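(* Let $s_n$, $t_n$, $u_n$, $v_n$ denote respectively the number of $2$-covers, proper $2$-covers, restricted $2$-covers, and restricted proper $2$-covers of $[n]=\{1,\dots,n\}$, let $l_n$ be the number of line graphs on $n$ labelled vertices, and let $B_{k}$ be the $k$th Bell number. Then, as $n\to\infty$, $$ s_n\sim t_n\sim B_{2n}2^{-n}\exp\left(-\frac12\log(2n/\log n)\right), $$ and $$ u_n\sim v_n\sim l_n\sim B_{2n}2^{-n}n^{-1/2}\exp\left(-\left[\frac12\log(2n/\log n)\right]^2\right). $$
   Context: A $2$-cover of $[n]$ is a finite multiset $\{S_1,\dots,S_m\}$ of nonempty subsets of $[n]$ (repetitions $S_i=S_j$ with $i\neq j$ allowed) such that every $d\in[n]$ belongs to $S_j$ for exactly two indices $j$. It is proper if $S_i\neq S_j$ whenever $i\neq j$, and restricted if $|S_i\cap S_j|\le 1$ for all $i\neq j$. The line graph $L(G)$ of a simple graph $G$ has vertex set $E(G)$, two vertices being adjacent iff the corresponding edges share an endpoint; a line graph on $n$ labelled vertices is a simple graph on vertex set $[n]$ isomorphic to $L(G)$ for some simple graph $G$. $B_k$ is the number of set partitions of $[k]$. For sequences, $a_n\sim b_n$ means $a_n/b_n\to1$. *)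

theory Defs
  imports Complex_Main
    "HOL-Library.Multiset"
    "HOL-Library.Disjoint_Sets"
    "HOL-Library.Landau_Symbols"
begin

definition bell :: "nat \<Rightarrow> nat" where
  "bell k = card {P. partition_on {1..k} P}"

definition two_cover :: "nat \<Rightarrow> nat set multiset \<Rightarrow> bool" where
  "two_cover n M \<longleftrightarrow>
     (\<forall>S \<in># M. S \<noteq> {} \<and> S \<subseteq> {1..n}) \<and>
     (\<forall>d \<in> {1..n}. size {#S \<in># M. d \<in> S#} = 2)"

definition proper_cover :: "'a set multiset \<Rightarrow> bool" where
  "proper_cover M \<longleftrightarrow> (\<forall>S. count M S \<le> 1)"

text \<open>
  The condition \<open>{#S, T#} \<subseteq># M\<close> says that \<open>S\<close> and \<open>T\<close> are members of \<open>M\<close> at two different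
  indices; \<open>S = T\<close> is included when \<open>S\<close> has multiplicity at least 2, so that a repeated set
  must be a singleton.
\<close>
definition restricted_cover :: "'a set multiset \<Rightarrow> bool" where
  "restricted_cover M \<longleftrightarrow> (\<forall>S T. {#S, T#} \<subseteq># M \<longrightarrow> card (S \<inter> T) \<le> 1)"

type_synonym 'a sgraph = "'a set \<times> 'a set set"

abbreviation (input) verts :: "'a sgraph \<Rightarrow> 'a set" where "verts \<equiv> fst"
abbreviation (input) edges :: "'a sgraph \<Rightarrow> 'a set set" where "edges \<equiv> snd"

definition simple_graph :: "'a sgraph \<Rightarrow> bool" where
  "simple_graph G \<longleftrightarrow> (\<forall>e \<in> edges G. e \<subseteq> verts G \<and> card e = 2)"

definition graph_iso :: "'a sgraph \<Rightarrow> 'b sgraph \<Rightarrow> bool" where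
  "graph_iso G H \<longleftrightarrow>
     (\<exists>f. bij_betw f (verts G) (verts H) \<and>
          (\<forall>x \<in> verts G. \<forall>y \<in> verts G. {x, y} \<in> edges G \<longleftrightarrow> {f x, f y} \<in> edges H))"

definition line_graph :: "'a sgraph \<Rightarrow> 'a set sgraph" where
  "line_graph G =
     (edges G, {{e, f} | e f. e \<in> edges G \<and> f \<in> edges G \<and> e \<noteq> f \<and> e \<inter> f \<noteq> {}})"

text \<open>
  Taking the vertices of \<open>G\<close> from \<open>nat\<close> loses nothing, see \<open>graph_iso_line_graph_nat\<close> below.
\<close>
definition labelled_line_graph :: "nat \<Rightarrow> nat sgraph \<Rightarrow> bool" where
  "labelled_line_graph n H \<longleftrightarrow>
     simple_graph H \<and> verts H = {1..n} \<and>
     (\<exists>G :: nat sgraph. simple_graph G \<and> graph_iso H (line_graph G))"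

lemma graph_iso_line_graph_nat:
  fixes H :: "'b sgraph" and G :: "'a sgraph"
  assumes G: "simple_graph G" and fin: "finite (verts H)" and iso: "graph_iso H (line_graph G)"
  shows "\<exists>G' :: nat sgraph. simple_graph G' \<and> graph_iso H (line_graph G')"
proof -
  obtain f where f: "bij_betw f (verts H) (edges G)"
    and fe: "\<And>x y. x \<in> verts H \<Longrightarrow> y \<in> verts H \<Longrightarrow>
      {x, y} \<in> edges H \<longleftrightarrow> {f x, f y} \<in> edges (line_graph G)"
    using iso by (auto simp: graph_iso_def line_graph_def)
  define U where "U = \<Union> (edges G)"
  have card2: "card e = 2" if "e \<in> edges G" for e
    using G that by (auto simp: simple_graph_def)
  have "finite (edges G)"
    using f fin bij_betw_finite by blast
  then have "finite U"
    unfolding U_def using card2 by (metis card.infinite finite_Union zero_neq_numeral)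
  then obtain g :: "'a \<Rightarrow> nat" where g: "inj_on g U"
    using finite_imp_inj_to_nat_seg by metis
  have sub: "e \<subseteq> U" if "e \<in> edges G" for e
    using that by (auto simp: U_def)
  define G' :: "nat sgraph" where "G' = (g ` U, (`) g ` edges G)"
  have ginj: "inj_on ((`) g) (edges G)"
    using g sub by (meson inj_on_image_eq_iff inj_onI)
  have line': "{a, b} \<in> edges (line_graph K) \<longleftrightarrow> a \<in> edges K \<and> b \<in> edges K \<and> a \<noteq> b \<and> a \<inter> b \<noteq> {}"
    for a b :: "nat set" and K
    by (auto simp: line_graph_def doubleton_eq_iff)
  have line'': "{a, b} \<in> edges (line_graph G) \<longleftrightarrow> a \<in> edges G \<and> b \<in> edges G \<and> a \<noteq> b \<and> a \<inter> b \<noteq> {}"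
    for a b
    by (auto simp: line_graph_def doubleton_eq_iff)
  have "simple_graph G'"
    using sub card2 g
    by (auto simp: simple_graph_def G'_def card_image inj_on_subset)
  moreover have "graph_iso H (line_graph G')"
    unfolding graph_iso_def
  proof (intro exI conjI ballI)
    have "bij_betw ((`) g) (edges G) (edges G')"
      using ginj by (simp add: G'_def bij_betw_def)
    then show "bij_betw ((`) g \<circ> f) (verts H) (verts (line_graph G'))"
      using bij_betw_trans[OF f] by (simp add: line_graph_def)
    fix x y assume xy: "x \<in> verts H" "y \<in> verts H"
    then have e: "f x \<in> edges G" "f y \<in> edges G"
      using f by (auto dest: bij_betwE)
    have "g ` f x \<inter> g ` f y = g ` (f x \<inter> f y)"
      using inj_on_image_Int[OF g sub sub] e by simp
    moreover have "g ` f x = g ` f y \<longleftrightarrow> f x = f y"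
      using ginj e by (auto dest: inj_onD)
    ultimately show "({x, y} \<in> edges H) \<longleftrightarrow>
        ({((`) g \<circ> f) x, ((`) g \<circ> f) y} \<in> edges (line_graph G'))"
      using e unfolding fe[OF xy] line' line'' by (simp add: G'_def)
  qed
  ultimately show ?thesis by blast
qed

end

theory Submission
  imports Defs "HOL-Real_Asymp.Real_Asymp" "HOL-Combinatorics.Multiset_Permutations"
begin

text \<open>
  Writing a cover as a list of $m$ possibly empty sets turns a 2-cover into a map from $[n]$ to the
  2-subsets of $[m]$, and a restricted one into an injective map. Up to the symmetry of repeated sets,
  this gives Dobinski-type series
  $\frac1e\sum_m \binom m2^n/m!$ and $\frac1e\sum_m \binom m2\left(\binom m2-1\right)\cdots\left(\binom m2-n+1\right)/m!$,
  to be compared with $B_{2n} = \frac1e\sum_m m^{2n}/m!$. The latter is concentrated at $m \approx \mu$ with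
  $\mu \ln \mu = 2n$, where the ratios of the terms are close to $2^{-n} e^{-n/\mu}$ and
  $2^{-n} e^{-n/\mu - n^2/\mu^2}$; expressing everything through $\theta = \ln \mu$ gives the stated formulas.

  Covers with repeated sets, and restricted covers not determined by their intersection graph, split off
  a nonempty union of components. There are too few of them since $X_{n-k}/X_n$ is at most about
  $n^{-3k/2}$ for both series while only $\binom nk$ choices of the elements split off are available.
\<close>

section \<open>Concentration of the series of $m^N/m!$\<close>

text \<open>Bell numbers are never evaluated; only ratios to the series of m^(2n)/m! are estimated.
  The relative half-width \<delta> = e^(-\<theta>/4) of the window meets two opposite demands:
  \<theta>^2 \<delta> must tend to 0, or else the factor e^(-n^2/\<mu>^2) would vary over the
  window, and \<delta>^2 \<mu> must be large enough for a tail of relative size about e^(-\<delta>^2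
  \<mu>/4) to be negligible against e^(-\<theta>^2/4). The series do not count covers exactly, since
  a cover with repeated sets has weight below 1. Their values lie between the number of proper
  covers and that of all covers. Bounding the difference must not presuppose a count of all covers:
  splitting off all repeated sets at once leaves a proper remainder, which the series does bound.
  For line graphs the obstacle is Whitney's: a triangle and a claw have the same line graph. Covers
  whose claws can be told from triangles by a parity test are recovered from the graph; the others
  have a component on four vertices. There the remainder may be nonproper, but it has lost at most
  six elements, so the count of all covers, known by then, applies to it.\<close>

lemma upper_tail_le:
  fixes a :: "nat \<Rightarrow> real"
  assumes nonneg: "\<And>m. a m \<ge> 0" and summ: "summable a" and q: "q > 1"
    and step: "\<And>m. m \<ge> p \<Longrightarrow> a (Suc m) * q \<le> a m"
  shows "(\<Sum>m. if p + J \<le> m then a m else 0) \<le> suminf a * (1 / q) ^ J * (q / (q - 1))"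
proof -
  have decay: "a (p + j) \<le> suminf a * (1 / q) ^ j" for j
  proof (induction j)
    case 0
    have "sum a {p} \<le> suminf a"
      by (rule sum_le_suminf) (use nonneg summ in auto)
    then show ?case by simp
  next
    case (Suc j)
    have "a (p + Suc j) \<le> a (p + j) / q"
      using step[of "p + j"] q by (simp add: field_simps)
    also have "\<dots> \<le> suminf a * (1 / q) ^ j / q"
      using Suc q by (intro divide_right_mono) auto
    finally show ?case by simp
  qed
  let ?f = "\<lambda>m. if p + J \<le> m then a m else 0"
  have sf: "summable ?f"
    by (rule summable_comparison_test'[OF summ]) (use nonneg in auto)
  have geo: "(\<lambda>j. (1 / q) ^ j) sums (1 / (1 - 1 / q))"
    by (rule geometric_sums) (use q in auto)
  then have geo': "(\<lambda>j. suminf a * (1 / q) ^ J * (1 / q) ^ j) sums (suminf a * (1 / q) ^ J * (1 / (1 - 1 / q)))"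
    by (rule sums_mult)
  have "suminf ?f = (\<Sum>j. ?f (j + (p + J))) + (\<Sum>i<p + J. ?f i)"
    by (rule suminf_split_initial_segment[OF sf])
  also have "(\<Sum>i<p + J. ?f i) = 0"
    by (intro sum.neutral) auto
  also have "(\<Sum>j. ?f (j + (p + J))) \<le> (\<Sum>j. suminf a * (1 / q) ^ J * (1 / q) ^ j)"
  proof (rule suminf_le)
    show "?f (j + (p + J)) \<le> suminf a * (1 / q) ^ J * (1 / q) ^ j" for j
      using decay[of "J + j"] by (simp add: power_add algebra_simps)
    show "summable (\<lambda>j. ?f (j + (p + J)))"
      using sf by (rule summable_ignore_initial_segment)
  qed (use geo' in \<open>simp add: sums_iff\<close>)
  also have "\<dots> = suminf a * (1 / q) ^ J * (1 / (1 - 1 / q))"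
    using geo' by (simp add: sums_iff)
  also have "1 / (1 - 1 / q) = q / (q - 1)"
    using q by (simp add: field_simps)
  finally show ?thesis by simp
qed

lemma lower_tail_le:
  fixes a :: "nat \<Rightarrow> real"
  assumes nonneg: "\<And>m. a m \<ge> 0" and summ: "summable a" and q: "q > 1"
    and step: "\<And>m. m < p \<Longrightarrow> a m * q \<le> a (Suc m)"
  shows "(\<Sum>m. if m + J \<le> p then a m else 0) \<le> suminf a * (1 / q) ^ J * (real p + 1)"
proof -
  have decay: "a (p - j) \<le> suminf a * (1 / q) ^ j" if "j \<le> p" for j
    using that
  proof (induction j)
    case 0
    have "sum a {p} \<le> suminf a"
      by (rule sum_le_suminf) (use nonneg summ in auto)
    then show ?case by simp
  next
    case (Suc j)
    have "Suc (p - Suc j) = p - j" using Suc.prems by simp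
    then have "a (p - Suc j) \<le> a (p - j) / q"
      using step[of "p - Suc j"] q Suc.prems by (simp add: field_simps)
    also have "\<dots> \<le> suminf a * (1 / q) ^ j / q"
      using Suc q by (intro divide_right_mono) auto
    finally show ?case by simp
  qed
  have bound: "a m \<le> suminf a * (1 / q) ^ J" if "m + J \<le> p" for m
  proof -
    have "a m \<le> suminf a * (1 / q) ^ (p - m)"
      using decay[of "p - m"] that by simp
    also have "\<dots> \<le> suminf a * (1 / q) ^ J"
      using q that suminf_nonneg[OF summ nonneg]
      by (intro mult_left_mono power_decreasing) auto
    finally show ?thesis .
  qed
  have "(\<Sum>m. if m + J \<le> p then a m else 0) = (\<Sum>m\<le>p. if m + J \<le> p then a m else 0)"
    by (rule suminf_finite) auto
  also have "\<dots> \<le> (\<Sum>m\<le>p. suminf a * (1 / q) ^ J)"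
    using bound suminf_nonneg[OF summ nonneg] q by (intro sum_mono) auto
  finally show ?thesis by (simp add: algebra_simps)
qed

text \<open>After a shift by \<open>N\<close>, each of the \<open>N\<close> factors m + N is at most
  (N + 1)(m + i) with i running from 1 to N; the product of the m + i cancels against (m + N)! and
  leaves a multiple of the series of e.\<close>

lemma summable_power_div_fact: "summable (\<lambda>m. real m ^ N / fact m)"
proof -
  have "summable (\<lambda>m. real (m + N) ^ N / fact (m + N))"
  proof (rule summable_comparison_test')
    show "summable (\<lambda>m. (real N + 1) ^ N * (1 / fact m :: real))"
      using summable_exp[of 1] by (intro summable_mult) (simp add: field_simps)
    show "norm (real (m + N) ^ N / fact (m + N)) \<le> (real N + 1) ^ N * (1 / fact m)" if "m \<ge> 0" for m
    proof -
      have "(\<Prod>i\<in>{1..N}. real (m + N)) \<le> (\<Prod>i\<in>{1..N}. (real N + 1) * real (m + i))"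
      proof (intro prod_mono conjI)
        fix i assume "i \<in> {1..N}"
        then have "N \<le> N * i" by simp
        moreover have "(N + 1) * (m + i) = m + N * i + (i + N * m)" by (simp add: algebra_simps)
        ultimately have "m + N \<le> (N + 1) * (m + i)" by linarith
        then have "real (m + N) \<le> real ((N + 1) * (m + i))"
          by (rule of_nat_mono)
        then show "real (m + N) \<le> (real N + 1) * real (m + i)"
            by (simp only: of_nat_mult of_nat_add of_nat_1)
      qed auto
      also have "\<dots> = (real N + 1) ^ N * (\<Prod>i\<in>{1..N}. real (m + i))"
        by (simp add: prod.distrib)
      also have "(\<Prod>i\<in>{1..N}. real (m + i)) = fact (m + N) / fact m"
      proof (induction N)
        case (Suc N)
        have "(\<Prod>i\<in>{1..Suc N}. real (m + i)) = (\<Prod>i\<in>{1..N}. real (m + i)) * real (Suc (m + N))"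
          by simp
        also have "\<dots> = fact (Suc (m + N)) / fact m"
          unfolding Suc.IH fact_Suc by (simp add: mult.commute)
        finally show ?case by simp
      qed simp
      finally show ?thesis by (simp add: field_simps)
    qed
  qed
  then show ?thesis by (rule summable_iff_shift[THEN iffD1])
qed

text \<open>Consecutive terms have ratio (1 + 1/m)^N / (m + 1), and (1 + 1/m)^N lies between
  e^(N/(m+1)) and e^(N/m). Since N = \<theta> \<mu> and \<mu> = e^\<theta>, that power is at most
  \<mu> for m \<ge> \<mu> and at least \<mu> for m + 1 \<le> \<mu>.\<close>

lemma concentration:
  fixes \<delta> \<theta> :: real
  defines "\<mu> \<equiv> exp \<theta>" and "a \<equiv> \<lambda>N m. real m ^ N / fact m"
  assumes N: "real N = \<theta> * exp \<theta>" and \<theta>: "\<theta> > 0" and \<delta>: "\<delta> > 0" "\<delta> < 1"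
  shows "(\<Sum>m. if (1 - \<delta>) * \<mu> \<le> real m \<and> real m \<le> (1 + \<delta>) * \<mu> then 0 else a N m)
    \<le> suminf (a N) * ((1 + \<delta> / 2) powr (1 - \<delta> * \<mu> / 2) * (2 + 2 / \<delta> + \<mu>))"
proof -
  define q where "q = 1 + \<delta> / 2"
  have q: "q > 1" using \<delta> by (simp add: q_def)
  have \<mu>: "\<mu> > 0" by (simp add: \<mu>_def)
  have N0: "N > 0"
    using N \<theta> by (metis exp_gt_zero mult_pos_pos of_nat_0_less_iff)
  have Nm: "real N = \<theta> * \<mu>" using N by (simp add: \<mu>_def)
  \<comment> \<open>Half of the window is spent on reaching the range where the ratio is bounded
    away from 1, the other half, about \<open>J\<close> terms, on accumulating the decay
    q^(-J).\<close>
  define J where "J = nat \<lfloor>\<delta> * \<mu> / 2\<rfloor>"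
  define p where "p = nat \<lceil>(1 + \<delta> / 2) * \<mu>\<rceil>"
  define p' where "p' = nat \<lfloor>(1 - \<delta> / 2) * \<mu>\<rfloor>"
  have summ: "summable (a N)"
    unfolding a_def by (rule summable_power_div_fact)
  have nonneg: "a N m \<ge> 0" for m by (simp add: a_def)
  have S: "suminf (a N) \<ge> 0" using summ nonneg by (rule suminf_nonneg)
  have up: "a N (Suc m) * q \<le> a N m" if "m \<ge> p" for m
  proof -
    have m: "real m \<ge> q * \<mu>"
      using that by (auto simp: p_def q_def)
    moreover have "q * \<mu> > 0" using q \<mu> by simp
    ultimately have m0: "real m > 0" by linarith
    have m\<mu>: "real m \<ge> \<mu>" using m q \<mu> by (smt (verit) mult_less_cancel_right2)
    have "(1 + 1 / real m) ^ N \<le> exp (1 / real m) ^ N"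
      by (intro power_mono) auto
    also have "\<dots> = exp (real N / real m)"
      by (simp flip: exp_of_nat_mult)
    also have "\<dots> \<le> exp \<theta>"
      using m\<mu> m0 \<theta> by (simp add: Nm field_simps)
    finally have *: "(1 + 1 / real m) ^ N \<le> \<mu>" by (simp add: \<mu>_def)
    have "real (Suc m) ^ N = real m ^ N * (1 + 1 / real m) ^ N"
      using m0 by (simp add: power_mult_distrib[symmetric] field_simps)
    then have "a N (Suc m) * q = a N m * ((1 + 1 / real m) ^ N * q / (real m + 1))"
      by (simp add: a_def field_simps)
    also have "\<dots> \<le> a N m * 1"
    proof (intro mult_left_mono nonneg)
      have "(1 + 1 / real m) ^ N * q \<le> \<mu> * q"
        using * q by (intro mult_right_mono) auto
      then show "(1 + 1 / real m) ^ N * q / (real m + 1) \<le> 1"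
        using m m0 by (subst divide_le_eq_1_pos) (simp_all add: mult.commute)
    qed
    finally show ?thesis by simp
  qed
  have down: "a N m * q \<le> a N (Suc m)" if "m < p'" for m
  proof (cases "m = 0")
    case True
    then show ?thesis using N0 by (simp add: a_def power_0_left)
  next
    case False
    then have m0: "real m > 0" by simp
    have m: "real m + 1 \<le> (1 - \<delta> / 2) * \<mu>"
      using that unfolding p'_def by linarith
    have m\<mu>: "real m + 1 \<le> \<mu>"
      using m \<delta> \<mu> by (smt (verit) divide_pos_pos mult_less_cancel_right2)
    have "1 / (1 + 1 / real m) \<le> exp (- (1 / (real m + 1)))"
      using exp_ge_add_one_self[of "- (1 / (real m + 1))"] m0 by (simp add: field_simps)
    then have "exp (1 / (real m + 1)) \<le> 1 + 1 / real m"
      using m0 by (simp add: exp_minus field_simps)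
    then have "exp (1 / (real m + 1)) ^ N \<le> (1 + 1 / real m) ^ N"
      by (intro power_mono) auto
    moreover have "exp (1 / (real m + 1)) ^ N = exp (real N / (real m + 1))"
      by (simp flip: exp_of_nat_mult)
    moreover have "\<theta> \<le> real N / (real m + 1)"
      using mult_left_mono[OF m\<mu>, of \<theta>] m0 \<theta> by (simp add: Nm field_simps)
    ultimately have *: "(1 + 1 / real m) ^ N \<ge> \<mu>"
      unfolding \<mu>_def by (metis exp_le_cancel_iff order_trans)
    have "q * (real m + 1) \<le> q * ((1 - \<delta> / 2) * \<mu>)"
      using m q by (intro mult_left_mono) auto
    also have "\<dots> = (1 - \<delta>\<^sup>2 / 4) * \<mu>" by (simp add: q_def field_simps power2_eq_square)
    also have "\<dots> \<le> 1 * \<mu>" using \<mu> by (intro mult_right_mono) auto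
    finally have **: "q * (real m + 1) \<le> \<mu>" by simp
    have "real (Suc m) ^ N = real m ^ N * (1 + 1 / real m) ^ N"
      using m0 by (simp add: power_mult_distrib[symmetric] field_simps)
    then have eq: "a N (Suc m) = a N m * ((1 + 1 / real m) ^ N / (real m + 1))"
      by (simp add: a_def field_simps)
    have "q \<le> (1 + 1 / real m) ^ N / (real m + 1)"
      using * ** m0 by (subst pos_le_divide_eq) auto
    then have "a N m * q \<le> a N m * ((1 + 1 / real m) ^ N / (real m + 1))"
      by (intro mult_left_mono nonneg)
    then show ?thesis by (simp add: eq)
  qed
  let ?W = "\<lambda>m. (1 - \<delta>) * \<mu> \<le> real m \<and> real m \<le> (1 + \<delta>) * \<mu>"
  let ?f = "\<lambda>m. if p + J \<le> m then a N m else 0"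
  let ?g = "\<lambda>m. if m + J \<le> p' then a N m else 0"
  have Jle: "real J \<le> \<delta> * \<mu> / 2" "real J \<ge> \<delta> * \<mu> / 2 - 1"
    using \<delta> \<mu> unfolding J_def by (auto simp: le_nat_floor) linarith+
  have pw: "(if ?W m then 0 else a N m) \<le> ?f m + ?g m" for m
  proof (cases "?W m")
    case True
    then show ?thesis using nonneg by simp
  next
    case False
    then consider "real m > (1 + \<delta>) * \<mu>" | "real m < (1 - \<delta>) * \<mu>" by linarith
    then have "p + J \<le> m \<or> m + J \<le> p'"
    proof cases
      case 1
      have "(1 + \<delta> / 2) * \<mu> \<ge> 0" using \<delta> \<mu> by simp
      then have "real p < (1 + \<delta> / 2) * \<mu> + 1" unfolding p_def by linarith
      then have "real p + real J < real m + 1" using 1 Jle by (simp add: algebra_simps)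
      then show ?thesis by linarith
    next
      case 2
      have "(1 - \<delta> / 2) * \<mu> \<ge> 0" using \<delta> \<mu> by simp
      then have "real p' > (1 - \<delta> / 2) * \<mu> - 1" unfolding p'_def by linarith
      then have "real m + real J < real p' + 1" using 2 Jle by (simp add: algebra_simps)
      then show ?thesis by linarith
    qed
    then show ?thesis using nonneg by auto
  qed
  have sf: "summable ?f" and sg: "summable ?g" and sw: "summable (\<lambda>m. if ?W m then 0 else a N m)"
    by (rule summable_comparison_test'[OF summ]; use nonneg in auto)+
  have "(\<Sum>m. if ?W m then 0 else a N m) \<le> (\<Sum>m. ?f m + ?g m)"
    by (intro suminf_le pw summable_add sf sg sw)
  also have "\<dots> = suminf ?f + suminf ?g"
    by (rule suminf_add[symmetric, OF sf sg])
  also have "\<dots> \<le> suminf (a N) * (1 / q) ^ J * (q / (q - 1)) + suminf (a N) * (1 / q) ^ J * (real p' + 1)"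
    by (intro add_mono upper_tail_le lower_tail_le nonneg summ q up down)
  also have "\<dots> = suminf (a N) * ((1 / q) ^ J * (q / (q - 1) + real p' + 1))"
    by (simp add: algebra_simps)
  \<comment> \<open>The 1 in the exponent pays for the floor in \<open>J\<close>; the last factor
    collects q/(q - 1) = 1 + 2/\<delta> and the number of terms in the lower tail.\<close>
  also have "\<dots> \<le> suminf (a N) * (q powr (1 - \<delta> * \<mu> / 2) * (2 + 2 / \<delta> + \<mu>))"
  proof (intro mult_left_mono mult_mono S)
    have "(1 / q) ^ J = q powr (- real J)"
      using q by (simp add: powr_minus powr_realpow power_one_over inverse_eq_divide)
    also have "\<dots> \<le> q powr (1 - \<delta> * \<mu> / 2)"
      using q Jle by (intro powr_mono) auto
    finally show "(1 / q) ^ J \<le> q powr (1 - \<delta> * \<mu> / 2)" .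
    have "q / (q - 1) = 2 / \<delta> + 1" using \<delta> by (simp add: q_def field_simps)
    moreover have "real p' \<le> \<mu>"
    proof -
      have "(1 - \<delta> / 2) * \<mu> \<ge> 0" "(1 - \<delta> / 2) * \<mu> \<le> 1 * \<mu>" using \<delta> \<mu> by (auto intro: mult_right_mono)
      then show ?thesis unfolding p'_def by linarith
    qed
    ultimately show "q / (q - 1) + real p' + 1 \<le> 2 + 2 / \<delta> + \<mu>" by simp
  qed (use q in auto)
  finally show ?thesis by (simp add: q_def)
qed

section \<open>Asymptotics of the weighted series\<close>

text \<open>
  The terms $m^{2n}/m!$ peak where $m \ln m = 2n$, that is at $m = e^\theta$ with $\theta e^\theta = 2n$.
\<close>

definition saddle :: "nat \<Rightarrow> real" where
  "saddle n = (SOME x. x \<ge> 0 \<and> x * exp x = 2 * real n)"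

lemma saddle: "saddle n \<ge> 0" "saddle n * exp (saddle n) = 2 * real n"
proof -
  have "\<exists>x. 0 \<le> x \<and> x \<le> 2 * real n \<and> x * exp x = 2 * real n"
  proof (rule IVT')
    show "2 * real n \<le> 2 * real n * exp (2 * real n)"
      using mult_left_mono[of 1 "exp (2 * real n)" "2 * real n"] by simp
  qed (auto intro!: continuous_intros)
  then have "\<exists>x. x \<ge> 0 \<and> x * exp x = 2 * real n" by blast
  from someI_ex[OF this] show "saddle n \<ge> 0" "saddle n * exp (saddle n) = 2 * real n"
    by (simp_all add: saddle_def)
qed

lemma saddle_at_top: "filterlim saddle at_top sequentially"
  unfolding filterlim_at_top_ge[where c = 0]
proof (intro allI impI)
  fix K :: real assume K: "K \<ge> 0"
  have "\<forall>\<^sub>F n in sequentially. 2 * real n \<ge> K * exp K"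
    by real_asymp
  then show "\<forall>\<^sub>F n in sequentially. K \<le> saddle n"
  proof eventually_elim
    case (elim n)
    show ?case
    proof (rule ccontr)
      assume "\<not> K \<le> saddle n"
      then have "saddle n * exp (saddle n) < K * exp K"
        using saddle(1)[of n] by (intro mult_strict_mono') auto
      with elim saddle(2)[of n] show False by simp
    qed
  qed
qed

text \<open>The fraction from \<open>concentration\<close> for \<delta> = e^(-\<theta>/4). It decays
  roughly like exp(-e^(\<theta>/2)/4), because \<delta>^2 e^\<theta> = e^(\<theta>/2).\<close>

definition tail_bound :: "real \<Rightarrow> real" where
  "tail_bound \<theta> = (1 + exp (- \<theta> / 4) / 2) powr (1 - exp (- \<theta> / 4) * exp \<theta> / 2) *
     (2 + 2 / exp (- \<theta> / 4) + exp \<theta>)"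

text \<open>
  Outside the window the weights are only bounded by 1. This suffices because the tail of the
  unweighted series, at most a fraction \<open>tail_bound \<theta>\<close>, is far smaller than $e^{-\theta^2}$.
\<close>

lemma weighted_series_asymp_equiv:
  fixes g :: "nat \<Rightarrow> nat \<Rightarrow> real" and \<gamma> lo hi :: "real \<Rightarrow> real"
  assumes g: "\<And>n m. 0 \<le> g n m" "\<And>n m. g n m \<le> 1"
    and window: "\<forall>\<^sub>F n in sequentially. \<forall>m. (1 - exp (- saddle n / 4)) * exp (saddle n) \<le> real m \<longrightarrow>
        real m \<le> (1 + exp (- saddle n / 4)) * exp (saddle n) \<longrightarrow>
        lo (saddle n) \<le> g n m \<and> g n m \<le> hi (saddle n)"
    and pos: "\<And>\<theta>. \<gamma> \<theta> > 0" "\<And>\<theta>. lo \<theta> \<ge> 0"  "\<And>\<theta>. hi \<theta> \<ge> 0"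
    and lo: "((\<lambda>\<theta>. lo \<theta> / \<gamma> \<theta>) \<longlongrightarrow> 1) at_top"
    and hi: "((\<lambda>\<theta>. hi \<theta> / \<gamma> \<theta>) \<longlongrightarrow> 1) at_top"
    and tail: "((\<lambda>\<theta>. tail_bound \<theta>) \<longlongrightarrow> 0) at_top" "((\<lambda>\<theta>. tail_bound \<theta> / \<gamma> \<theta>) \<longlongrightarrow> 0) at_top"
  shows "(\<lambda>n. \<Sum>m. g n m * (real m ^ (2 * n) / fact m)) \<sim>[at_top]
    (\<lambda>n. \<gamma> (saddle n) * (\<Sum>m. real m ^ (2 * n) / fact m))"
proof -
  define a where "a = (\<lambda>n m. real m ^ (2 * n) / fact m)"
  have a0: "a n m \<ge> 0" for n m by (simp add: a_def)
  have asum: "summable (a n)" for n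
    unfolding a_def by (rule summable_power_div_fact)
  have S: "suminf (a n) > 0" for n
    by (rule suminf_pos2[where i = 1, OF asum]) (auto simp: a_def)
  have summg: "summable (\<lambda>m. g n m * a n m)" for n
    by (rule summable_comparison_test'[OF asum])
       (use g a0 in \<open>auto simp: abs_mult intro!: mult_left_le_one_le\<close>)
  have bounds: "\<forall>\<^sub>F n in sequentially.
      lo (saddle n) * (1 - tail_bound (saddle n)) / \<gamma> (saddle n) \<le>
        (\<Sum>m. g n m * a n m) / (\<gamma> (saddle n) * suminf (a n)) \<and>
      (\<Sum>m. g n m * a n m) / (\<gamma> (saddle n) * suminf (a n)) \<le>
        hi (saddle n) / \<gamma> (saddle n) + tail_bound (saddle n) / \<gamma> (saddle n)"
    using window eventually_gt_at_top[of 0]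
  proof eventually_elim
    case (elim n)
    define \<theta> where "\<theta> = saddle n"
    define W where "W = (\<lambda>m. (1 - exp (- \<theta> / 4)) * exp \<theta> \<le> real m \<and> real m \<le> (1 + exp (- \<theta> / 4)) * exp \<theta>)"
    have \<theta>: "\<theta> > 0"
      using saddle[of n] elim by (cases "\<theta> = 0") (auto simp: \<theta>_def)
    have eqN: "real (2 * n) = \<theta> * exp \<theta>" using saddle(2)[of n] by (simp add: \<theta>_def)
    let ?\<tau> = "\<lambda>m. if W m then 0 else a n m"
    have \<tau>: "suminf ?\<tau> \<le> suminf (a n) * tail_bound \<theta>"
      using concentration[OF eqN \<theta>, of "exp (- \<theta> / 4)"] \<theta>
      unfolding W_def a_def tail_bound_def by simp
    have s\<tau>: "summable ?\<tau>"
      by (rule summable_comparison_test'[OF asum[of n]]) (use a0 in auto)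
    have gW: "lo \<theta> \<le> g n m" "g n m \<le> hi \<theta>" if "W m" for m
      using elim that by (auto simp: W_def \<theta>_def)
    have "(\<Sum>m. g n m * a n m) \<le> (\<Sum>m. hi \<theta> * a n m + ?\<tau> m)"
    proof (intro suminf_le summable_add summable_mult asum s\<tau> summg)
      show "g n m * a n m \<le> hi \<theta> * a n m + ?\<tau> m" for m
      proof (cases "W m")
        case False
        have "g n m * a n m \<le> 1 * a n m" by (intro mult_right_mono g a0)
        moreover have "hi \<theta> * a n m \<ge> 0" using pos a0 by simp
        ultimately show ?thesis using False by simp
      qed (use gW a0 in \<open>auto intro: mult_right_mono\<close>)
    qed
    also have "\<dots> = hi \<theta> * suminf (a n) + suminf ?\<tau>"
      by (simp add: suminf_add[symmetric] summable_mult asum s\<tau> suminf_mult)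
    also have "\<dots> \<le> hi \<theta> * suminf (a n) + suminf (a n) * tail_bound \<theta>"
      using \<tau> by simp
    finally have upper: "(\<Sum>m. g n m * a n m) \<le> (hi \<theta> + tail_bound \<theta>) * suminf (a n)"
      by (simp add: algebra_simps)
    have "lo \<theta> * (suminf (a n) - suminf (a n) * tail_bound \<theta>) \<le> lo \<theta> * (suminf (a n) - suminf ?\<tau>)"
      using \<tau> pos by (intro mult_left_mono) auto
    also have "\<dots> = (\<Sum>m. lo \<theta> * (a n m - ?\<tau> m))"
      by (simp add: suminf_diff[symmetric] summable_diff asum s\<tau> suminf_mult)
    also have "\<dots> \<le> (\<Sum>m. g n m * a n m)"
    proof (intro suminf_le summable_diff summable_mult asum s\<tau> summg)
      show "lo \<theta> * (a n m - ?\<tau> m) \<le> g n m * a n m" for m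
        using gW[of m] g[of n m] a0[of n m] by (cases "W m") (auto intro: mult_right_mono)
    qed
    finally have lower: "lo \<theta> * (1 - tail_bound \<theta>) * suminf (a n) \<le> (\<Sum>m. g n m * a n m)"
      by (simp add: algebra_simps)
    have nz: "\<gamma> \<theta> * suminf (a n) \<ge> 0" "suminf (a n) \<noteq> 0"
      using pos(1)[of \<theta>] S[of n] by auto
    show ?case
      unfolding \<theta>_def[symmetric]
      using divide_right_mono[OF upper nz(1)] divide_right_mono[OF lower nz(1)] nz(2)
      by (simp add: add_divide_distrib)
  qed
  have lo': "((\<lambda>\<theta>. lo \<theta> * (1 - tail_bound \<theta>) / \<gamma> \<theta>) \<longlongrightarrow> 1) at_top"
    using tendsto_mult[OF lo tendsto_diff[OF tendsto_const[of 1] tail(1)]] by simp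
  have hi': "((\<lambda>\<theta>. hi \<theta> / \<gamma> \<theta> + tail_bound \<theta> / \<gamma> \<theta>) \<longlongrightarrow> 1) at_top"
    using tendsto_add[OF hi tail(2)] by simp
  have "(\<lambda>n. (\<Sum>m. g n m * a n m) / (\<gamma> (saddle n) * suminf (a n))) \<longlonglongrightarrow> 1"
    using bounds unfolding eventually_conj_iff
    by (intro tendsto_sandwich[OF _ _ filterlim_compose[OF lo' saddle_at_top]
          filterlim_compose[OF hi' saddle_at_top]]) auto
  moreover have "\<forall>\<^sub>F n in sequentially. \<gamma> (saddle n) * suminf (a n) \<noteq> 0"
    using pos S by (intro always_eventually) (simp add: less_imp_neq[symmetric])
  ultimately show ?thesis
    unfolding a_def by (intro asymp_equivI') simp_all
qed

lemma tail_bound_tendsto: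
  "((\<lambda>\<theta>. tail_bound \<theta>) \<longlongrightarrow> 0) at_top"
  "((\<lambda>\<theta>. tail_bound \<theta> / exp (- \<theta> / 2)) \<longlongrightarrow> 0) at_top"
  "((\<lambda>\<theta>. tail_bound \<theta> / exp (- \<theta> / 2 - \<theta>\<^sup>2 / 4)) \<longlongrightarrow> 0) at_top"
  unfolding tail_bound_def by real_asymp+

section \<open>Falling factorials and the normalised series\<close>

text \<open>Truncated subtraction is harmless: for \<open>c < n\<close> the factor with i = c is 0,
  so in all cases this is the number of injections from \<open>n\<close> points into
  \<open>c\<close> points.\<close>

definition ffact :: "nat \<Rightarrow> nat \<Rightarrow> nat" where
  "ffact c n = (\<Prod>i<n. c - i)"

lemma ffact_le_power: "ffact c n \<le> c ^ n"
  using prod_mono[of "{..<n}" "\<lambda>i. c - i" "\<lambda>_. c"] by (simp add: ffact_def)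

text \<open>With x = i/c, use 1 - x \<le> e^(-x) above and ln (1 - x) \<ge> -x - 2 x^2 below; the
  latter holds for x \<le> 1/2, hence \<open>2 * n \<le> c\<close>. On the window c is about
  \<mu>^2/2, so n^2/(2c) is about \<theta>^2/4 and the error 2 n^3/c^2 about
  \<theta>^3/\<mu>.\<close>

lemma ffact_bounds:
  assumes "2 * n \<le> c" "0 < c"
  shows "exp (- real n * (real n - 1) / (2 * real c)) * real c ^ n \<ge> real (ffact c n)"
    and "exp (- (real n)\<^sup>2 / (2 * real c) - 2 * real n ^ 3 / (real c)\<^sup>2) * real c ^ n \<le> real (ffact c n)"
proof -
  have eq: "real (ffact c n) = (\<Prod>i<n. 1 - real i / real c) * real c ^ n"
  proof -
    have "real (ffact c n) = (\<Prod>i<n. (1 - real i / real c) * real c)"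
      unfolding ffact_def of_nat_prod
      using assms by (intro prod.cong) (auto simp: field_simps of_nat_diff)
    also have "\<dots> = (\<Prod>i<n. 1 - real i / real c) * real c ^ n"
      by (simp add: prod.distrib)
    finally show ?thesis .
  qed
  have sum_i: "(\<Sum>i<n. real i) = real n * (real n - 1) / 2"
    by (induction n) (auto simp: field_simps)
  have half: "real i / real c \<le> 1 / 2" if "i < n" for i
    using that assms by (simp add: field_simps)
  have "(\<Prod>i<n. 1 - real i / real c) \<le> (\<Prod>i<n. exp (- (real i / real c)))"
  proof (intro prod_mono conjI)
    fix i assume "i \<in> {..<n}"
    then have "i < n" by simp
    from half[OF this] show "0 \<le> 1 - real i / real c" by linarith
    show "1 - real i / real c \<le> exp (- (real i / real c))"
      using exp_ge_add_one_self[of "- (real i / real c)"] by simp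
  qed
  also have "\<dots> = exp (- (\<Sum>i<n. real i) / real c)"
    by (simp add: exp_sum[symmetric] sum_negf sum_divide_distrib)
  also have "\<dots> = exp (- real n * (real n - 1) / (2 * real c))"
    by (simp add: sum_i)
  finally show "exp (- real n * (real n - 1) / (2 * real c)) * real c ^ n \<ge> real (ffact c n)"
    unfolding eq by (intro mult_right_mono) auto
  have "- (real n)\<^sup>2 / (2 * real c) - 2 * real n ^ 3 / (real c)\<^sup>2
      \<le> (\<Sum>i<n. - (real i / real c) - 2 * (real n / real c)\<^sup>2)"
  proof -
    have "(\<Sum>i<n. - (real i / real c) - 2 * (real n / real c)\<^sup>2)
        = - (\<Sum>i<n. real i) / real c - real n * (2 * (real n / real c)\<^sup>2)"
      by (simp add: sum_subtractf sum_negf sum_divide_distrib)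
    also have "\<dots> = - (real n * (real n - 1)) / (2 * real c) - 2 * real n ^ 3 / (real c)\<^sup>2"
      by (simp add: sum_i power2_eq_square power3_eq_cube)
    finally have *: "(\<Sum>i<n. - (real i / real c) - 2 * (real n / real c)\<^sup>2) =
      - (real n * (real n - 1)) / (2 * real c) - 2 * real n ^ 3 / (real c)\<^sup>2" .
    have "- (real n)\<^sup>2 \<le> - (real n * (real n - 1))"
      by (simp add: power2_eq_square algebra_simps)
    then have "- (real n)\<^sup>2 / (2 * real c) \<le> - (real n * (real n - 1)) / (2 * real c)"
      by (intro divide_right_mono) auto
    then show ?thesis unfolding * by simp
  qed
  also have "\<dots> \<le> (\<Sum>i<n. ln (1 - real i / real c))"
  proof (intro sum_mono)
    fix i assume "i \<in> {..<n}"
    then have "(real i / real c)\<^sup>2 \<le> (real n / real c)\<^sup>2"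
      by (intro power_mono divide_right_mono) auto
    moreover from half[of i] \<open>i \<in> {..<n}\<close>
    have "- (real i / real c) - 2 * (real i / real c)\<^sup>2 \<le> ln (1 - real i / real c)"
      by (intro ln_one_minus_pos_lower_bound) simp_all
    ultimately show "- (real i / real c) - 2 * (real n / real c)\<^sup>2 \<le> ln (1 - real i / real c)"
      by linarith
  qed
  finally have "exp (- (real n)\<^sup>2 / (2 * real c) - 2 * real n ^ 3 / (real c)\<^sup>2)
      \<le> exp (\<Sum>i<n. ln (1 - real i / real c))" by simp
  also have "\<dots> = (\<Prod>i<n. 1 - real i / real c)"
  proof -
    have "exp (ln (1 - real i / real c)) = 1 - real i / real c" if "i < n" for i
      using half[OF that] by (intro exp_ln) linarith
    then show ?thesis by (simp add: exp_sum)
  qed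
  finally show "exp (- (real n)\<^sup>2 / (2 * real c) - 2 * real n ^ 3 / (real c)\<^sup>2) * real c ^ n \<le> real (ffact c n)"
    unfolding eq by (intro mult_right_mono) auto
qed

definition dobinski :: "nat \<Rightarrow> real" where
  "dobinski n = (\<Sum>m. real m ^ (2 * n) / fact m)"

definition cover_series :: "nat \<Rightarrow> real" where
  "cover_series n = (\<Sum>m. real (m choose 2) ^ n / fact m)"

definition restricted_series :: "nat \<Rightarrow> real" where
  "restricted_series n = (\<Sum>m. real (ffact (m choose 2) n) / fact m)"

lemma real_choose_two: "real (m choose 2) = real m * (real m - 1) / 2"
proof -
  have "even (m * (m - 1))" by (cases m) auto
  then show ?thesis by (cases m) (simp_all add: choose_two real_of_nat_div algebra_simps)
qed

lemma choose_two_power_le: "2 ^ n * real (m choose 2) ^ n \<le> real m ^ (2 * n)"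
proof -
  have "2 * real (m choose 2) \<le> (real m)\<^sup>2"
    by (simp add: real_choose_two power2_eq_square algebra_simps)
  then have "(2 * real (m choose 2)) ^ n \<le> ((real m)\<^sup>2) ^ n"
    by (intro power_mono) auto
  then show ?thesis by (simp add: power_mult_distrib power_mult)
qed

text \<open>Dividing by m^(2n)/2^n, an upper bound for the n-th power of \<open>m choose 2\<close>,
  turns the terms of either series into weights in [0, 1] on Dobinski's series.\<close>

lemma normalized_series_asymp_equiv:
  fixes X :: "nat \<Rightarrow> nat \<Rightarrow> real" and \<gamma> lo hi :: "real \<Rightarrow> real"
  assumes X: "\<And>n m. 0 \<le> X n m" "\<And>n m. X n m \<le> real (m choose 2) ^ n"
    and window: "\<forall>\<^sub>F n in sequentially. \<forall>m. (1 - exp (- saddle n / 4)) * exp (saddle n) \<le> real m \<longrightarrow>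
        real m \<le> (1 + exp (- saddle n / 4)) * exp (saddle n) \<longrightarrow>
        lo (saddle n) \<le> 2 ^ n * X n m / real m ^ (2 * n) \<and> 2 ^ n * X n m / real m ^ (2 * n) \<le> hi (saddle n)"
    and pos: "\<And>\<theta>. \<gamma> \<theta> > 0" "\<And>\<theta>. lo \<theta> \<ge> 0"  "\<And>\<theta>. hi \<theta> \<ge> 0"
    and lo: "((\<lambda>\<theta>. lo \<theta> / \<gamma> \<theta>) \<longlongrightarrow> 1) at_top"
    and hi: "((\<lambda>\<theta>. hi \<theta> / \<gamma> \<theta>) \<longlongrightarrow> 1) at_top"
    and tail: "((\<lambda>\<theta>. tail_bound \<theta> / \<gamma> \<theta>) \<longlongrightarrow> 0) at_top"
  shows "(\<lambda>n. \<Sum>m. X n m / fact m) \<sim>[at_top] (\<lambda>n. dobinski n / 2 ^ n * \<gamma> (saddle n))"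
proof -
  define g where "g = (\<lambda>n m. 2 ^ n * X n m / real m ^ (2 * n))"
  have le: "2 ^ n * X n m \<le> real m ^ (2 * n)" for n m
    by (rule order_trans[OF mult_left_mono[OF X(2)] choose_two_power_le]) simp
  have g: "0 \<le> g n m" "g n m \<le> 1" for n m
    using X(1)[of n m] le[of n m] by (auto simp: g_def divide_le_eq_1)
  have "(\<lambda>n. \<Sum>m. g n m * (real m ^ (2 * n) / fact m)) \<sim>[at_top]
    (\<lambda>n. \<gamma> (saddle n) * (\<Sum>m. real m ^ (2 * n) / fact m))"
    by (rule weighted_series_asymp_equiv[OF g _ pos lo hi tail_bound_tendsto(1) tail])
       (use window in \<open>simp add: g_def\<close>)
  also have "(\<lambda>n. \<Sum>m. g n m * (real m ^ (2 * n) / fact m)) = (\<lambda>n. 2 ^ n * (\<Sum>m. X n m / fact m))"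
  proof
    fix n
    have eq: "g n m * (real m ^ (2 * n) / fact m) = 2 ^ n * (X n m / fact m)" for m
    \<comment> \<open>If the denominator vanishes, \<open>g\<close> is 0 by the convention for
      division, and \<open>X n m\<close> is 0 because m^(2n) bounds it.\<close>
    proof (cases "real m ^ (2 * n) = 0")
      case True
      have "1 * X n m \<le> 2 ^ n * X n m" by (intro mult_right_mono X) auto
      then have "X n m = 0" using X(1)[of n m] le[of n m] True by linarith
      then show ?thesis by (simp add: g_def)
    qed (simp add: g_def)
    have "summable (\<lambda>m. X n m / fact m)"
    proof (rule summable_comparison_test'[OF summable_power_div_fact[of "2 * n"]])
      show "norm (X n m / fact m) \<le> real m ^ (2 * n) / fact m" for m
      proof -
        have "1 * X n m \<le> 2 ^ n * X n m" by (intro mult_right_mono X) auto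
        then show ?thesis using le[of n m] X(1)[of n m] by (simp add: divide_right_mono)
      qed
    qed
    then show "(\<Sum>m. g n m * (real m ^ (2 * n) / fact m)) = 2 ^ n * (\<Sum>m. X n m / fact m)"
      unfolding eq by (rule suminf_mult)
  qed
  finally show ?thesis
    using asymp_equiv_mult[OF asymp_equiv_refl[of "\<lambda>n. 1 / 2 ^ n :: real"]]
    unfolding dobinski_def[symmetric] by (fastforce simp: mult_ac)
qed

section \<open>Ratios of the terms on the window\<close>

text \<open>Put \<delta> = e^(-\<theta>/4), \<mu> = e^\<theta> and n = \<theta> \<mu>/2. The
  exponent is -n x - 2 n x^2 at x = 1/((1 - \<delta>) \<mu>), a lower bound for n ln (1 - 1/m); in
  \<open>binomial_ratio_upper\<close> it is -n/((1 + \<delta>) \<mu>).\<close>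

definition binomial_ratio_lower :: "real \<Rightarrow> real" where
  "binomial_ratio_lower \<theta> = exp (- (\<theta> / 2) / (1 - exp (- \<theta> / 4)) - \<theta> / ((1 - exp (- \<theta> / 4))\<^sup>2 * exp \<theta>))"
definition binomial_ratio_upper :: "real \<Rightarrow> real" where
  "binomial_ratio_upper \<theta> = exp (- (\<theta> / 2) / (1 + exp (- \<theta> / 4)))"
text \<open>The exponent of \<open>ffact_bounds\<close> with 2c replaced by its lower bound ((1 -
  \<delta>) \<mu> - 1)^2; \<open>falling_ratio_upper\<close> uses the upper bound ((1 + \<delta>)
  \<mu>)^2.\<close>

definition falling_ratio_lower :: "real \<Rightarrow> real" where
  "falling_ratio_lower \<theta> = exp (- ((\<theta> / 2)\<^sup>2 / (1 - exp (- \<theta> / 4) - exp (- \<theta>))\<^sup>2) -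
     \<theta> ^ 3 / ((1 - exp (- \<theta> / 4) - exp (- \<theta>)) ^ 4 * exp \<theta>))"
definition falling_ratio_upper :: "real \<Rightarrow> real" where
  "falling_ratio_upper \<theta> = exp (- (\<theta> * exp \<theta> / 2) * (\<theta> * exp \<theta> / 2 - 1) / ((1 + exp (- \<theta> / 4)) * exp \<theta>)\<^sup>2)"

lemma window_limits:
  "((\<lambda>\<theta>. binomial_ratio_lower \<theta> / exp (- \<theta> / 2)) \<longlongrightarrow> 1) at_top"
  "((\<lambda>\<theta>. binomial_ratio_upper \<theta> / exp (- \<theta> / 2)) \<longlongrightarrow> 1) at_top"
  "((\<lambda>\<theta>. falling_ratio_lower \<theta> / exp (- \<theta>\<^sup>2 / 4)) \<longlongrightarrow> 1) at_top"
  "((\<lambda>\<theta>. falling_ratio_upper \<theta> / exp (- \<theta>\<^sup>2 / 4)) \<longlongrightarrow> 1) at_top"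
proof -
  have *: "((\<lambda>\<theta>. exp (f \<theta>) / exp (g \<theta>)) \<longlongrightarrow> 1) at_top"
    if "((\<lambda>\<theta>. f \<theta> - g \<theta>) \<longlongrightarrow> 0) at_top" for f g :: "real \<Rightarrow> real"
    using tendsto_exp[OF that] by (simp add: exp_diff)
  show "((\<lambda>\<theta>. binomial_ratio_lower \<theta> / exp (- \<theta> / 2)) \<longlongrightarrow> 1) at_top"
    unfolding binomial_ratio_lower_def by (rule *) real_asymp
  show "((\<lambda>\<theta>. binomial_ratio_upper \<theta> / exp (- \<theta> / 2)) \<longlongrightarrow> 1) at_top"
    unfolding binomial_ratio_upper_def by (rule *) real_asymp
  show "((\<lambda>\<theta>. falling_ratio_lower \<theta> / exp (- \<theta>\<^sup>2 / 4)) \<longlongrightarrow> 1) at_top"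
    unfolding falling_ratio_lower_def
  proof (rule *)
    \<comment> \<open>The two terms of order \<theta>^2 are paired, so that \<theta>^2 multiplies
      only the exponentially small deviation of the denominator from 1.\<close>
    have "((\<lambda>\<theta>::real. - ((\<theta> / 2)\<^sup>2 * (1 / (1 - exp (- \<theta> / 4) - exp (- \<theta>))\<^sup>2 - 1)) -
       \<theta> ^ 3 / ((1 - exp (- \<theta> / 4) - exp (- \<theta>)) ^ 4 * exp \<theta>)) \<longlongrightarrow> 0) at_top"
      by real_asymp
    then show "((\<lambda>\<theta>::real. - ((\<theta> / 2)\<^sup>2 / (1 - exp (- \<theta> / 4) - exp (- \<theta>))\<^sup>2) -
       \<theta> ^ 3 / ((1 - exp (- \<theta> / 4) - exp (- \<theta>)) ^ 4 * exp \<theta>) - - \<theta>\<^sup>2 / 4) \<longlongrightarrow> 0) at_top"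
      by (rule Lim_transform_eventually) (simp add: right_diff_distrib power_divide)
  qed
  show "((\<lambda>\<theta>. falling_ratio_upper \<theta> / exp (- \<theta>\<^sup>2 / 4)) \<longlongrightarrow> 1) at_top"
    unfolding falling_ratio_upper_def by (rule *) real_asymp
qed

text \<open>In order, these conditions give m \<ge> 3 on the window, a positive lower end, n \<ge>
  1, and the hypothesis 2n \<le> c of \<open>ffact_bounds\<close>: the last one says 4n \<le> ((1 -
  \<delta>) \<mu> - 1)^2, which is at most 2c.\<close>

lemma window_large:
  "\<forall>\<^sub>F \<theta>::real in at_top. (1 - exp (- \<theta> / 4)) * exp \<theta> \<ge> 3 \<and> exp (- \<theta> / 4) < 1 \<and> \<theta> * exp \<theta> \<ge> 2 \<and>
      2 * (\<theta> * exp \<theta>) \<le> ((1 - exp (- \<theta> / 4)) * exp \<theta> - 1)\<^sup>2"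
  by (intro eventually_conj; real_asymp)

lemma window_bounds:
  fixes \<theta> :: real
  assumes n: "2 * real n = \<theta> * exp \<theta>"
    and big: "(1 - exp (- \<theta> / 4)) * exp \<theta> \<ge> 3" "exp (- \<theta> / 4) < 1" "\<theta> * exp \<theta> \<ge> 2"
      "2 * (\<theta> * exp \<theta>) \<le> ((1 - exp (- \<theta> / 4)) * exp \<theta> - 1)\<^sup>2"
    and m: "(1 - exp (- \<theta> / 4)) * exp \<theta> \<le> real m" "real m \<le> (1 + exp (- \<theta> / 4)) * exp \<theta>"
  shows "binomial_ratio_lower \<theta> \<le> 2 ^ n * real (m choose 2) ^ n / real m ^ (2 * n)"
    and "2 ^ n * real (m choose 2) ^ n / real m ^ (2 * n) \<le> binomial_ratio_upper \<theta>"
    and "falling_ratio_lower \<theta> * real (m choose 2) ^ n \<le> real (ffact (m choose 2) n)"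
    and "real (ffact (m choose 2) n) \<le> falling_ratio_upper \<theta> * real (m choose 2) ^ n"
proof -
  define \<delta> where "\<delta> = exp (- \<theta> / 4)"
  define \<mu> where "\<mu> = exp \<theta>"
  define c where "c = m choose 2"
  note big = big[folded \<delta>_def \<mu>_def] and m = m[folded \<delta>_def \<mu>_def] and n = n[folded \<mu>_def]
  have \<delta>: "\<delta> > 0" "\<delta> < 1" using big by (auto simp: \<delta>_def)
  have \<mu>: "\<mu> > 0" by (simp add: \<mu>_def)
  have \<theta>: "\<theta> > 0" using big(3) \<mu> by (smt (verit) mult_nonpos_nonneg)
  have m3: "real m \<ge> 3" using big m by linarith
  have n': "real n = \<theta> * \<mu> / 2" using n by simp
  have c2: "2 * real c = real m * (real m - 1)" by (simp add: c_def real_choose_two)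
  have quot: "2 ^ n * real (m choose 2) ^ n / real m ^ (2 * n) = (1 - 1 / real m) ^ n"
  proof -
    have "2 ^ n * real (m choose 2) ^ n = (2 * real c) ^ n" by (simp add: c_def power_mult_distrib)
    also have "\<dots> = ((real m)\<^sup>2 * (1 - 1 / real m)) ^ n"
      using m3 by (simp add: c2 power2_eq_square right_diff_distrib)
    also have "\<dots> = real m ^ (2 * n) * (1 - 1 / real m) ^ n"
      by (simp add: power_mult_distrib power_mult)
    finally show ?thesis using m3 by simp
  qed
  have lm: "(1 - \<delta>) * \<mu> > 0" using \<delta> \<mu> by simp
  show "binomial_ratio_lower \<theta> \<le> 2 ^ n * real (m choose 2) ^ n / real m ^ (2 * n)"
  proof -
    have "1 / real m \<le> 1 / ((1 - \<delta>) * \<mu>)"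
      using m lm by (intro divide_left_mono) auto
    then have i1: "real n * (1 / real m) \<le> real n * (1 / ((1 - \<delta>) * \<mu>))"
      and i2: "real n * (2 * (1 / real m)\<^sup>2) \<le> real n * (2 * (1 / ((1 - \<delta>) * \<mu>))\<^sup>2)"
      using m3 by (intro mult_left_mono power_mono; simp)+
    have e1: "real n * (1 / ((1 - \<delta>) * \<mu>)) = (\<theta> / 2) / (1 - \<delta>)"
      using \<mu> \<delta> by (simp add: n' field_simps)
    have e2: "real n * (2 * (1 / ((1 - \<delta>) * \<mu>))\<^sup>2) = \<theta> / ((1 - \<delta>)\<^sup>2 * \<mu>)"
    proof -
      have "real n * (2 * (1 / (d * \<mu>))\<^sup>2) = \<theta> / (d\<^sup>2 * \<mu>)" if "d > 0" for d
        using that \<mu> by (simp add: n' field_simps power2_eq_square)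
      from this[of "1 - \<delta>"] show ?thesis using \<delta> by simp
    qed
    have "- (1 / real m) - 2 * (1 / real m)\<^sup>2 \<le> ln (1 - 1 / real m)"
      using m3 by (intro ln_one_minus_pos_lower_bound) (auto simp: field_simps)
    then have "real n * (- (1 / real m) - 2 * (1 / real m)\<^sup>2) \<le> real n * ln (1 - 1 / real m)"
      by (intro mult_left_mono) auto
    then have "- (\<theta> / 2) / (1 - \<delta>) - \<theta> / ((1 - \<delta>)\<^sup>2 * \<mu>) \<le> real n * ln (1 - 1 / real m)"
      using i1 i2 unfolding e1 e2 by (simp add: algebra_simps)
    then have "binomial_ratio_lower \<theta> \<le> exp (real n * ln (1 - 1 / real m))"
      by (simp add: binomial_ratio_lower_def \<delta>_def \<mu>_def)
    also have "\<dots> = (1 - 1 / real m) ^ n"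
      using m3 by (simp add: exp_of_nat_mult)
    finally show ?thesis by (simp add: quot)
  qed
  show "2 ^ n * real (m choose 2) ^ n / real m ^ (2 * n) \<le> binomial_ratio_upper \<theta>"
  proof -
    have "(1 - 1 / real m) ^ n \<le> exp (- (1 / real m)) ^ n"
      using m3 exp_ge_add_one_self[of "- (1 / real m)"] by (intro power_mono) auto
    also have "\<dots> = exp (- (real n / real m))"
      by (simp flip: exp_of_nat_mult)
    also have "\<dots> \<le> binomial_ratio_upper \<theta>"
    proof -
      have "real n / ((1 + \<delta>) * \<mu>) \<le> real n / real m"
        using m m3 by (intro divide_left_mono) auto
      moreover have "real n / ((1 + \<delta>) * \<mu>) = (\<theta> / 2) / (1 + \<delta>)"
        using \<mu> by (simp add: n')
      ultimately show ?thesis by (simp add: binomial_ratio_upper_def \<delta>_def)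
    qed
    finally show ?thesis by (simp add: quot)
  qed
  \<comment> \<open>A lower bound for 2c = m(m - 1) on the whole window, by way of (m -
    1)^2.\<close>
  define K where "K = ((1 - \<delta>) * \<mu> - 1)\<^sup>2"
  have K: "K \<ge> 4"
    using big power_mono[of 2 "(1 - \<delta>) * \<mu> - 1" 2] by (simp add: K_def)
  have cK: "2 * real c \<ge> K"
  proof -
    have "K \<le> (real m - 1)\<^sup>2" unfolding K_def using m big by (intro power_mono) auto
    also have "\<dots> \<le> real m * (real m - 1)" using m3 by (simp add: power2_eq_square)
    finally show ?thesis by (simp add: c2)
  qed
  have c0: "c > 0" using K cK by (intro gr0I) auto
  have "4 * real n \<le> K" using big(4) unfolding K_def n[symmetric] by simp
  then have "2 * n \<le> c" using cK by linarith
  note ff = ffact_bounds[OF this c0]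
  have "falling_ratio_lower \<theta> \<le> exp (- (real n)\<^sup>2 / (2 * real c) - 2 * real n ^ 3 / (real c)\<^sup>2)"
  proof -
    have "(real n)\<^sup>2 / (2 * real c) \<le> (real n)\<^sup>2 / K"
      using cK K by (intro divide_left_mono) auto
    moreover have "8 * real n ^ 3 / (2 * real c)\<^sup>2 \<le> 8 * real n ^ 3 / K\<^sup>2"
      using cK K by (intro divide_left_mono power_mono) auto
    moreover have "8 * real n ^ 3 / (2 * real c)\<^sup>2 = 2 * real n ^ 3 / (real c)\<^sup>2"
      by (simp add: power_mult_distrib)
    moreover have "falling_ratio_lower \<theta> = exp (- (real n)\<^sup>2 / K - 8 * real n ^ 3 / K\<^sup>2)"
    proof -
      define D where "D = 1 - \<delta> - 1 / \<mu>"
      have D: "(1 - \<delta>) * \<mu> - 1 = \<mu> * D" using \<mu> by (simp add: D_def field_simps)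
      then have "D \<noteq> 0" using big by auto
      moreover have "K = (\<mu> * D)\<^sup>2" by (simp only: K_def D)
      ultimately have "(real n)\<^sup>2 / K = (\<theta> / 2)\<^sup>2 / D\<^sup>2" "8 * real n ^ 3 / K\<^sup>2 = \<theta> ^ 3 / (D ^ 4 * \<mu>)"
        using \<mu> by (simp_all add: n' field_simps power2_eq_square power3_eq_cube power4_eq_xxxx)
      then show ?thesis
        by (simp add: falling_ratio_lower_def D_def \<delta>_def \<mu>_def exp_minus inverse_eq_divide)
    qed
    ultimately show ?thesis by simp
  qed
  then show "falling_ratio_lower \<theta> * real (m choose 2) ^ n \<le> real (ffact (m choose 2) n)"
    unfolding c_def[symmetric] by (intro order_trans[OF mult_right_mono ff(2)]) auto
  have "exp (- real n * (real n - 1) / (2 * real c)) \<le> falling_ratio_upper \<theta>"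
  proof -
    have "2 * real c \<le> (real m)\<^sup>2" using m3 by (simp add: c2 power2_eq_square)
    also have "\<dots> \<le> ((1 + \<delta>) * \<mu>)\<^sup>2" using m by (intro power_mono) auto
    finally have "2 * real c \<le> ((1 + \<delta>) * \<mu>)\<^sup>2" .
    moreover have "real n \<ge> 1" using big(3) n by simp
    ultimately have "real n * (real n - 1) / ((1 + \<delta>) * \<mu>)\<^sup>2 \<le> real n * (real n - 1) / (2 * real c)"
      using c0 \<delta> \<mu> by (intro divide_left_mono mult_pos_pos zero_less_power) auto
    moreover have "falling_ratio_upper \<theta> = exp (- (real n * (real n - 1) / ((1 + \<delta>) * \<mu>)\<^sup>2))"
      by (simp add: falling_ratio_upper_def n' \<delta>_def \<mu>_def)
    ultimately show ?thesis by simp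
  qed
  then show "real (ffact (m choose 2) n) \<le> falling_ratio_upper \<theta> * real (m choose 2) ^ n"
    unfolding c_def[symmetric] by (intro order_trans[OF ff(1) mult_right_mono]) auto
qed

lemma window_eventually:
  "\<forall>\<^sub>F n in sequentially. \<forall>m. (1 - exp (- saddle n / 4)) * exp (saddle n) \<le> real m \<longrightarrow>
        real m \<le> (1 + exp (- saddle n / 4)) * exp (saddle n) \<longrightarrow>
    binomial_ratio_lower (saddle n) \<le> 2 ^ n * real (m choose 2) ^ n / real m ^ (2 * n) \<and>
    2 ^ n * real (m choose 2) ^ n / real m ^ (2 * n) \<le> binomial_ratio_upper (saddle n) \<and>
    falling_ratio_lower (saddle n) * real (m choose 2) ^ n \<le> real (ffact (m choose 2) n) \<and>
    real (ffact (m choose 2) n) \<le> falling_ratio_upper (saddle n) * real (m choose 2) ^ n"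
  using eventually_compose_filterlim[OF window_large saddle_at_top]
proof eventually_elim
  case (elim n)
  then show ?case
    using window_bounds[of n "saddle n"] saddle(2)[of n] by simp
qed

lemma cover_series_asymp_equiv:
  "cover_series \<sim>[at_top] (\<lambda>n. dobinski n / 2 ^ n * exp (- saddle n / 2))"
  unfolding cover_series_def
proof (rule normalized_series_asymp_equiv[where lo = binomial_ratio_lower and hi = binomial_ratio_upper and \<gamma> = "\<lambda>\<theta>. exp (- \<theta> / 2)"])
  show "\<forall>\<^sub>F n in sequentially. \<forall>m. (1 - exp (- saddle n / 4)) * exp (saddle n) \<le> real m \<longrightarrow>
        real m \<le> (1 + exp (- saddle n / 4)) * exp (saddle n) \<longrightarrow>
        binomial_ratio_lower (saddle n) \<le> 2 ^ n * real (m choose 2) ^ n / real m ^ (2 * n) \<and>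
        2 ^ n * real (m choose 2) ^ n / real m ^ (2 * n) \<le> binomial_ratio_upper (saddle n)"
    using window_eventually by (rule eventually_mono) blast
qed (use window_limits tail_bound_tendsto in \<open>simp_all add: binomial_ratio_lower_def binomial_ratio_upper_def\<close>)

text \<open>The quotient of the falling product by m^(2n) factors through the n-th power of
  \<open>m choose 2\<close>: the first factor contributes e^(-\<theta>/2), the second
  e^(-\<theta>^2/4).\<close>

lemma restricted_series_asymp_equiv:
  "restricted_series \<sim>[at_top] (\<lambda>n. dobinski n / 2 ^ n * exp (- saddle n / 2 - (saddle n)\<^sup>2 / 4))"
  unfolding restricted_series_def
proof (rule normalized_series_asymp_equiv[where lo = "\<lambda>\<theta>. binomial_ratio_lower \<theta> * falling_ratio_lower \<theta>" and hi = "\<lambda>\<theta>. binomial_ratio_upper \<theta> * falling_ratio_upper \<theta>"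
      and \<gamma> = "\<lambda>\<theta>. exp (- \<theta> / 2 - \<theta>\<^sup>2 / 4)"])
  show "real (ffact (m choose 2) n) \<le> real (m choose 2) ^ n" for n m
    using ffact_le_power[of "m choose 2" n] by (metis of_nat_le_iff of_nat_power)
  show "\<forall>\<^sub>F n in sequentially. \<forall>m. (1 - exp (- saddle n / 4)) * exp (saddle n) \<le> real m \<longrightarrow>
        real m \<le> (1 + exp (- saddle n / 4)) * exp (saddle n) \<longrightarrow>
        binomial_ratio_lower (saddle n) * falling_ratio_lower (saddle n) \<le> 2 ^ n * real (ffact (m choose 2) n) / real m ^ (2 * n) \<and>
        2 ^ n * real (ffact (m choose 2) n) / real m ^ (2 * n) \<le> binomial_ratio_upper (saddle n) * falling_ratio_upper (saddle n)"
    using window_eventually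
  proof (rule eventually_mono, intro allI impI)
    fix n m
    assume "\<forall>m. (1 - exp (- saddle n / 4)) * exp (saddle n) \<le> real m \<longrightarrow>
        real m \<le> (1 + exp (- saddle n / 4)) * exp (saddle n) \<longrightarrow>
      binomial_ratio_lower (saddle n) \<le> 2 ^ n * real (m choose 2) ^ n / real m ^ (2 * n) \<and>
      2 ^ n * real (m choose 2) ^ n / real m ^ (2 * n) \<le> binomial_ratio_upper (saddle n) \<and>
      falling_ratio_lower (saddle n) * real (m choose 2) ^ n \<le> real (ffact (m choose 2) n) \<and>
      real (ffact (m choose 2) n) \<le> falling_ratio_upper (saddle n) * real (m choose 2) ^ n"
      "(1 - exp (- saddle n / 4)) * exp (saddle n) \<le> real m"
      "real m \<le> (1 + exp (- saddle n / 4)) * exp (saddle n)"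
    then have b: "binomial_ratio_lower (saddle n) \<le> 2 ^ n * real (m choose 2) ^ n / real m ^ (2 * n)"
      "2 ^ n * real (m choose 2) ^ n / real m ^ (2 * n) \<le> binomial_ratio_upper (saddle n)"
      "falling_ratio_lower (saddle n) * real (m choose 2) ^ n \<le> real (ffact (m choose 2) n)"
      "real (ffact (m choose 2) n) \<le> falling_ratio_upper (saddle n) * real (m choose 2) ^ n"
      by blast+
    have "binomial_ratio_lower (saddle n) * falling_ratio_lower (saddle n) \<le> 2 ^ n * real (m choose 2) ^ n / real m ^ (2 * n) * falling_ratio_lower (saddle n)"
      using b(1) by (intro mult_right_mono) (auto simp: falling_ratio_lower_def)
    also have "\<dots> = 2 ^ n * (falling_ratio_lower (saddle n) * real (m choose 2) ^ n) / real m ^ (2 * n)"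
      by simp
    also have "\<dots> \<le> 2 ^ n * real (ffact (m choose 2) n) / real m ^ (2 * n)"
      using b(3) by (intro divide_right_mono mult_left_mono) auto
    finally have l: "binomial_ratio_lower (saddle n) * falling_ratio_lower (saddle n) \<le> 2 ^ n * real (ffact (m choose 2) n) / real m ^ (2 * n)" .
    have "2 ^ n * real (ffact (m choose 2) n) / real m ^ (2 * n)
        \<le> 2 ^ n * (falling_ratio_upper (saddle n) * real (m choose 2) ^ n) / real m ^ (2 * n)"
      using b(4) by (intro divide_right_mono mult_left_mono) auto
    also have "\<dots> = 2 ^ n * real (m choose 2) ^ n / real m ^ (2 * n) * falling_ratio_upper (saddle n)"
      by simp
    also have "\<dots> \<le> binomial_ratio_upper (saddle n) * falling_ratio_upper (saddle n)"
      using b(2) by (intro mult_right_mono) (auto simp: falling_ratio_upper_def)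
    finally show "binomial_ratio_lower (saddle n) * falling_ratio_lower (saddle n) \<le> 2 ^ n * real (ffact (m choose 2) n) / real m ^ (2 * n) \<and>
        2 ^ n * real (ffact (m choose 2) n) / real m ^ (2 * n) \<le> binomial_ratio_upper (saddle n) * falling_ratio_upper (saddle n)"
      using l by simp
  qed
  have e: "exp (- \<theta> / 2 - \<theta>\<^sup>2 / 4) = exp (- \<theta> / 2) * exp (- \<theta>\<^sup>2 / 4)" for \<theta> :: real
    by (simp flip: exp_add)
  show "((\<lambda>\<theta>. binomial_ratio_lower \<theta> * falling_ratio_lower \<theta> / exp (- \<theta> / 2 - \<theta>\<^sup>2 / 4)) \<longlongrightarrow> 1) at_top"
    "((\<lambda>\<theta>. binomial_ratio_upper \<theta> * falling_ratio_upper \<theta> / exp (- \<theta> / 2 - \<theta>\<^sup>2 / 4)) \<longlongrightarrow> 1) at_top"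
    using tendsto_mult[OF window_limits(1,3)] tendsto_mult[OF window_limits(2,4)]
    unfolding e by simp_all
qed (use tail_bound_tendsto in \<open>simp_all add: binomial_ratio_lower_def binomial_ratio_upper_def falling_ratio_lower_def falling_ratio_upper_def\<close>)

section \<open>From the saddle point to logarithms of n\<close>

text \<open>From 2n = \<theta> e^\<theta> one gets ln (2n/ln n) = \<theta> + \<epsilon> with
  \<epsilon> = ln \<theta> - ln (ln n) tending to 0, which settles the first claim. In the second,
  the square contains \<theta> \<epsilon>/2, which does not vanish: it equals (ln 2 - ln \<theta>)/2
  + o(1) and supplies a factor (\<theta>/2)^(1/2). This is cancelled by n^(-1/2) =
  (\<theta>/2)^(-1/2) e^(-\<theta>/2).\<close>

lemma saddle_asymp_equiv:
  "(\<lambda>n. exp (- saddle n / 2)) \<sim>[at_top] (\<lambda>n. exp (- (1 / 2) * ln (2 * real n / ln (real n))))"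
  "(\<lambda>n. exp (- saddle n / 2 - (saddle n)\<^sup>2 / 4)) \<sim>[at_top]
     (\<lambda>n. real n powr (- 1 / 2) * exp (- (1 / 2 * ln (2 * real n / ln (real n)))\<^sup>2))"
proof -
  have n: "real n = saddle n * exp (saddle n) / 2" for n
    using saddle(2)[of n] by simp
  have "(\<lambda>\<theta>. exp (- \<theta> / 2)) \<sim>[at_top]
      (\<lambda>\<theta>::real. exp (- (1 / 2) * ln (2 * (\<theta> * exp \<theta> / 2) / ln (\<theta> * exp \<theta> / 2))))"
    by real_asymp
  from asymp_equiv_compose'[OF this saddle_at_top]
  show "(\<lambda>n. exp (- saddle n / 2)) \<sim>[at_top] (\<lambda>n. exp (- (1 / 2) * ln (2 * real n / ln (real n))))"
    unfolding n[symmetric] .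
  have "((\<lambda>\<theta>::real. exp (- \<theta> / 2 - \<theta>\<^sup>2 / 4) / ((\<theta> * exp \<theta> / 2) powr (- 1 / 2) *
      exp (- (1 / 2 * ln (2 * (\<theta> * exp \<theta> / 2) / ln (\<theta> * exp \<theta> / 2)))\<^sup>2))) \<longlongrightarrow> 1) at_top"
  proof (rule Lim_transform_eventually)
    \<comment> \<open>The difference of the two exponents, arranged by powers of \<epsilon> = ln
      \<theta> - ln (ln \<theta> + \<theta> - ln 2).\<close>
    let ?d = "\<lambda>\<theta>::real. 1 / 2 * ln \<theta> - 1 / 2 * ln 2 + (ln \<theta> - ln (ln \<theta> + \<theta> - ln 2)) *
        (\<theta> / 2 + (ln \<theta> - ln (ln \<theta> + \<theta> - ln 2)) / 4)"
    have "(?d \<longlongrightarrow> 0) at_top" by real_asymp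
    from tendsto_exp[OF this] show "((\<lambda>\<theta>. exp (?d \<theta>)) \<longlongrightarrow> 1) at_top" by simp
    have "\<forall>\<^sub>F \<theta>::real in at_top. \<theta> > 0 \<and> ln \<theta> + \<theta> - ln 2 > 0"
      by (intro eventually_conj; real_asymp)
    then show "\<forall>\<^sub>F \<theta>::real in at_top. exp (?d \<theta>) = exp (- \<theta> / 2 - \<theta>\<^sup>2 / 4) / ((\<theta> * exp \<theta> / 2) powr (- 1 / 2) *
      exp (- (1 / 2 * ln (2 * (\<theta> * exp \<theta> / 2) / ln (\<theta> * exp \<theta> / 2)))\<^sup>2))"
    proof eventually_elim
      case (elim \<theta>)
      define l where "l = ln \<theta> + \<theta> - ln 2"
      have l: "ln (\<theta> * exp \<theta> / 2) = l" using elim by (simp add: l_def ln_mult ln_div)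
      have l': "ln (2 * (\<theta> * exp \<theta> / 2) / l) = ln \<theta> + \<theta> - ln l"
        using elim by (simp add: l_def ln_mult ln_div)
      have "(\<theta> * exp \<theta> / 2) powr (- 1 / 2) = exp (- l / 2)"
        using elim by (simp add: powr_def l)
      moreover have "?d \<theta> = - \<theta> / 2 - \<theta>\<^sup>2 / 4 - (- l / 2 + - (1 / 2 * (ln \<theta> + \<theta> - ln l))\<^sup>2)"
        by (simp add: l_def[symmetric]) (simp add: l_def power2_eq_square field_simps)
      ultimately show ?case
        unfolding l l' by (simp only: exp_add[symmetric] exp_diff[symmetric])
    qed
  qed
  then have "(\<lambda>\<theta>. exp (- \<theta> / 2 - \<theta>\<^sup>2 / 4)) \<sim>[at_top] (\<lambda>\<theta>::real. (\<theta> * exp \<theta> / 2) powr (- 1 / 2) *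
      exp (- (1 / 2 * ln (2 * (\<theta> * exp \<theta> / 2) / ln (\<theta> * exp \<theta> / 2)))\<^sup>2))"
    by (rule asymp_equivI')
  from asymp_equiv_compose'[OF this saddle_at_top]
  show "(\<lambda>n. exp (- saddle n / 2 - (saddle n)\<^sup>2 / 4)) \<sim>[at_top]
     (\<lambda>n. real n powr (- 1 / 2) * exp (- (1 / 2 * ln (2 * real n / ln (real n)))\<^sup>2))"
    unfolding n[symmetric] .
qed

section \<open>Covers and Dobinski-type series\<close>

text \<open>
  A multiset \<open>M\<close> of size $k$ arises from $m!/(m-k)!$ times \<open>weight M\<close> lists of length $m$ when the empty
  entries are dropped, so summing over $m$ with weights $1/m!$ gives $e$ times \<open>weight M\<close>.
\<close>

definition weight :: "'a multiset \<Rightarrow> real" where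
  "weight M = 1 / (\<Prod>S\<in>set_mset M. fact (count M S))"

abbreviation nonempty_part :: "'a set list \<Rightarrow> 'a set multiset" where
  "nonempty_part xs \<equiv> filter_mset (\<lambda>S. S \<noteq> {}) (mset xs)"

lemma nonempty_part_eq_iff:
  assumes "{} \<notin># M"
  shows "length xs = m \<and> nonempty_part xs = M \<longleftrightarrow>
    size M \<le> m \<and> mset xs = M + replicate_mset (m - size M) {}"
proof
  assume *: "length xs = m \<and> nonempty_part xs = M"
  then have eq: "mset xs = M + replicate_mset (count (mset xs) {}) {}"
    using multiset_partition[of "mset xs" "\<lambda>S. S \<noteq> {}"] by (simp add: filter_eq_replicate_mset)
  have "size (mset xs) = m" using * by simp
  then have "m = size M + count (mset xs) {}" by (subst (asm) eq) simp
  then show "size M \<le> m \<and> mset xs = M + replicate_mset (m - size M) {}"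
    using eq by simp
next
  assume *: "size M \<le> m \<and> mset xs = M + replicate_mset (m - size M) {}"
  then have "size (mset xs) = m" by simp
  then have "length xs = m" by simp
  moreover have "filter_mset (\<lambda>S. S \<noteq> {}) M = M"
    using assms by (auto simp: filter_mset_eq_conv)
  moreover have "filter_mset (\<lambda>S. S \<noteq> {}) (replicate_mset (m - size M) {}) = {#}"
    by (simp add: multiset_eq_iff)
  ultimately show "length xs = m \<and> nonempty_part xs = M"
    using * by simp
qed

lemma card_arrangements:
  assumes "{} \<notin># M"
  shows "real (card {xs. length xs = m \<and> nonempty_part xs = M}) / fact m =
    (if size M \<le> m then weight M / fact (m - size M) else 0)"
proof (cases "size M \<le> m")
  case True
  define N where "N = M + replicate_mset (m - size M) {}"
  have sizeN: "size N = m" using True by (simp add: N_def)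
  have c0: "count M {} = 0" using assms by (simp add: not_in_iff)
  \<comment> \<open>Adding the index \<open>{}\<close> covers the case m = \<open>size M\<close>,
    where no empty entry occurs and its factor is 0! = 1.\<close>
  have "(\<Prod>S\<in>set_mset N. fact (count N S)) =
      (\<Prod>S\<in>insert {} (set_mset M). fact (count N S) :: nat)"
    by (rule prod.mono_neutral_left) (auto simp: N_def not_in_iff split: if_splits)
  also have "\<dots> = fact (count N {}) * (\<Prod>S\<in>set_mset M. fact (count N S))"
    using assms by (subst prod.insert) auto
  also have "(\<Prod>S\<in>set_mset M. fact (count N S)) = (\<Prod>S\<in>set_mset M. fact (count M S) :: nat)"
    using assms by (intro prod.cong) (auto simp: N_def)
  also have "count N {} = m - size M" by (simp add: N_def c0)
  finally have prod: "(\<Prod>S\<in>set_mset N. fact (count N S)) =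
    fact (m - size M) * (\<Prod>S\<in>set_mset M. fact (count M S) :: nat)" .
  have "{xs. length xs = m \<and> nonempty_part xs = M} = permutations_of_multiset N"
    using True unfolding nonempty_part_eq_iff[OF assms] by (simp add: permutations_of_multiset_def N_def)
  then have "card {xs. length xs = m \<and> nonempty_part xs = M} *
      (fact (m - size M) * (\<Prod>S\<in>set_mset M. fact (count M S))) = fact m"
    using card_permutations_of_multiset_aux[of N] by (simp add: prod sizeN)
  then have "real (card {xs. length xs = m \<and> nonempty_part xs = M} *
      (fact (m - size M) * (\<Prod>S\<in>set_mset M. fact (count M S)))) = real (fact m)"
    by (simp only:)
  then have *: "real (card {xs. length xs = m \<and> nonempty_part xs = M}) *
      (fact (m - size M) * (\<Prod>S\<in>set_mset M. fact (count M S))) = fact m"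
    by simp
  have "(\<Prod>S\<in>set_mset M. fact (count M S) :: real) \<noteq> 0" by simp
  then show ?thesis using * True
    by (simp add: weight_def field_simps)
next
  case False
  then show ?thesis unfolding nonempty_part_eq_iff[OF assms] by simp
qed

lemma exp_1_sums: "(\<lambda>m. 1 / fact m) sums exp (1 :: real)"
  using exp_converges[of "1 :: real"] by (simp add: field_simps)

lemma arrangements_sums:
  assumes fin: "finite C" and ne: "\<And>M. M \<in> C \<Longrightarrow> {} \<notin># M"
    and fin': "\<And>m. finite {xs. length xs = m \<and> nonempty_part xs \<in> C}"
  shows "(\<lambda>m. real (card {xs. length xs = m \<and> nonempty_part xs \<in> C}) / fact m) sums
    (exp 1 * (\<Sum>M\<in>C. weight M))"
proof -
  have one: "(\<lambda>m. real (card {xs. length xs = m \<and> nonempty_part xs = M}) / fact m) sums (exp 1 * weight M)"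
    if "M \<in> C" for M
  proof -
    have "(\<lambda>m. if size M \<le> m then weight M / fact (m - size M) else 0) sums (exp 1 * weight M)"
    proof (subst sums_iff_shift'[of _ "size M", symmetric])
      show "(\<lambda>i. if size M \<le> i + size M then weight M / fact (i + size M - size M) else 0) sums
        (exp 1 * weight M - (\<Sum>i<size M. if size M \<le> i then weight M / fact (i - size M) else 0))"
        using sums_mult[OF exp_1_sums, of "weight M"] by (simp add: mult.commute)
    qed
    then show ?thesis unfolding card_arrangements[OF ne[OF that]] .
  qed
  have card: "card {xs. length xs = m \<and> nonempty_part xs \<in> C} =
      (\<Sum>M\<in>C. card {xs. length xs = m \<and> nonempty_part xs = M})" for m
  proof -
    have "{xs. length xs = m \<and> nonempty_part xs \<in> C} = (\<Union>M\<in>C. {xs. length xs = m \<and> nonempty_part xs = M})"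
      by auto
    moreover have "finite {xs. length xs = m \<and> nonempty_part xs = M}" if "M \<in> C" for M
      by (rule finite_subset[OF _ fin'[of m]]) (use that in auto)
    ultimately show ?thesis
      using fin by (simp add: card_UN_disjoint disjoint_iff)
  qed
  show ?thesis
    unfolding card of_nat_sum sum_divide_distrib sum_distrib_left
    by (intro sums_sum one)
qed

text \<open>The ground set is arbitrary because components will be split off, leaving a cover of a
  subset of [n].\<close>

definition cover :: "nat \<Rightarrow> 'a set \<Rightarrow> 'a set multiset \<Rightarrow> bool" where
  "cover r A M \<longleftrightarrow>
     (\<forall>S \<in># M. S \<noteq> {} \<and> S \<subseteq> A) \<and> (\<forall>d \<in> A. size {#S \<in># M. d \<in> S#} = r)"

text \<open>
  Lists whose nonempty entries cover each \<open>d\<close> exactly \<open>r\<close> times are the same as functions sending each \<open>d\<close>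
  to an \<open>r\<close>-set of positions. For \<open>r = 1\<close> this yields Dobinski's formula; for \<open>r = 2\<close> the functions are the
  loopless multigraphs with labelled edges, and the restricted covers correspond to the injective ones.
\<close>

definition incidence :: "'a set \<Rightarrow> 'a set list \<Rightarrow> 'a \<Rightarrow> nat set" where
  "incidence A xs = (\<lambda>d\<in>A. {i. i < length xs \<and> d \<in> xs ! i})"

lemma cover_nonempty_part_iff:
  "cover r A (nonempty_part xs) \<longleftrightarrow>
    (\<forall>S\<in>set xs. S \<subseteq> A) \<and> (\<forall>d\<in>A. card (incidence A xs d) = r)"
proof -
  have "size {#S \<in># nonempty_part xs. d \<in> S#} = card {i. i < length xs \<and> d \<in> xs ! i}" for d
  proof -
    have "{#S \<in># nonempty_part xs. d \<in> S#} = mset (filter (\<lambda>S. d \<in> S) xs)"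
      by (auto simp: filter_filter_mset intro: filter_mset_cong)
    then show ?thesis by (simp only: size_mset length_filter_conv_card)
  qed
  then show ?thesis by (auto simp: cover_def incidence_def)
qed

lemma bij_betw_incidence:
  "bij_betw (incidence A) {xs. length xs = m \<and> cover r A (nonempty_part xs)}
     (A \<rightarrow>\<^sub>E {T. T \<subseteq> {..<m} \<and> card T = r})"
proof (rule bij_betw_byWitness[where f' = "\<lambda>f. map (\<lambda>i. {d \<in> A. i \<in> f d}) [0..<m]"])
  show "\<forall>xs\<in>{xs. length xs = m \<and> cover r A (nonempty_part xs)}.
       map (\<lambda>i. {d \<in> A. i \<in> incidence A xs d}) [0..<m] = xs"
    unfolding cover_nonempty_part_iff
    by (fastforce intro!: nth_equalityI simp: incidence_def)
  have inv: "incidence A (map (\<lambda>i. {d \<in> A. i \<in> f d}) [0..<m]) = f"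
    if "f \<in> A \<rightarrow>\<^sub>E {T. T \<subseteq> {..<m} \<and> card T = r}" for f
  proof
    show "incidence A (map (\<lambda>i. {d \<in> A. i \<in> f d}) [0..<m]) d = f d" for d
    proof (cases "d \<in> A")
      case True
      then have "f d \<subseteq> {..<m}" using that by (auto simp: PiE_iff)
      then have "{i. i < m \<and> i \<in> f d} = f d" by auto
      then show ?thesis using True by (simp add: incidence_def cong: conj_cong)
    qed (simp add: incidence_def PiE_arb[OF that])
  qed
  then show "\<forall>f\<in>A \<rightarrow>\<^sub>E {T. T \<subseteq> {..<m} \<and> card T = r}.
      incidence A (map (\<lambda>i. {d \<in> A. i \<in> f d}) [0..<m]) = f" by blast
  show "incidence A ` {xs. length xs = m \<and> cover r A (nonempty_part xs)}
      \<subseteq> A \<rightarrow>\<^sub>E {T. T \<subseteq> {..<m} \<and> card T = r}"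
    unfolding cover_nonempty_part_iff by (auto simp: incidence_def)
  show "(\<lambda>f. map (\<lambda>i. {d \<in> A. i \<in> f d}) [0..<m]) ` (A \<rightarrow>\<^sub>E {T. T \<subseteq> {..<m} \<and> card T = r})
      \<subseteq> {xs. length xs = m \<and> cover r A (nonempty_part xs)}"
    unfolding cover_nonempty_part_iff using inv by (auto simp: PiE_iff)
qed

lemma card_subset_lessThan: "card {T. T \<subseteq> {..<m} \<and> card T = r} = m choose r"
  using n_subsets[of "{..<m}" r] by simp

lemma finite_subset_lessThan: "finite {T. T \<subseteq> {..<m :: nat} \<and> card T = r}"
  by (rule finite_subset[of _ "Pow {..<m}"]) auto

lemma card_cover_lists:
  assumes "finite A"
  shows "card {xs. length xs = m \<and> cover r A (nonempty_part xs)} = (m choose r) ^ card A"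
  using bij_betw_same_card[OF bij_betw_incidence[of A m r]] assms
  by (simp add: card_funcsetE card_subset_lessThan)

lemma finite_cover_lists:
  assumes "finite A"
  shows "finite {xs. length xs = m \<and> cover r A (nonempty_part xs)}"
  using bij_betw_finite[OF bij_betw_incidence[of A m r]] finite_PiE[OF assms, of "\<lambda>_. {T. T \<subseteq> {..<m} \<and> card T = r}"]
  by (simp add: finite_subset_lessThan)

lemma cover_empty_notin: "cover r A M \<Longrightarrow> {} \<notin># M"
  by (auto simp: cover_def)

lemma cover_count_le:
  assumes "cover r A M"
  shows "count M S \<le> r"
proof (cases "S \<in># M")
  case True
  then have "S \<noteq> {}" "S \<subseteq> A" using assms by (auto simp: cover_def)
  then obtain d where d: "d \<in> S" "d \<in> A" by blast
  have "count M S = size {#T \<in># M. T = S#}" by (simp add: filter_eq_replicate_mset)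
  also have "\<dots> \<le> size {#T \<in># M. d \<in> T#}"
    using d by (intro size_mset_mono filter_mset_mono_strong) auto
  also have "\<dots> = r" using assms d by (auto simp: cover_def)
  finally show ?thesis .
qed (simp add: not_in_iff)

lemma finite_covers:
  assumes "finite A"
  shows "finite {M. cover r A M}"
proof -
  define B where "B = Pow A"
  have B: "finite B" using assms by (simp add: B_def)
  have "{M. cover r A M} \<subseteq> mset ` {xs. set xs \<subseteq> B \<and> length xs \<le> r * card B}"
  proof
    fix M assume "M \<in> {M. cover r A M}"
    then have M: "cover r A M" by simp
    then have sub: "set_mset M \<subseteq> B" by (auto simp: cover_def B_def)
    obtain xs where xs: "mset xs = M" using ex_mset by blast
    have "length xs = (\<Sum>S\<in>set_mset M. count M S)"
      using xs by (simp flip: size_mset add: size_multiset_overloaded_eq)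
    also have "\<dots> \<le> (\<Sum>S\<in>B. r)"
      using cover_count_le[OF M] sub B by (intro order_trans[OF sum_mono sum_mono2]) auto
    finally show "M \<in> mset ` {xs. set xs \<subseteq> B \<and> length xs \<le> r * card B}"
      using xs sub by (intro image_eqI[of _ _ xs]) (auto simp: mult.commute)
  qed
  then show ?thesis
    by (rule finite_subset) (simp add: finite_lists_length_le B)
qed

lemma cover_weight_sums:
  assumes "finite A"
  shows "(\<lambda>m. real (card {xs. length xs = m \<and> cover r A (nonempty_part xs) \<and> Q (nonempty_part xs)}) / fact m) sums
    (exp 1 * (\<Sum>M | cover r A M \<and> Q M. weight M))"
proof -
  have "finite {xs. length xs = m \<and> nonempty_part xs \<in> {M. cover r A M \<and> Q M}}" for m
    by (rule finite_subset[OF _ finite_cover_lists[OF assms, of m r]]) auto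
  from arrangements_sums[OF _ _ this] show ?thesis
    using finite_covers[OF assms, of r] cover_empty_notin[of r A]
    by simp
qed

section \<open>Set partitions as 1-covers\<close>

lemma cover_1_eq_mset_set:
  assumes "cover 1 A M"
  shows "M = mset_set (set_mset M)"
proof (rule multiset_eqI)
  show "count M S = count (mset_set (set_mset M)) S" for S
    using cover_count_le[OF assms, of S] count_greater_zero_iff[of M S]
    by (cases "S \<in># M") (auto simp: not_in_iff simp del: count_greater_zero_iff)
qed

lemma cover_1_mset_set_iff:
  assumes "finite P"
  shows "cover 1 A (mset_set P) \<longleftrightarrow> partition_on A P"
proof -
  have size: "size {#S \<in># mset_set P. d \<in> S#} = card {S \<in> P. d \<in> S}" for d
    using assms by simp
  have one: "card {S \<in> P. d \<in> S} = 1 \<longleftrightarrow> (\<exists>!S. S \<in> P \<and> d \<in> S)" for d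
  proof
    assume "card {S \<in> P. d \<in> S} = 1"
    then obtain S where "{T \<in> P. d \<in> T} = {S}" by (auto simp: card_1_singleton_iff)
    then have "T \<in> P \<and> d \<in> T \<longleftrightarrow> T = S" for T by (simp add: set_eq_iff)
    then show "\<exists>!S. S \<in> P \<and> d \<in> S" by simp
  next
    assume "\<exists>!S. S \<in> P \<and> d \<in> S"
    then obtain S where S: "S \<in> P" "d \<in> S" and unique: "\<And>T. T \<in> P \<Longrightarrow> d \<in> T \<Longrightarrow> T = S"
      by metis
    then have "{T \<in> P. d \<in> T} = {S}" using S by (blast intro: unique)
    then show "card {S \<in> P. d \<in> S} = 1" by simp
  qed
  show ?thesis
  proof
    assume "cover 1 A (mset_set P)"
    then have sub: "\<And>S. S \<in> P \<Longrightarrow> S \<noteq> {} \<and> S \<subseteq> A" and ex1: "\<And>d. d \<in> A \<Longrightarrow> \<exists>!S. S \<in> P \<and> d \<in> S"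
      unfolding cover_def size one using assms by auto
    show "partition_on A P"
    proof (rule partition_onI)
      show "\<Union>P = A" using sub ex1 by blast
      show "disjnt S T" if "S \<in> P" "T \<in> P" "S \<noteq> T" for S T
      proof (rule ccontr)
        assume "\<not> disjnt S T"
        then obtain d where "d \<in> S" "d \<in> T" by (auto simp: disjnt_def)
        then show False using ex1[of d] sub[of S] that by blast
      qed
      show "{} \<notin> P" using sub by blast
    qed
  next
    assume P: "partition_on A P"
    have "\<exists>!S. S \<in> P \<and> d \<in> S" if "d \<in> A" for d
      using partition_onD1[OF P] partition_onD2[OF P] that unfolding disjoint_def by blast
    then show "cover 1 A (mset_set P)"
      unfolding cover_def size one using assms partition_onD1[OF P] partition_onD3[OF P] by auto
  qed
qed

lemma partition_covers:
  assumes "finite A"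
  shows "bij_betw set_mset {M. cover 1 A M} {P. partition_on A P}"
proof (rule bij_betw_byWitness[where f' = mset_set])
  show "\<forall>M\<in>{M. cover 1 A M}. mset_set (set_mset M) = M"
    using cover_1_eq_mset_set[of A] by auto
  have fin: "finite P" if "partition_on A P" for P
    using that assms finite_elements by blast
  then show "\<forall>P\<in>{P. partition_on A P}. set_mset (mset_set P) = P" by simp
  show "set_mset ` {M. cover 1 A M} \<subseteq> {P. partition_on A P}"
    using cover_1_eq_mset_set[of A] cover_1_mset_set_iff[of _ A] by (auto simp: image_subset_iff) (metis finite_set_mset)
  show "mset_set ` {P. partition_on A P} \<subseteq> {M. cover 1 A M}"
    using cover_1_mset_set_iff[OF fin] by (auto simp del: One_nat_def)
qed

text \<open>For r = 1 there are m^(2n) lists of length m, and a nonempty set cannot be repeated, so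
  all weights are 1 and the weighted count is the Bell number: Dobinski's formula.\<close>

lemma dobinski_eq_bell: "dobinski n = exp 1 * real (bell (2 * n))"
proof -
  have "weight M = 1" if "cover 1 A M" for A :: "nat set" and M
  proof -
    have "fact (count M S) = (1 :: real)" for S
      using cover_count_le[OF that, of S] by (auto simp: le_Suc_eq)
    then show ?thesis by (simp add: weight_def)
  qed
  then have "(\<Sum>M | cover 1 {1..2 * n} M. weight M) = real (card {M. cover 1 {1..2 * n} M})"
    by simp
  also have "\<dots> = real (bell (2 * n))"
    using bij_betw_same_card[OF partition_covers[of "{1..2 * n}"]] by (simp add: bell_def)
  finally have "(\<lambda>m. real (card {xs. length xs = m \<and> cover 1 {1..2 * n} (nonempty_part xs)}) / fact m) sums
     (exp 1 * real (bell (2 * n)))"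
    using cover_weight_sums[of "{1..2 * n}" 1 "\<lambda>_. True"] by simp
  then show ?thesis
    unfolding dobinski_def by (subst (asm) card_cover_lists) (simp_all add: sums_iff)
qed

section \<open>Restricted covers as injective incidence maps\<close>

text \<open>Turns the two indices of the informal definition into positions of a list; for S = T it
  expresses multiplicity at least 2.\<close>

lemma doubleton_subseteq_mset_iff:
  "{#S, T#} \<subseteq># mset xs \<longleftrightarrow>
    (\<exists>i j. i < length xs \<and> j < length xs \<and> i \<noteq> j \<and> xs ! i = S \<and> xs ! j = T)"
proof
  assume sub: "{#S, T#} \<subseteq># mset xs"
  show "\<exists>i j. i < length xs \<and> j < length xs \<and> i \<noteq> j \<and> xs ! i = S \<and> xs ! j = T"
  proof (cases "S = T")
    case True
    have "2 \<le> count (mset xs) S" using mset_subset_eq_count[OF sub, of S] True by simp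
    also have "\<dots> = length (filter (\<lambda>T. T = S) xs)"
      by (induction xs) auto
    also have "\<dots> = card {i. i < length xs \<and> xs ! i = S}"
      by (rule length_filter_conv_card)
    finally have "\<not> card {i. i < length xs \<and> xs ! i = S} \<le> Suc 0" by simp
    then obtain i j where "i < length xs" "j < length xs" "i \<noteq> j" "xs ! i = S" "xs ! j = S"
      by (subst (asm) card_le_Suc0_iff_eq) auto
    then show ?thesis using True by auto
  next
    case False
    have "S \<in> set xs" "T \<in> set xs"
      using mset_subset_eqD[OF sub] by auto
    then show ?thesis using False by (metis in_set_conv_nth)
  qed
next
  assume "\<exists>i j. i < length xs \<and> j < length xs \<and> i \<noteq> j \<and> xs ! i = S \<and> xs ! j = T"
  then obtain i j where ij: "i < length xs" "j < length xs" "i \<noteq> j" "xs ! i = S" "xs ! j = T" by blast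
  have "mset_set {i, j} \<subseteq># mset_set {..<length xs}"
    using ij by (intro subset_imp_msubset_mset_set) auto
  then have "image_mset ((!) xs) (mset_set {i, j}) \<subseteq># image_mset ((!) xs) (mset_set {..<length xs})"
    by (rule image_mset_subseteq_mono)
  moreover have "image_mset ((!) xs) (mset_set {..<length xs}) = mset xs"
    by (metis map_nth mset_map mset_upt atLeast0LessThan atLeast_upt mset_set_set distinct_upt)
  ultimately show "{#S, T#} \<subseteq># mset xs" using ij by simp
qed

text \<open>Empty entries may be kept, since their intersections are empty.\<close>

lemma restricted_nonempty_part_iff:
  "restricted_cover (nonempty_part xs) \<longleftrightarrow>
    (\<forall>i<length xs. \<forall>j<length xs. i \<noteq> j \<longrightarrow> card (xs ! i \<inter> xs ! j) \<le> 1)"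
proof -
  have "{#S, T#} \<subseteq># nonempty_part xs \<longleftrightarrow> S \<noteq> {} \<and> T \<noteq> {} \<and> {#S, T#} \<subseteq># mset xs" for S T
  proof
    assume sub: "{#S, T#} \<subseteq># nonempty_part xs"
    then have "S \<in># nonempty_part xs" "T \<in># nonempty_part xs"
      using mset_subset_eqD[OF sub] by auto
    then show "S \<noteq> {} \<and> T \<noteq> {} \<and> {#S, T#} \<subseteq># mset xs"
      using subset_mset.order_trans[OF sub multiset_filter_subset] by auto
  next
    assume *: "S \<noteq> {} \<and> T \<noteq> {} \<and> {#S, T#} \<subseteq># mset xs"
    then have "filter_mset (\<lambda>S. S \<noteq> {}) {#S, T#} \<subseteq># nonempty_part xs"
      by (intro multiset_filter_mono) auto
    with * show "{#S, T#} \<subseteq># nonempty_part xs" by simp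
  qed
  then have "restricted_cover (nonempty_part xs) \<longleftrightarrow>
      (\<forall>S T. S \<noteq> {} \<and> T \<noteq> {} \<and> (\<exists>i j. i < length xs \<and> j < length xs \<and> i \<noteq> j \<and> xs ! i = S \<and> xs ! j = T)
        \<longrightarrow> card (S \<inter> T) \<le> 1)"
    unfolding restricted_cover_def by (simp only: doubleton_subseteq_mset_iff)
  also have "\<dots> \<longleftrightarrow> (\<forall>i<length xs. \<forall>j<length xs. i \<noteq> j \<longrightarrow> card (xs ! i \<inter> xs ! j) \<le> 1)"
  proof (intro iffI allI impI)
    fix i j assume *: "\<forall>S T. S \<noteq> {} \<and> T \<noteq> {} \<and> (\<exists>i j. i < length xs \<and> j < length xs \<and> i \<noteq> j \<and>
      xs ! i = S \<and> xs ! j = T) \<longrightarrow> card (S \<inter> T) \<le> 1"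
      and ij: "i < length xs" "j < length xs" "i \<noteq> j"
    show "card (xs ! i \<inter> xs ! j) \<le> 1"
    proof (cases "xs ! i = {} \<or> xs ! j = {}")
      case False
      then show ?thesis using *[rule_format, of "xs ! i" "xs ! j"] ij by blast
    qed auto
  qed blast
  finally show ?thesis .
qed

text \<open>Two elements have the same pair of positions {i, j} exactly when both lie in the entries
  i and j. In the multigraph with the elements as edges, being restricted thus means having no
  parallel edges.\<close>

lemma restricted_iff_inj_on_incidence:
  assumes A: "finite A" and xs: "cover 2 A (nonempty_part xs)"
  shows "restricted_cover (nonempty_part xs) \<longleftrightarrow> inj_on (incidence A xs) A"
proof
  have sub: "S \<subseteq> A" if "S \<in> set xs" for S
    using xs that by (auto simp: cover_nonempty_part_iff)
  have card2: "card (incidence A xs d) = 2" if "d \<in> A" for d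
    using xs that by (auto simp: cover_nonempty_part_iff)
  assume restr: "restricted_cover (nonempty_part xs)"
  show "inj_on (incidence A xs) A"
  proof (rule inj_onI, rule ccontr)
    fix d e assume de: "d \<in> A" "e \<in> A" "incidence A xs d = incidence A xs e" "d \<noteq> e"
    obtain i j where ij: "incidence A xs d = {i, j}" "i \<noteq> j"
      using card2[OF de(1)] by (auto simp: card_2_iff)
    have "i \<in> incidence A xs d" "j \<in> incidence A xs d" "i \<in> incidence A xs e" "j \<in> incidence A xs e"
      using ij de(3) by auto
    then have i: "i < length xs" "j < length xs" "{d, e} \<subseteq> xs ! i \<inter> xs ! j"
      using de by (auto simp: incidence_def)
    have "finite (xs ! i \<inter> xs ! j)"
      using sub[of "xs ! i"] i A by (auto intro: finite_subset)
    from card_mono[OF this i(3)] have "2 \<le> card (xs ! i \<inter> xs ! j)"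
      using de by simp
    then show False
      using restr i(1,2) ij(2) unfolding restricted_nonempty_part_iff by fastforce
  qed
next
  have sub: "S \<subseteq> A" if "S \<in> set xs" for S
    using xs that by (auto simp: cover_nonempty_part_iff)
  have card2: "card (incidence A xs d) = 2" if "d \<in> A" for d
    using xs that by (auto simp: cover_nonempty_part_iff)
  assume inj: "inj_on (incidence A xs) A"
  show "restricted_cover (nonempty_part xs)"
    unfolding restricted_nonempty_part_iff
  proof (intro allI impI)
    fix i j assume ij: "i < length xs" "j < length xs" "i \<noteq> j"
    have inA: "d \<in> A" if "d \<in> xs ! i" for d using sub[of "xs ! i"] that ij by auto
    have inc: "incidence A xs d = {i, j}" if "d \<in> xs ! i \<inter> xs ! j" for d
    proof (rule card_seteq[symmetric])
      have "d \<in> A" using inA that by blast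
      then show "{i, j} \<subseteq> incidence A xs d" "finite (incidence A xs d)" "card (incidence A xs d) \<le> card {i, j}"
        using that ij card2[of d] by (auto simp: incidence_def)
    qed
    have "finite (xs ! i \<inter> xs ! j)"
      using sub[of "xs ! i"] ij A by (auto intro: finite_subset)
    moreover have "d = e" if "d \<in> xs ! i \<inter> xs ! j" "e \<in> xs ! i \<inter> xs ! j" for d e
      using inj_onD[OF inj, of d e] inc[OF that(1)] inc[OF that(2)] inA that by auto
    ultimately show "card (xs ! i \<inter> xs ! j) \<le> 1"
      by (metis One_nat_def card_le_Suc0_iff_eq)
  qed
qed

lemma card_restricted_lists:
  assumes A: "finite A"
  shows "card {xs. length xs = m \<and> cover 2 A (nonempty_part xs) \<and> restricted_cover (nonempty_part xs)} =
    ffact (m choose 2) (card A)"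
proof -
  let ?L = "{xs. length xs = m \<and> cover 2 A (nonempty_part xs)}"
  let ?B = "{T. T \<subseteq> {..<m} \<and> card T = 2}"
  have bij: "bij_betw (incidence A) ?L (A \<rightarrow>\<^sub>E ?B)"
    by (rule bij_betw_incidence)
  have "{xs. length xs = m \<and> cover 2 A (nonempty_part xs) \<and> restricted_cover (nonempty_part xs)}
      = {xs \<in> ?L. inj_on (incidence A xs) A}"
    using restricted_iff_inj_on_incidence[OF A] by auto
  moreover have "incidence A ` {xs \<in> ?L. inj_on (incidence A xs) A} = {f \<in> A \<rightarrow>\<^sub>E ?B. inj_on f A}"
  proof -
    have "A \<rightarrow>\<^sub>E ?B = incidence A ` ?L" using bij by (simp add: bij_betw_def)
    then show ?thesis by (simp only: Compr_image_eq)
  qed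
  moreover have "inj_on (incidence A) {xs \<in> ?L. inj_on (incidence A xs) A}"
    using bij_betw_imp_inj_on[OF bij] by (rule inj_on_subset) auto
  ultimately have "card {xs. length xs = m \<and> cover 2 A (nonempty_part xs) \<and> restricted_cover (nonempty_part xs)}
      = card {f \<in> A \<rightarrow>\<^sub>E ?B. inj_on f A}"
    using card_image[of "incidence A" "{xs \<in> ?L. inj_on (incidence A xs) A}"] by simp
  also have "\<dots> = ffact (m choose 2) (card A)"
    using card_inj_on_subset_funcset[OF A finite_subset_lessThan[of m 2], of A]
    by (simp add: card_subset_lessThan ffact_def atLeast0LessThan)
  finally show ?thesis .
qed

section \<open>Weighted counts of 2-covers\<close>

lemma two_cover_eq_cover: "two_cover n = cover 2 {1..n}"
  by (intro ext) (simp add: two_cover_def cover_def)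

definition covers :: "('a set multiset \<Rightarrow> bool) \<Rightarrow> 'a set \<Rightarrow> 'a set multiset set" where
  "covers Q A = {M. cover 2 A M \<and> Q M}"

lemma finite_covers_pred: "finite A \<Longrightarrow> finite (covers Q A)"
  by (rule finite_subset[OF _ finite_covers[of A 2]]) (auto simp: covers_def)

lemma weight_pos: "weight M > 0"
  by (auto simp: weight_def intro!: divide_pos_pos prod_pos)

lemma weight_le_1: "weight M \<le> 1"
proof -
  have "(\<Prod>S\<in>set_mset M. 1) \<le> (\<Prod>S\<in>set_mset M. fact (count M S) :: real)"
    by (intro prod_mono) (auto simp: fact_ge_1)
  then show ?thesis by (simp add: weight_def divide_le_eq_1)
qed

lemma weight_proper: "proper_cover M \<Longrightarrow> weight M = 1"
proof -
  assume "proper_cover M"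
  then have "fact (count M S) = (1 :: real)" for S
    unfolding proper_cover_def by (auto simp: le_Suc_eq dest: spec[of _ S])
  then show "weight M = 1" by (simp add: weight_def)
qed

lemma weight_sum_covers:
  assumes "finite A"
  shows "(\<Sum>M\<in>covers (\<lambda>_. True) A. weight M) = cover_series (card A) / exp 1"
    and "(\<Sum>M\<in>covers restricted_cover A. weight M) = restricted_series (card A) / exp 1"
proof -
  have "(\<lambda>m. real (m choose 2) ^ card A / fact m) sums (exp 1 * (\<Sum>M\<in>covers (\<lambda>_. True) A. weight M))"
    using cover_weight_sums[OF assms, of 2 "\<lambda>_. True"]
    by (simp add: card_cover_lists[OF assms] covers_def)
  then show "(\<Sum>M\<in>covers (\<lambda>_. True) A. weight M) = cover_series (card A) / exp 1"
    by (simp add: cover_series_def sums_iff)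
  have "(\<lambda>m. real (ffact (m choose 2) (card A)) / fact m) sums (exp 1 * (\<Sum>M\<in>covers restricted_cover A. weight M))"
    using cover_weight_sums[OF assms, of 2 restricted_cover]
    by (simp add: card_restricted_lists[OF assms] covers_def)
  then show "(\<Sum>M\<in>covers restricted_cover A. weight M) = restricted_series (card A) / exp 1"
    by (simp add: restricted_series_def sums_iff)
qed

text \<open>Proper covers have weight 1 and no weight exceeds 1. With
  \<open>weight_sum_le_card\<close> this traps the weighted count between the number of proper
  covers and the number of all covers.\<close>

lemma card_proper_le_weight_sum:
  assumes "finite A"
  shows "real (card (covers (\<lambda>M. Q M \<and> proper_cover M) A)) \<le> (\<Sum>M\<in>covers Q A. weight M)"
proof -
  have "real (card (covers (\<lambda>M. Q M \<and> proper_cover M) A)) =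
      (\<Sum>M\<in>covers (\<lambda>M. Q M \<and> proper_cover M) A. weight M)"
    by (simp add: covers_def weight_proper)
  also have "\<dots> \<le> (\<Sum>M\<in>covers Q A. weight M)"
    using finite_covers_pred[OF assms] weight_pos
    by (intro sum_mono2) (auto simp: covers_def intro: less_imp_le)
  finally show ?thesis .
qed

lemma weight_sum_le_card:
  "(\<Sum>M\<in>covers Q A. weight M) \<le> real (card (covers Q A))"
  using sum_mono[of "covers Q A" weight "\<lambda>_. 1", OF weight_le_1] by simp

section \<open>Covers with repeated sets\<close>

text \<open>The elements of \<open>U\<close> have exhausted their \<open>r\<close> sets within
  \<open>M1\<close>, so no set of \<open>M2\<close> can touch \<open>U\<close>.\<close>

lemma cover_diff:
  assumes M: "cover r A (M1 + M2)" and M1: "cover r U M1" and U: "U \<subseteq> A"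
  shows "cover r (A - U) M2"
proof -
  have size: "size {#S \<in># M1 + M2. d \<in> S#} = size {#S \<in># M1. d \<in> S#} + size {#S \<in># M2. d \<in> S#}" for d
    by simp
  have "S \<noteq> {} \<and> S \<subseteq> A - U" if S: "S \<in># M2" for S
  proof -
    have "d \<notin> U" if d: "d \<in> S" for d
    proof
      assume "d \<in> U"
      then have "size {#S \<in># M1. d \<in> S#} = r" "size {#S \<in># M1 + M2. d \<in> S#} = r"
        using M M1 U unfolding cover_def by blast+
      then have "{#S \<in># M2. d \<in> S#} = {#}" unfolding size by simp
      moreover have "S \<in># {#S \<in># M2. d \<in> S#}" using S d by simp
      ultimately show False by auto
    qed
    moreover have "S \<noteq> {} \<and> S \<subseteq> A" using M S by (simp add: cover_def)
    ultimately show ?thesis by blast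
  qed
  moreover have "size {#S \<in># M2. d \<in> S#} = r" if d: "d \<in> A - U" for d
  proof -
    have "size {#S \<in># M1. d \<in> S#} = 0"
      using M1 d unfolding cover_def by auto
    moreover have "size {#S \<in># M1 + M2. d \<in> S#} = r" using M d unfolding cover_def by blast
    ultimately show ?thesis using size[of d] by linarith
  qed
  ultimately show ?thesis unfolding cover_def by blast
qed

text \<open>Two copies of \<open>S\<close> exhaust the two sets available to \<open>d\<close>. A
  repeated set is therefore disjoint from all others; it is a component with two vertices and
  \<open>card S\<close> edges between them.\<close>

lemma cover_repeated_eq:
  assumes M: "cover 2 A M" and S: "count M S \<ge> 2" and d: "d \<in> S"
  shows "{#T \<in># M. d \<in> T#} = replicate_mset 2 S"
proof -
  have "S \<in># M" using S by (metis count_greater_zero_iff less_le_trans zero_less_numeral)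
  then have dA: "d \<in> A" using M d by (auto simp: cover_def)
  have sub: "replicate_mset 2 S \<subseteq># {#T \<in># M. d \<in> T#}"
    using S d by (simp add: subseteq_mset_def)
  moreover have "size {#T \<in># M. d \<in> T#} = size (replicate_mset 2 S)"
    using M dA by (simp add: cover_def)
  ultimately show ?thesis
    by (metis less_irrefl mset_subset_size subset_mset.le_imp_less_or_eq)
qed

text \<open>All repeated sets are removed simultaneously to make the remainder \<open>N\<close>
  proper, since the number of proper covers is bounded by the weighted count.\<close>

lemma nonproper_cover_decompose:
  assumes M: "cover 2 A M" and np: "\<not> proper_cover M"
  obtains U R N where "U \<subseteq> A" "U \<noteq> {}" "partition_on U R" "M = mset_set R + mset_set R + N"
    "cover 2 (A - U) N" "proper_cover N" "N \<subseteq># M"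
proof -
  define R where "R = {S. count M S \<ge> 2}"
  define U where "U = \<Union>R"
  define M1 where "M1 = filter_mset (\<lambda>S. S \<in> R) M"
  define N where "N = filter_mset (\<lambda>S. S \<notin> R) M"
  have RM: "S \<in># M" if "S \<in> R" for S
    using that unfolding R_def by (metis count_greater_zero_iff less_le_trans mem_Collect_eq zero_less_numeral)
  have finR: "finite R" by (rule finite_subset[of _ "set_mset M"]) (use RM in auto)
  have eq: "M = M1 + N" unfolding M1_def N_def by (rule multiset_partition)
  have sub: "S \<noteq> {}" "S \<subseteq> A" if "S \<in> R" for S
    using RM[OF that] M by (auto simp: cover_def)
  have c2: "count M S = 2" if "S \<in> R" for S
    using that cover_count_le[OF M, of S] by (simp add: R_def)
  have M1_eq: "M1 = mset_set R + mset_set R"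
  proof (rule multiset_eqI)
    show "count M1 S = count (mset_set R + mset_set R) S" for S
      using c2[of S] finR by (cases "S \<in> R") (simp_all add: M1_def)
  qed
  have cov1: "cover 2 U M1"
    unfolding cover_def
  proof (intro conjI ballI)
    fix S assume "S \<in># M1"
    then have "S \<in> R" by (simp add: M1_def)
    then show "S \<noteq> {}" "S \<subseteq> U" using sub by (auto simp: U_def)
  next
    fix d assume "d \<in> U"
    then obtain S where S: "S \<in> R" "d \<in> S" by (auto simp: U_def)
    have "{#T \<in># M1. d \<in> T#} = filter_mset (\<lambda>T. T \<in> R) {#T \<in># M. d \<in> T#}"
      by (simp add: M1_def filter_filter_mset conj_commute)
    also have "\<dots> = filter_mset (\<lambda>T. T \<in> R) (replicate_mset 2 S)"
      using S cover_repeated_eq[OF M, of S d] by (simp add: R_def)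
    finally show "size {#T \<in># M1. d \<in> T#} = 2" using S by (simp add: numeral_2_eq_2)
  qed
  have part: "partition_on U R"
  proof (rule partition_onI)
    show "disjnt S T" if ST: "S \<in> R" "T \<in> R" "S \<noteq> T" for S T
    proof (rule ccontr)
      assume "\<not> disjnt S T"
      then obtain d where d: "d \<in> S" "d \<in> T" by (auto simp: disjnt_def)
      then have "T \<in># {#T \<in># M. d \<in> T#}" using RM ST by simp
      moreover have "{#T \<in># M. d \<in> T#} = replicate_mset 2 S"
        using cover_repeated_eq[OF M _ d(1)] ST by (simp add: R_def)
      ultimately have "T \<in># replicate_mset 2 S" by (simp only:)
      then show False using ST by simp
    qed
    show "{} \<notin> R" using sub by blast
  qed (simp add: U_def)
  have UA: "U \<subseteq> A" using sub by (auto simp: U_def)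
  have "R \<noteq> {}" using np unfolding proper_cover_def R_def by (auto simp: not_le) (metis Suc_leI not_less numeral_2_eq_2)
  then have "U \<noteq> {}" using sub by (auto simp: U_def)
  moreover have "cover 2 (A - U) N"
    using cover_diff[of 2 A M1 N U] M cov1 UA eq by simp
  moreover have "proper_cover N"
    by (auto simp: proper_cover_def N_def R_def not_le)
  moreover have "N \<subseteq># M" by (simp add: N_def)
  moreover have "M = mset_set R + mset_set R + N" using eq unfolding M1_eq .
  ultimately show ?thesis using UA part by (intro that)
qed

text \<open>A partition is the family of fibres of a map sending each point to a representative of
  its block, and there are k^k maps from k points to themselves.\<close>

lemma card_partitions_le:
  assumes U: "finite U"
  shows "finite {R. partition_on U R}" "card {R. partition_on U R} \<le> card U ^ card U"
proof -
  define \<Phi> where "\<Phi> = (\<lambda>f :: 'a \<Rightarrow> 'a. (\<lambda>y. {x \<in> U. f x = y}) ` f ` U)"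
  have sub: "{R. partition_on U R} \<subseteq> \<Phi> ` (U \<rightarrow>\<^sub>E U)"
  proof
    fix R assume "R \<in> {R. partition_on U R}"
    then have R: "partition_on U R" by simp
    \<comment> \<open>The predicate depends only on the block of \<open>x\<close>, so the same
      representative is chosen throughout a block.\<close>
    define f where "f = (\<lambda>x\<in>U. SOME y. \<exists>S\<in>R. x \<in> S \<and> y \<in> S)"
    have same: "S = T" if "S \<in> R" "T \<in> R" "x \<in> S" "x \<in> T" for S T x
      using partition_onD2[OF R] that unfolding disjoint_def by blast
    have RU: "S \<subseteq> U" if "S \<in> R" for S using partition_onD1[OF R] that by blast
    have f_in: "f x \<in> S" if S: "S \<in> R" "x \<in> S" for x S
    proof -
      have "\<exists>y. \<exists>S\<in>R. x \<in> S \<and> y \<in> S" using S by blast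
      then have "\<exists>S\<in>R. x \<in> S \<and> f x \<in> S"
        using RU S someI_ex[of "\<lambda>y. \<exists>S\<in>R. x \<in> S \<and> y \<in> S"] unfolding f_def by auto
      then show ?thesis using same S by blast
    qed
    have f_eq: "f x = f y" if S: "S \<in> R" "x \<in> S" "y \<in> S" for x y S
    proof -
      have "(\<exists>S\<in>R. x \<in> S \<and> z \<in> S) \<longleftrightarrow> (\<exists>S\<in>R. y \<in> S \<and> z \<in> S)" for z
        using same S by blast
      then show ?thesis using RU[OF S(1)] S by (auto simp: f_def)
    qed
    have fibre: "{x \<in> U. f x = f y} = S" if S: "S \<in> R" "y \<in> S" for y S
    proof (intro equalityI subsetI)
      fix x assume x: "x \<in> {x \<in> U. f x = f y}"
      then obtain T where T: "T \<in> R" "x \<in> T" using partition_onD1[OF R] by blast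
      have "f y \<in> T" "f y \<in> S" using f_in[OF T] f_in[OF S] x by auto
      then show "x \<in> S" using same T S by blast
    next
      fix x assume "x \<in> S"
      then show "x \<in> {x \<in> U. f x = f y}" using f_eq[OF S(1) _ S(2)] RU[OF S(1)] by auto
    qed
    have "R = \<Phi> f"
    proof (intro equalityI subsetI)
      fix S assume S: "S \<in> R"
      then obtain y where y: "y \<in> S" using partition_onD3[OF R] by (metis ex_in_conv)
      then have "y \<in> U" using RU[OF S] by blast
      then show "S \<in> \<Phi> f" using fibre[OF S y] unfolding \<Phi>_def by blast
    next
      fix S assume "S \<in> \<Phi> f"
      then obtain y where y: "y \<in> U" "S = {x \<in> U. f x = f y}" by (auto simp: \<Phi>_def)
      then obtain T where "T \<in> R" "y \<in> T" using partition_onD1[OF R] by blast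
      then show "S \<in> R" using fibre[of T y] y by simp
    qed
    moreover have "f \<in> U \<rightarrow>\<^sub>E U"
    proof
      fix x assume "x \<in> U"
      then obtain T where "T \<in> R" "x \<in> T" using partition_onD1[OF R] by blast
      then show "f x \<in> U" using f_in[of T x] RU[of T] by blast
    qed (simp add: f_def)
    ultimately show "R \<in> \<Phi> ` (U \<rightarrow>\<^sub>E U)" by blast
  qed
  have fin: "finite (U \<rightarrow>\<^sub>E U)" using U by (simp add: finite_PiE)
  show "finite {R. partition_on U R}" using sub fin by (meson finite_imageI finite_subset)
  have "card {R. partition_on U R} \<le> card (\<Phi> ` (U \<rightarrow>\<^sub>E U))"
    using sub fin by (intro card_mono) auto
  also have "\<dots> \<le> card (U \<rightarrow>\<^sub>E U)" using fin by (rule card_image_le)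
  also have "\<dots> = card U ^ card U" using U by (rule card_funcsetE)
  finally show "card {R. partition_on U R} \<le> card U ^ card U" .
qed

lemma sum_Pow_card:
  assumes A: "finite A"
  shows "(\<Sum>U\<in>Pow A - {{}}. h (card U)) = (\<Sum>k\<in>{1..card A}. real (card A choose k) * h k)"
proof -
  have fin: "finite (Pow A - {{}})" using A by simp
  have "(\<Sum>U\<in>Pow A - {{}}. h (card U)) =
      (\<Sum>k\<in>{1..card A}. \<Sum>U\<in>{U \<in> Pow A - {{}}. card U = k}. h (card U))"
  proof (rule sum.group[symmetric, OF fin])
    show "card ` (Pow A - {{}}) \<subseteq> {1..card A}"
    proof (rule image_subsetI)
      fix U assume U: "U \<in> Pow A - {{}}"
      then have "finite U" using A by (auto intro: finite_subset)
      with U A show "card U \<in> {1..card A}" by (auto simp: Suc_le_eq card_gt_0_iff intro: card_mono)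
    qed
  qed simp
  also have "\<dots> = (\<Sum>k\<in>{1..card A}. real (card A choose k) * h k)"
  proof (intro sum.cong refl)
    fix k assume k: "k \<in> {1..card A}"
    have "{U \<in> Pow A - {{}}. card U = k} = {U. U \<subseteq> A \<and> card U = k}" using k by auto
    then show "(\<Sum>U\<in>{U \<in> Pow A - {{}}. card U = k}. h (card U)) = real (card A choose k) * h k"
      using n_subsets[OF A, of k] by simp
  qed
  finally show ?thesis .
qed

definition hereditary :: "('a set multiset \<Rightarrow> bool) \<Rightarrow> bool" where
  "hereditary Q \<longleftrightarrow> (\<forall>M N. Q M \<longrightarrow> N \<subseteq># M \<longrightarrow> Q N)"

lemma hereditary_restricted: "hereditary restricted_cover"
  unfolding hereditary_def restricted_cover_def by (blast intro: subset_mset.order_trans)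

lemma card_nonproper_le:
  assumes A: "finite A" and Q: "hereditary Q"
    and X: "\<And>B. finite B \<Longrightarrow> (\<Sum>M\<in>covers Q B. weight M) = X (card B)"
  shows "real (card (covers Q A - covers (\<lambda>M. Q M \<and> proper_cover M) A)) \<le>
    (\<Sum>k\<in>{1..card A}. real (card A choose k) * (real k ^ k * X (card A - k)))"
proof -
  define D where "D = (\<lambda>U. (\<lambda>(R, N). mset_set R + mset_set R + N) `
    ({R. partition_on U R} \<times> covers (\<lambda>M. Q M \<and> proper_cover M) (A - U)))"
  have fin: "finite ({R. partition_on U R} \<times> covers (\<lambda>M. Q M \<and> proper_cover M) (A - U))" if "U \<subseteq> A" for U
    using that A card_partitions_le(1)[of U] finite_covers_pred[of "A - U"] finite_subset by blast
  have sub: "covers Q A - covers (\<lambda>M. Q M \<and> proper_cover M) A \<subseteq> (\<Union>U\<in>Pow A - {{}}. D U)"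
  proof
    fix M assume "M \<in> covers Q A - covers (\<lambda>M. Q M \<and> proper_cover M) A"
    then have M: "cover 2 A M" "Q M" "\<not> proper_cover M" by (auto simp: covers_def)
    obtain U R N where *: "U \<subseteq> A" "U \<noteq> {}" "partition_on U R" "M = mset_set R + mset_set R + N"
      "cover 2 (A - U) N" "proper_cover N" "N \<subseteq># M"
      by (rule nonproper_cover_decompose[OF M(1,3)])
    have "Q N" using Q M(2) *(7) unfolding hereditary_def by blast
    then have "M \<in> D U" unfolding D_def covers_def using * by (intro image_eqI[of _ _ "(R, N)"]) auto
    then show "M \<in> (\<Union>U\<in>Pow A - {{}}. D U)" using * by blast
  qed
  have cardD: "real (card (D U)) \<le> real (card U) ^ card U * X (card A - card U)" if U: "U \<in> Pow A - {{}}" for U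
  proof -
    have finU: "finite U" using U A finite_subset by auto
    have "card (D U) \<le> card ({R. partition_on U R} \<times> covers (\<lambda>M. Q M \<and> proper_cover M) (A - U))"
      unfolding D_def using fin U by (intro card_image_le) auto
    also have "\<dots> = card {R. partition_on U R} * card (covers (\<lambda>M. Q M \<and> proper_cover M) (A - U))"
      by (rule card_cartesian_product)
    finally have "real (card (D U)) \<le>
        real (card {R. partition_on U R}) * real (card (covers (\<lambda>M. Q M \<and> proper_cover M) (A - U)))"
      by (metis of_nat_le_iff of_nat_mult)
    also have "\<dots> \<le> real (card U) ^ card U * X (card A - card U)"
    proof (rule mult_mono)
      show "real (card {R. partition_on U R}) \<le> real (card U) ^ card U"
        using card_partitions_le(2)[OF finU] by (metis of_nat_le_iff of_nat_power)
      have "real (card (covers (\<lambda>M. Q M \<and> proper_cover M) (A - U))) \<le> X (card (A - U))"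
        using card_proper_le_weight_sum[of "A - U" Q] A X[of "A - U"] by simp
      then show "real (card (covers (\<lambda>M. Q M \<and> proper_cover M) (A - U))) \<le> X (card A - card U)"
        using U finU by (simp add: card_Diff_subset)
    qed auto
    finally show ?thesis .
  qed
  have "finite (\<Union>U\<in>Pow A - {{}}. D U)" using A fin by (auto simp: D_def)
  then have "card (covers Q A - covers (\<lambda>M. Q M \<and> proper_cover M) A) \<le> card (\<Union>U\<in>Pow A - {{}}. D U)"
    using sub by (rule card_mono)
  also have "\<dots> \<le> (\<Sum>U\<in>Pow A - {{}}. card (D U))"
    using A by (intro card_UN_le) auto
  finally have "real (card (covers Q A - covers (\<lambda>M. Q M \<and> proper_cover M) A)) \<le> (\<Sum>U\<in>Pow A - {{}}. real (card (D U)))"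
    by (metis of_nat_le_iff of_nat_sum)
  also have "\<dots> \<le> (\<Sum>U\<in>Pow A - {{}}. real (card U) ^ card U * X (card A - card U))"
    using cardD by (rule sum_mono)
  also have "\<dots> = (\<Sum>k\<in>{1..card A}. real (card A choose k) * (real k ^ k * X (card A - k)))"
    using sum_Pow_card[OF A, of "\<lambda>k. real k ^ k * X (card A - k)"] .
  finally show ?thesis .
qed

section \<open>Decay of the series and convolution sums\<close>

text \<open>If c > 2a, each of the k dropped factors is at least c - n \<ge> a. If c \<le> 2a,
  already (2a)^n makes up for the k factors a. For a = n^(3/2) this surplus is harmless by
  \<open>restricted_series_lower_bound\<close>.\<close>

lemma ffact_diff_le:
  fixes a :: real
  assumes k: "k \<le> n" and a: "real n \<le> a" "a > 0"
  shows "real (ffact c (n - k)) \<le> (real (ffact c n) + (2 * a) ^ n) / a ^ k"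
    and "real c ^ (n - k) \<le> (real c ^ n + (2 * a) ^ n) / a ^ k"
proof -
  have small: "real c ^ (n - k) \<le> (2 * a) ^ n / a ^ k" if "real c \<le> 2 * a"
  proof -
    have "real c ^ (n - k) * a ^ k \<le> (2 * a) ^ (n - k) * (2 * a) ^ k"
      using that a by (intro mult_mono power_mono) auto
    also have "\<dots> = (2 * a) ^ n" using k by (metis le_add_diff_inverse2 power_add)
    finally show ?thesis using a by (simp add: pos_le_divide_eq)
  qed
  show "real (ffact c (n - k)) \<le> (real (ffact c n) + (2 * a) ^ n) / a ^ k"
  proof (cases "real c \<le> 2 * a")
    case True
    have "real (ffact c (n - k)) \<le> real c ^ (n - k)"
      using ffact_le_power[of c "n - k"] by (metis of_nat_le_iff of_nat_power)
    also have "\<dots> \<le> (2 * a) ^ n / a ^ k" by (rule small[OF True])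
    also have "\<dots> \<le> (real (ffact c n) + (2 * a) ^ n) / a ^ k"
      using a by (intro divide_right_mono) auto
    finally show ?thesis .
  next
    case False
    have "ffact c n = ffact c (n - k) * (\<Prod>i\<in>{n - k..<n}. c - i)"
      unfolding ffact_def atLeast0LessThan[symmetric] using k
      by (subst prod.atLeastLessThan_concat) auto
    then have "real (ffact c n) = real (ffact c (n - k)) * (\<Prod>i\<in>{n - k..<n}. real (c - i))"
      by simp
    moreover have "(\<Prod>i\<in>{n - k..<n}. a) \<le> (\<Prod>i\<in>{n - k..<n}. real (c - i))"
      using False a by (intro prod_mono) auto
    ultimately have "real (ffact c (n - k)) * a ^ k \<le> real (ffact c n)"
      using k by (simp add: mult_left_mono)
    also have "\<dots> \<le> real (ffact c n) + (2 * a) ^ n" using a by simp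
    finally show ?thesis using a by (simp add: pos_le_divide_eq)
  qed
  show "real c ^ (n - k) \<le> (real c ^ n + (2 * a) ^ n) / a ^ k"
  proof (cases "real c \<le> 2 * a")
    case True
    have "(2 * a) ^ n / a ^ k \<le> (real c ^ n + (2 * a) ^ n) / a ^ k"
      using a by (intro divide_right_mono) auto
    then show ?thesis using small[OF True] by linarith
  next
    case False
    have "real c ^ (n - k) * a ^ k \<le> real c ^ (n - k) * real c ^ k"
      using False a by (intro mult_left_mono power_mono) auto
    also have "\<dots> = real c ^ n" using k by (simp flip: power_add)
    also have "\<dots> \<le> real c ^ n + (2 * a) ^ n" using a by simp
    finally show ?thesis using a by (simp add: pos_le_divide_eq)
  qed
qed

lemma summable_series:
  "summable (\<lambda>m. real (m choose 2) ^ n / fact m)"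
  "summable (\<lambda>m. real (ffact (m choose 2) n) / fact m)"
proof -
  have le: "real (m choose 2) ^ n \<le> real m ^ (2 * n)" for m
  proof -
    have "1 * real (m choose 2) ^ n \<le> 2 ^ n * real (m choose 2) ^ n"
      by (intro mult_right_mono) auto
    then show ?thesis using choose_two_power_le[of n m] by simp
  qed
  have le': "real (ffact (m choose 2) n) \<le> real (m choose 2) ^ n" for m
    using ffact_le_power[of "m choose 2" n] by (metis of_nat_le_iff of_nat_power)
  show 1: "summable (\<lambda>m. real (m choose 2) ^ n / fact m)"
    by (rule summable_comparison_test'[OF summable_power_div_fact[of "2 * n"]])
       (use le in \<open>auto intro: divide_right_mono\<close>)
  show "summable (\<lambda>m. real (ffact (m choose 2) n) / fact m)"
    by (rule summable_comparison_test'[OF 1]) (use le' in \<open>auto intro: divide_right_mono\<close>)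
qed

lemma series_diff_le:
  fixes a :: real and f :: "nat \<Rightarrow> nat \<Rightarrow> real"
  assumes le: "\<And>m. f m (n - k) \<le> (f m n + (2 * a) ^ n) / a ^ k"
    and summ: "\<And>n. summable (\<lambda>m. f m n / fact m)" and a: "a > 0"
  shows "(\<Sum>m. f m (n - k) / fact m) / exp 1 \<le> ((\<Sum>m. f m n / fact m) / exp 1 + (2 * a) ^ n) / a ^ k"
proof -
  let ?b = "(2 * a) ^ n"
  have s1: "(\<lambda>m. ?b * (1 / fact m)) sums (?b * exp 1)"
    by (rule sums_mult[OF exp_1_sums])
  have s2: "(\<lambda>m. (f m n / fact m + ?b * (1 / fact m)) / a ^ k) sums
    (((\<Sum>m. f m n / fact m) + ?b * exp 1) / a ^ k)"
    by (intro sums_divide sums_add s1 summable_sums summ)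
  have "(\<Sum>m. f m (n - k) / fact m) \<le> ((\<Sum>m. f m n / fact m) + ?b * exp 1) / a ^ k"
  proof (rule sums_le[OF _ summable_sums[OF summ] s2])
    show "f m (n - k) / fact m \<le> (f m n / fact m + ?b * (1 / fact m)) / a ^ k" for m
      using divide_right_mono[OF le[of m], of "fact m"]
      by (simp add: add_divide_distrib mult.commute)
  qed
  then have "(\<Sum>m. f m (n - k) / fact m) / exp 1 \<le> ((\<Sum>m. f m n / fact m) + ?b * exp 1) / a ^ k / exp 1"
    by (rule divide_right_mono) simp
  then show ?thesis by (simp add: add_divide_distrib mult.commute)
qed

text \<open>The single term at m = \<open>nat \<lceil>\<mu>\<rceil>\<close> suffices. On the
  logarithmic scale the falling product contributes about 2 n \<theta>, the factorial costs only
  about \<mu> \<theta> = 2n, and the left side is about (3/2) n \<theta>.\<close>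

lemma restricted_series_lower_bound:
  "\<forall>\<^sub>F n in sequentially. (2 * real n powr (3 / 2)) ^ n \<le> restricted_series n / exp 1"
proof -
  have "\<forall>\<^sub>F \<theta>::real in at_top. \<theta> * exp \<theta> / 2 \<ge> 1 \<and>
      exp \<theta> * (exp \<theta> - 1) / 2 - \<theta> * exp \<theta> / 2 > 0 \<and>
      (\<theta> * exp \<theta> / 2) * (ln 2 + 3 / 2 * ln (\<theta> * exp \<theta> / 2)) \<le>
      (\<theta> * exp \<theta> / 2) * ln (exp \<theta> * (exp \<theta> - 1) / 2 - \<theta> * exp \<theta> / 2) - (exp \<theta> + 1) * ln (exp \<theta> + 1) - 1"
    by (intro eventually_conj; real_asymp)
  from eventually_compose_filterlim[OF this saddle_at_top]
  show ?thesis
  proof eventually_elim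
    case (elim n)
    define \<mu> where "\<mu> = exp (saddle n)"
    define m where "m = nat \<lceil>\<mu>\<rceil>"
    \<comment> \<open>A lower bound for every factor \<open>(m choose 2) - i\<close> with i <
      n.\<close>
    define y where "y = \<mu> * (\<mu> - 1) / 2 - real n"
    have n: "saddle n * exp (saddle n) / 2 = real n" using saddle(2)[of n] by simp
    have n1: "real n \<ge> 1" and y: "y > 0"
      and main: "real n * (ln 2 + 3 / 2 * ln (real n)) \<le> real n * ln y - (\<mu> + 1) * ln (\<mu> + 1) - 1"
      using elim unfolding n y_def \<mu>_def by auto
    have \<mu>: "\<mu> \<ge> 1" using saddle(1)[of n] by (simp add: \<mu>_def)
    have m: "\<mu> \<le> real m" "real m \<le> \<mu> + 1" using \<mu> unfolding m_def by linarith+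
    have "\<mu> * (\<mu> - 1) \<le> real m * (real m - 1)" using m \<mu> by (intro mult_mono) auto
    then have c: "y \<le> real (m choose 2) - real n" by (simp add: real_choose_two y_def)
    have "(2 * real n powr (3 / 2)) ^ n = exp (real n * (ln 2 + 3 / 2 * ln (real n)))"
    proof -
      have "2 * real n powr (3 / 2) = exp (ln 2 + 3 / 2 * ln (real n))"
        using n1 by (simp add: exp_add powr_def)
      then show ?thesis by (simp flip: exp_of_nat_mult)
    qed
    also have "\<dots> \<le> exp (real n * ln y - (\<mu> + 1) * ln (\<mu> + 1) - 1)"
      using main by simp
    also have "\<dots> = y ^ n / (\<mu> + 1) powr (\<mu> + 1) / exp 1"
      using y \<mu> by (simp add: exp_diff exp_of_nat_mult powr_def)
    also have "\<dots> \<le> real (ffact (m choose 2) n) / fact m / exp 1"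
    proof (intro divide_right_mono frac_le)
      have "(\<Prod>i<n. y) \<le> (\<Prod>i<n. real ((m choose 2) - i))"
        using c y by (intro prod_mono) auto
      then show "y ^ n \<le> real (ffact (m choose 2) n)" by (simp add: ffact_def)
      have "fact m \<le> real (m ^ m)" by (metis fact_le_power le_refl of_nat_fact of_nat_le_iff)
      also have "real (m ^ m) = real m powr real m" using m \<mu> by (simp add: powr_realpow)
      also have "\<dots> \<le> (\<mu> + 1) powr real m" using m by (intro powr_mono2) auto
      also have "\<dots> \<le> (\<mu> + 1) powr (\<mu> + 1)" using m \<mu> by (intro powr_mono) auto
      finally show "fact m \<le> (\<mu> + 1) powr (\<mu> + 1)" .
    qed auto
    also have "real (ffact (m choose 2) n) / fact m \<le> restricted_series n"
      unfolding restricted_series_def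
      using sum_le_suminf[OF summable_series(2)[of n], of "{m}"] by simp
    finally show ?case by (simp add: divide_right_mono)
  qed
qed

text \<open>
  The exponent $3/2$ is any number strictly between 1 and 2: the true decay rate of both series is
  $X_{n-1}/X_n = n^{-2 + o(1)}$, and the convolution below needs more than $1/n$.
\<close>

definition slowly_decaying :: "(nat \<Rightarrow> real) \<Rightarrow> bool" where
  "slowly_decaying X \<longleftrightarrow> (\<forall>n. X n \<ge> 0) \<and>
    (\<forall>\<^sub>F n in sequentially. X n > 0 \<and> (\<forall>k\<le>n. X (n - k) \<le> 2 * X n / (real n powr (3 / 2)) ^ k))"

text \<open>For a = n^(3/2) the surplus (2a)^n is at most the series itself, whence the factor 2 in
  \<open>slowly_decaying\<close>. The cover series inherits the lower bound because it dominates the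
  restricted one.\<close>

lemma slowly_decaying_series:
  "slowly_decaying (\<lambda>n. cover_series n / exp 1)"
  "slowly_decaying (\<lambda>n. restricted_series n / exp 1)"
proof -
  have nonneg: "cover_series n \<ge> 0" "restricted_series n \<ge> 0" for n
    unfolding cover_series_def restricted_series_def
    by (intro suminf_nonneg summable_series; simp)+
  have le: "restricted_series n \<le> cover_series n" for n
    unfolding cover_series_def restricted_series_def
    using ffact_le_power by (intro suminf_le summable_series divide_right_mono) (simp_all flip: of_nat_power)
  have *: "\<forall>\<^sub>F n in sequentially. X n > 0 \<and> (\<forall>k\<le>n. X (n - k) \<le> 2 * X n / (real n powr (3 / 2)) ^ k)"
    if lower: "\<And>n. restricted_series n / exp 1 \<le> X n"
      and diff: "\<And>n k a. k \<le> n \<Longrightarrow> real n \<le> a \<Longrightarrow> a > 0 \<Longrightarrow> X (n - k) \<le> (X n + (2 * a) ^ n) / a ^ k"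
    for X :: "nat \<Rightarrow> real"
    using restricted_series_lower_bound eventually_gt_at_top[of 0]
  proof eventually_elim
    case (elim n)
    define a where "a = real n powr (3 / 2)"
    have a: "a > 0" using elim by (simp add: a_def)
    have na: "real n \<le> a"
      using elim powr_mono[of 1 "3 / 2" "real n"] by (simp add: a_def)
    have b: "(2 * a) ^ n \<le> X n" using elim lower[of n] by (simp add: a_def)
    have "X n > 0" using b a by (smt (verit) zero_less_power)
    moreover have "X (n - k) \<le> 2 * X n / a ^ k" if "k \<le> n" for k
    proof -
      have "X (n - k) \<le> (X n + (2 * a) ^ n) / a ^ k" by (rule diff[OF that na a])
      also have "\<dots> \<le> 2 * X n / a ^ k" using b a by (intro divide_right_mono) auto
      finally show ?thesis .
    qed
    ultimately show ?case by (simp add: a_def)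
  qed
  show "slowly_decaying (\<lambda>n. cover_series n / exp 1)"
    unfolding slowly_decaying_def cover_series_def
    using nonneg(1)[unfolded cover_series_def] le[unfolded cover_series_def]
    by (intro conjI * series_diff_le ffact_diff_le summable_series) (auto simp: divide_right_mono)
  show "slowly_decaying (\<lambda>n. restricted_series n / exp 1)"
    unfolding slowly_decaying_def restricted_series_def
    using nonneg(2)[unfolded restricted_series_def]
    by (intro conjI * series_diff_le ffact_diff_le summable_series) (auto simp: restricted_series_def)
qed

lemma geometric_sum_le:
  fixes q :: real
  assumes "0 \<le> q" "q \<le> 1 / 2"
  shows "(\<Sum>k\<in>{1..n}. q ^ k) \<le> 2 * q"
proof -
  \<comment> \<open>The added term bounds the missing tail of the geometric series and carries the
    induction.\<close>
  have "(\<Sum>k\<in>{1..n}. q ^ k) + q ^ n * q * 2 \<le> 2 * q"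
  proof (induction n)
    case (Suc n)
    have "q ^ Suc n * (q * 2) \<le> q ^ Suc n * 1"
      using assms by (intro mult_left_mono) auto
    then show ?case using Suc by (simp add: algebra_simps)
  qed (use assms in auto)
  moreover have "q ^ n * q * 2 \<ge> 0" using assms by simp
  ultimately show ?thesis by linarith
qed

text \<open>One term of the exponential series gives k^k/k! \<le> e^k, so up to e^k the number k^k
  of partitions is paid for by the k! in the binomial coefficient.\<close>

lemma choose_mult_power_le: "real (n choose k) * real k ^ k \<le> (exp 1 * real n) ^ k"
proof -
  have "real k ^ k / fact k \<le> exp (real k)"
    using sum_le_suminf[OF summable_exp_generic[of "real k"], of "{k}"]
    by (simp add: exp_def field_simps)
  then have e: "real k ^ k / fact k \<le> exp 1 ^ k" by (simp flip: exp_of_nat_mult)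
  have "real (n choose k) * fact k \<le> real n ^ k"
    using binomial_fact_pow[of n k] by (metis of_nat_fact of_nat_le_iff of_nat_mult of_nat_power)
  then have "real (n choose k) * fact k * (real k ^ k / fact k) \<le> real n ^ k * exp 1 ^ k"
    using e by (intro mult_mono) auto
  then show ?thesis by (simp add: power_mult_distrib mult.commute)
qed

text \<open>The k-th summand is at most 2 q^k \<open>X n\<close> with q = e n/n^(3/2), so the whole
  sum is O(q) times \<open>X n\<close>.\<close>

lemma convolution_negligible:
  assumes X: "slowly_decaying X"
  shows "(\<lambda>n. (\<Sum>k\<in>{1..n}. real (n choose k) * (real k ^ k * X (n - k))) / X n) \<longlonglongrightarrow> 0"
proof (rule tendsto_sandwich[where f = "\<lambda>_. 0"])
  have X0: "X n \<ge> 0" for n using X by (simp add: slowly_decaying_def)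
  show "\<forall>\<^sub>F n in sequentially. 0 \<le> (\<Sum>k\<in>{1..n}. real (n choose k) * (real k ^ k * X (n - k))) / X n"
    using X0 by (intro always_eventually allI divide_nonneg_nonneg sum_nonneg mult_nonneg_nonneg) auto
  have "\<forall>\<^sub>F n in sequentially. exp 1 * real n / real n powr (3 / 2) \<le> 1 / 2" by real_asymp
  moreover have "\<forall>\<^sub>F n in sequentially. X n > 0 \<and> (\<forall>k\<le>n. X (n - k) \<le> 2 * X n / (real n powr (3 / 2)) ^ k)"
    using X by (simp add: slowly_decaying_def)
  ultimately show "\<forall>\<^sub>F n in sequentially. (\<Sum>k\<in>{1..n}. real (n choose k) * (real k ^ k * X (n - k))) / X n
      \<le> 4 * (exp 1 * real n / real n powr (3 / 2))"
  proof eventually_elim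
    case (elim n)
    define q where "q = exp 1 * real n / real n powr (3 / 2)"
    have q: "0 \<le> q" "q \<le> 1 / 2" using elim by (auto simp: q_def)
    have "(\<Sum>k\<in>{1..n}. real (n choose k) * (real k ^ k * X (n - k))) \<le> (\<Sum>k\<in>{1..n}. 2 * X n * q ^ k)"
    proof (intro sum_mono)
      fix k assume k: "k \<in> {1..n}"
      have "real (n choose k) * (real k ^ k * X (n - k)) =
          (real (n choose k) * real k ^ k) * X (n - k)" by simp
      also have "\<dots> \<le> (exp 1 * real n) ^ k * (2 * X n / (real n powr (3 / 2)) ^ k)"
        using elim k X0 by (intro mult_mono choose_mult_power_le) auto
      also have "\<dots> = 2 * X n * q ^ k" by (simp add: q_def power_divide)
      finally show "real (n choose k) * (real k ^ k * X (n - k)) \<le> 2 * X n * q ^ k" .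
    qed
    also have "\<dots> = 2 * X n * (\<Sum>k\<in>{1..n}. q ^ k)" by (simp add: sum_distrib_left)
    also have "\<dots> \<le> 2 * X n * (2 * q)"
      using X0 q by (intro mult_left_mono geometric_sum_le) auto
    finally show ?case using elim by (simp add: q_def field_simps)
  qed
  show "(\<lambda>n. 4 * (exp 1 * real n / real n powr (3 / 2))) \<longlonglongrightarrow> 0" by real_asymp
qed simp

text \<open>\<open>X\<close> and \<open>Y\<close> lie in the same interval from \<open>P\<close> to
  \<open>N\<close>, so they differ by at most its length, which \<open>E\<close> bounds. Both counts
  of covers and the count of line graphs take the role of \<open>Y\<close>.\<close>

lemma sandwich_asymp_equiv:
  fixes X Y P N :: "nat \<Rightarrow> real"
  assumes PX: "\<And>n. P n \<le> X n" "\<And>n. X n \<le> N n" 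
    and diff: "\<forall>\<^sub>F n in sequentially. N n - P n \<le> E n"
    and pos: "\<forall>\<^sub>F n in sequentially. X n > 0" and E: "(\<lambda>n. E n / X n) \<longlonglongrightarrow> 0"
    and Y: "\<And>n. P n \<le> Y n" "\<And>n. Y n \<le> N n"
  shows "Y \<sim>[at_top] X"
proof (rule asymp_equivI')
  have "(\<lambda>n. Y n / X n - 1) \<longlonglongrightarrow> 0"
  proof (rule tendsto_0_le[OF E, where K = 1])
    show "\<forall>\<^sub>F n in sequentially. norm (Y n / X n - 1) \<le> norm (E n / X n) * 1"
      using pos diff
    proof eventually_elim
      case (elim n)
      have "\<bar>Y n - X n\<bar> \<le> E n" using PX[of n] Y[of n] elim by linarith
      then have "\<bar>Y n - X n\<bar> / X n \<le> E n / X n" using elim by (intro divide_right_mono) auto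
      moreover have "norm (Y n / X n - 1) = \<bar>Y n - X n\<bar> / X n"
        using elim by (simp add: field_simps abs_divide)
      ultimately have "norm (Y n / X n - 1) \<le> E n / X n" by simp
      then show ?case using abs_ge_self[of "E n / X n"] unfolding real_norm_def mult_1_right by linarith
    qed
  qed
  then show "(\<lambda>n. Y n / X n) \<longlonglongrightarrow> 1"
    using tendsto_add[of _ 0 _ "\<lambda>_. 1" 1] by fastforce
qed

lemma card_covers_asymp_equiv:
  fixes Q :: "nat set multiset \<Rightarrow> bool"
  assumes Q: "hereditary Q" and X: "slowly_decaying X"
    and weight: "\<And>B :: nat set. finite B \<Longrightarrow> (\<Sum>M\<in>covers Q B. weight M) = X (card B)"
  shows "(\<lambda>n. real (card (covers Q {1..n}))) \<sim>[at_top] X"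
    and "(\<lambda>n. real (card (covers (\<lambda>M. Q M \<and> proper_cover M) {1..n}))) \<sim>[at_top] X"
proof -
  let ?N = "\<lambda>n. real (card (covers Q {1..n}))"
  let ?P = "\<lambda>n. real (card (covers (\<lambda>M. Q M \<and> proper_cover M) {1..n}))"
  have PX: "?P n \<le> X n" "X n \<le> ?N n" for n
    using card_proper_le_weight_sum[of "{1..n}" Q] weight_sum_le_card[of Q "{1..n}"] weight[of "{1..n}"]
    by simp_all
  have diff: "?N n - ?P n \<le> (\<Sum>k\<in>{1..n}. real (n choose k) * (real k ^ k * X (n - k)))" for n
  proof -
    have sub: "covers (\<lambda>M. Q M \<and> proper_cover M) {1..n} \<subseteq> covers Q {1..n}"
      by (auto simp: covers_def)
    have "?N n - ?P n = real (card (covers Q {1..n} - covers (\<lambda>M. Q M \<and> proper_cover M) {1..n}))"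
      using card_mono[OF finite_covers_pred sub] finite_subset[OF sub finite_covers_pred]
      by (subst card_Diff_subset[OF _ sub]) (auto simp: of_nat_diff)
    then show ?thesis
      using card_nonproper_le[of "{1..n}" Q X, OF _ Q weight] by simp
  qed
  have pos: "\<forall>\<^sub>F n in sequentially. X n > 0"
    using X by (auto simp: slowly_decaying_def elim: eventually_mono)
  have PN: "?P n \<le> ?N n" for n using PX[of n] by linarith
  show "?N \<sim>[at_top] X"
    by (rule sandwich_asymp_equiv[OF PX always_eventually pos convolution_negligible[OF X]]) (use PN diff in auto)
  show "?P \<sim>[at_top] X"
    by (rule sandwich_asymp_equiv[OF PX always_eventually pos convolution_negligible[OF X]]) (use PN diff in auto)
qed

section \<open>Line graphs\<close>

definition adjacent :: "'a set multiset \<Rightarrow> 'a \<Rightarrow> 'a \<Rightarrow> bool" where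
  "adjacent M x y \<longleftrightarrow> x \<noteq> y \<and> (\<exists>S\<in>#M. x \<in> S \<and> y \<in> S)"

text \<open>With elements read as edges and sets as vertices, adjacency means sharing a vertex, so
  this is the line graph with its vertices named by the elements.\<close>

definition intersection_graph :: "'a set \<Rightarrow> 'a set multiset \<Rightarrow> 'a sgraph" where
  "intersection_graph A M = (A, {{x, y} | x y. x \<in> A \<and> y \<in> A \<and> adjacent M x y})"

lemma adjacent_sym: "adjacent M x y \<longleftrightarrow> adjacent M y x"
  by (auto simp: adjacent_def)

lemma in_edges_intersection_graph:
  "x \<in> A \<Longrightarrow> y \<in> A \<Longrightarrow> {x, y} \<in> edges (intersection_graph A M) \<longleftrightarrow> adjacent M x y"
  by (auto simp: intersection_graph_def doubleton_eq_iff adjacent_sym)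

lemma incidence_common_iff:
  assumes "x \<in> A"
  shows "i \<in> incidence A xs x \<longleftrightarrow> i < length xs \<and> x \<in> xs ! i"
  using assms by (simp add: incidence_def)

lemma Bex_nonempty_part: "(\<exists>S\<in>#nonempty_part xs. x \<in> S \<and> P S) \<longleftrightarrow> (\<exists>i<length xs. x \<in> xs ! i \<and> P (xs ! i))"
  by (auto simp: in_set_conv_nth)

lemma adjacent_incidence:
  assumes "x \<in> A" "y \<in> A"
  shows "adjacent (nonempty_part xs) x y \<longleftrightarrow> x \<noteq> y \<and> incidence A xs x \<inter> incidence A xs y \<noteq> {}"
  unfolding adjacent_def Bex_nonempty_part using assms by (auto simp: incidence_def)

text \<open>The vertices of \<open>G\<close> are positions in a list rather than sets, because a
  repeated singleton has to give two vertices. Since \<open>M\<close> is restricted, distinct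
  elements become distinct edges.\<close>

lemma intersection_graph_iso_line_graph:
  assumes A: "finite A" and M: "M \<in> covers restricted_cover A"
  obtains G :: "nat sgraph" where "simple_graph G" "graph_iso (intersection_graph A M) (line_graph G)"
proof -
  obtain xs where xs: "mset xs = M" using ex_mset by blast
  have "filter_mset (\<lambda>S. S \<noteq> {}) M = M"
    using M cover_empty_notin[of 2 A M] by (auto simp: filter_mset_eq_conv covers_def)
  then have M_eq: "nonempty_part xs = M" using xs by simp
  have cov: "cover 2 A (nonempty_part xs)" and restr: "restricted_cover (nonempty_part xs)"
    using M unfolding M_eq by (auto simp: covers_def)
  let ?f = "incidence A xs"
  define G :: "nat sgraph" where "G = ({..<length xs}, ?f ` A)"
  have "inj_on ?f A" using restricted_iff_inj_on_incidence[OF A cov] restr by simp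
  then have bij: "bij_betw ?f A (edges G)" by (simp add: G_def bij_betw_def)
  have "simple_graph G"
    using cov unfolding cover_nonempty_part_iff by (auto simp: simple_graph_def G_def incidence_def)
  moreover have "graph_iso (intersection_graph A M) (line_graph G)"
    unfolding graph_iso_def
  proof (intro exI[of _ ?f] conjI ballI)
    show "bij_betw ?f (verts (intersection_graph A M)) (verts (line_graph G))"
      using bij by (simp add: intersection_graph_def line_graph_def)
    fix x y assume "x \<in> verts (intersection_graph A M)" "y \<in> verts (intersection_graph A M)"
    then have xy: "x \<in> A" "y \<in> A" by (auto simp: intersection_graph_def)
    have "{?f x, ?f y} \<in> edges (line_graph G) \<longleftrightarrow> ?f x \<noteq> ?f y \<and> ?f x \<inter> ?f y \<noteq> {}"
      using xy by (auto simp: line_graph_def G_def doubleton_eq_iff)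
    also have "\<dots> \<longleftrightarrow> adjacent M x y"
      using adjacent_incidence[OF xy, of xs] \<open>inj_on ?f A\<close> xy unfolding M_eq by (auto dest: inj_onD)
    finally show "{x, y} \<in> edges (intersection_graph A M) \<longleftrightarrow> {?f x, ?f y} \<in> edges (line_graph G)"
      using in_edges_intersection_graph[OF xy] by simp
  qed
  ultimately show ?thesis by (rule that)
qed

lemma sgraph_eqI:
  assumes "simple_graph G" "simple_graph H" "verts G = verts H"
    and "\<And>x y. x \<in> verts G \<Longrightarrow> y \<in> verts G \<Longrightarrow> {x, y} \<in> edges G \<longleftrightarrow> {x, y} \<in> edges H"
  shows "G = H"
proof (rule prod_eqI)
  have sub: "edges G \<subseteq> edges H" if "simple_graph G" "verts G = verts H"
    "\<And>x y. x \<in> verts G \<Longrightarrow> y \<in> verts G \<Longrightarrow> {x, y} \<in> edges G \<longleftrightarrow> {x, y} \<in> edges H" for G H :: "'a sgraph"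
  proof
    fix e assume e: "e \<in> edges G"
    then have "e \<subseteq> verts G" "card e = 2" using that(1) by (auto simp: simple_graph_def)
    then obtain x y where "e = {x, y}" "x \<in> verts G" "y \<in> verts G" by (auto simp: card_2_iff)
    then show "e \<in> edges H" using that(3) e by auto
  qed
  show "edges G = edges H"
    using sub[of G H] sub[of H G] assms by auto
qed (rule assms)

lemma simple_intersection_graph: "simple_graph (intersection_graph A M)"
  by (auto simp: simple_graph_def intersection_graph_def adjacent_def)

lemma line_graph_is_intersection_graph:
  assumes A: "finite A" and H: "simple_graph H" "verts H = A"
    and G: "simple_graph (G :: 'b sgraph)" and iso: "graph_iso H (line_graph G)"
  shows "H \<in> intersection_graph A ` covers restricted_cover A"
proof -
  obtain f where f: "bij_betw f A (edges G)"
    and fe: "\<And>x y. x \<in> A \<Longrightarrow> y \<in> A \<Longrightarrow> {x, y} \<in> edges H \<longleftrightarrow> {f x, f y} \<in> edges (line_graph G)"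
    using iso H by (auto simp: graph_iso_def line_graph_def)
  \<comment> \<open>Isolated vertices are discarded: they would only yield empty sets, and without
    them finitely many edges leave finitely many vertices.\<close>
  define V where "V = \<Union>(edges G)"
  have card2: "card e = 2" if "e \<in> edges G" for e
    using G that by (auto simp: simple_graph_def)
  have "finite (edges G)" using f A bij_betw_finite by blast
  then have finV: "finite V"
    unfolding V_def using card2 by (metis card.infinite finite_Union zero_neq_numeral)
  obtain h where h: "bij_betw h V {..<card V}"
    using ex_bij_betw_finite_nat[OF finV] by (auto simp: atLeast0LessThan)
  have inj_h: "inj_on h V" using h by (rule bij_betw_imp_inj_on)
  have fV: "f x \<subseteq> V" and fG: "f x \<in> edges G" if "x \<in> A" for x
    using bij_betwE[OF f] that by (auto simp: V_def)
  define g where "g = (\<lambda>x\<in>A. h ` f x)"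
  have gcard: "card (h ` f x) = 2" "h ` f x \<subseteq> {..<card V}" if "x \<in> A" for x
    using card2[OF fG[OF that]] card_image[OF inj_on_subset[OF inj_h fV[OF that]]]
      bij_betw_imp_surj_on[OF h] fV[OF that] by auto
  then have "g \<in> A \<rightarrow>\<^sub>E {T. T \<subseteq> {..<card V} \<and> card T = 2}" by (auto simp: g_def)
  then have "g \<in> incidence A ` {xs. length xs = card V \<and> cover 2 A (nonempty_part xs)}"
    unfolding bij_betw_imp_surj_on[OF bij_betw_incidence[of A "card V" 2]] .
  then obtain xs where xs: "length xs = card V" "cover 2 A (nonempty_part xs)" "incidence A xs = g"
    by blast
  have "inj_on g A"
  proof (rule inj_onI)
    fix x y assume xy: "x \<in> A" "y \<in> A" "g x = g y"
    then have "h ` f x = h ` f y" by (simp add: g_def)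
    then have "f x = f y" using inj_on_image_eq_iff[OF inj_h fV fV] xy by blast
    then show "x = y" using bij_betw_imp_inj_on[OF f] xy by (auto dest: inj_onD)
  qed
  then have restr: "restricted_cover (nonempty_part xs)"
    using restricted_iff_inj_on_incidence[OF A xs(2)] xs(3) by simp
  have "H = intersection_graph A (nonempty_part xs)"
  proof (rule sgraph_eqI[OF H(1) simple_intersection_graph])
    show "verts H = verts (intersection_graph A (nonempty_part xs))" using H by (simp add: intersection_graph_def)
    fix x y assume "x \<in> verts H" "y \<in> verts H"
    then have xy: "x \<in> A" "y \<in> A" using H by auto
    have "{x, y} \<in> edges H \<longleftrightarrow> f x \<noteq> f y \<and> f x \<inter> f y \<noteq> {}"
      unfolding fe[OF xy] using fG[OF xy(1)] fG[OF xy(2)]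
      by (auto simp: line_graph_def doubleton_eq_iff)
    also have "f x \<noteq> f y \<longleftrightarrow> x \<noteq> y"
      using bij_betw_imp_inj_on[OF f] xy by (auto dest: inj_onD)
    also have "f x \<inter> f y \<noteq> {} \<longleftrightarrow> g x \<inter> g y \<noteq> {}"
      using inj_on_image_Int[OF inj_h fV[OF xy(1)] fV[OF xy(2)]] xy by (simp add: g_def) (metis image_is_empty)
    finally show "{x, y} \<in> edges H \<longleftrightarrow> {x, y} \<in> edges (intersection_graph A (nonempty_part xs))"
      unfolding in_edges_intersection_graph[OF xy] adjacent_incidence[OF xy] xs(3) .
  qed
  then show ?thesis using xs(2) restr by (auto simp: covers_def)
qed

text \<open>Line graphs are thus the images of the restricted covers, and only the failure of
  injectivity remains to be estimated.\<close>

lemma labelled_line_graphs_eq: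
  "{H. labelled_line_graph n H} = intersection_graph {1..n} ` covers restricted_cover {1..n}"
proof (intro equalityI subsetI)
  fix H assume "H \<in> {H. labelled_line_graph n H}"
  then show "H \<in> intersection_graph {1..n} ` covers restricted_cover {1..n}"
    using line_graph_is_intersection_graph[of "{1..n}" H] by (auto simp: labelled_line_graph_def)
next
  fix H assume "H \<in> intersection_graph {1..n} ` covers restricted_cover {1..n}"
  then obtain M where M: "M \<in> covers restricted_cover {1..n}" "H = intersection_graph {1..n} M" by blast
  obtain G :: "nat sgraph" where "simple_graph G" "graph_iso H (line_graph G)"
    using intersection_graph_iso_line_graph[OF _ M(1)] M(2) by auto
  moreover have "verts H = {1..n}" using M(2) by (simp add: intersection_graph_def)
  moreover have "simple_graph H" using M(2) simple_intersection_graph by simp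
  ultimately show "H \<in> {H. labelled_line_graph n H}"
    unfolding labelled_line_graph_def by blast
qed

text \<open>
  In a line graph, three pairwise adjacent vertices that come from a triangle are joined to every other
  vertex an even number of times. Hence a claw is recognisable as such as soon as some other vertex is
  joined to it an odd number of times; a claw without such a vertex lies in a component with at most
  six edges (a subgraph of $K_4$).
\<close>

definition no_even_claw :: "'a set \<Rightarrow> 'a set multiset \<Rightarrow> bool" where
  "no_even_claw A M \<longleftrightarrow>
    (\<forall>S\<in>#M. card S = 3 \<longrightarrow> (\<exists>w\<in>A - S. odd (card {v \<in> S. adjacent M v w})))"

section \<open>Recovering a cover from its intersection graph\<close>

lemma restricted_eqI:
  assumes M: "restricted_cover M" and ST: "S \<in># M" "T \<in># M" and fin: "finite S"
    and xy: "x \<noteq> y" "x \<in> S" "y \<in> S" "x \<in> T" "y \<in> T"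
  shows "S = T"
proof (rule ccontr)
  assume ne: "S \<noteq> T"
  obtain N where N: "M = add_mset S N" using ST(1) by (metis mset_add)
  then have "T \<in># N" using ST(2) ne by auto
  then have "{#S, T#} \<subseteq># M" using N by (simp add: single_subset_iff)
  then have "card (S \<inter> T) \<le> 1" using M unfolding restricted_cover_def by blast
  moreover have "card {x, y} \<le> card (S \<inter> T)" using fin xy by (intro card_mono) auto
  ultimately show False using xy(1) by simp
qed

lemma restricted_count_le:
  assumes M: "restricted_cover M" and S: "card S \<ge> 2"
  shows "count M S \<le> 1"
proof (rule ccontr)
  assume "\<not> count M S \<le> 1"
  then have "{#S, S#} \<subseteq># M" by (simp add: subseteq_mset_def)
  then have "card (S \<inter> S) \<le> 1" using M unfolding restricted_cover_def by blast
  then show False using S by simp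
qed

lemma cover_obtain_list:
  assumes "cover r A M"
  obtains xs where "mset xs = M" "nonempty_part xs = M"
proof -
  obtain xs where xs: "mset xs = M" using ex_mset by blast
  moreover have "filter_mset (\<lambda>S. S \<noteq> {}) M = M"
    using cover_empty_notin[OF assms] by (auto simp: filter_mset_eq_conv)
  ultimately show ?thesis using that by simp
qed

text \<open>A set larger than {x, y, z} supplies a witness joined to all three; a set equal to it
  has one by \<open>no_even_claw\<close>. Conversely, three pairwise adjacent edges without a common
  vertex form a triangle, and any further edge contains at most one corner, hence meets none or two
  of the sides.\<close>

lemma claw_iff:
  assumes A: "finite A" and M: "M \<in> covers restricted_cover A" and good: "no_even_claw A M"
    and xyz: "x \<in> A" "y \<in> A" "z \<in> A" "x \<noteq> y" "y \<noteq> z" "x \<noteq> z"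
  shows "(\<exists>S\<in>#M. {x, y, z} \<subseteq> S) \<longleftrightarrow> adjacent M x y \<and> adjacent M y z \<and> adjacent M x z \<and>
    (\<exists>w\<in>A - {x, y, z}. odd (card {v \<in> {x, y, z}. adjacent M v w}))"
proof
  assume "\<exists>S\<in>#M. {x, y, z} \<subseteq> S"
  then obtain S where S: "S \<in># M" "{x, y, z} \<subseteq> S" by blast
  have SA: "S \<subseteq> A" using M S by (auto simp: covers_def cover_def)
  then have finS: "finite S" using A finite_subset by blast
  have "\<exists>w\<in>A - {x, y, z}. odd (card {v \<in> {x, y, z}. adjacent M v w})"
  proof (cases "S = {x, y, z}")
    case True
    then have "card S = 3" using xyz by simp
    then show ?thesis using good S True unfolding no_even_claw_def by blast
  next
    case False
    then obtain w where w: "w \<in> S" "w \<notin> {x, y, z}" using S by blast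
    then have "{v \<in> {x, y, z}. adjacent M v w} = {x, y, z}"
      using S by (auto simp: adjacent_def)
    then have "odd (card {v \<in> {x, y, z}. adjacent M v w})" using xyz by simp
    then show ?thesis using w SA by blast
  qed
  then show "adjacent M x y \<and> adjacent M y z \<and> adjacent M x z \<and>
    (\<exists>w\<in>A - {x, y, z}. odd (card {v \<in> {x, y, z}. adjacent M v w}))"
    using S xyz by (auto simp: adjacent_def)
next
  assume R: "adjacent M x y \<and> adjacent M y z \<and> adjacent M x z \<and>
    (\<exists>w\<in>A - {x, y, z}. odd (card {v \<in> {x, y, z}. adjacent M v w}))"
  show "\<exists>S\<in>#M. {x, y, z} \<subseteq> S"
  proof (rule ccontr)
    assume no: "\<not> (\<exists>S\<in>#M. {x, y, z} \<subseteq> S)"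
    obtain xs where xs: "nonempty_part xs = M"
      using M cover_obtain_list[of 2 A M] by (auto simp: covers_def)
    have cov: "cover 2 A (nonempty_part xs)" and restr: "restricted_cover (nonempty_part xs)"
      using M xs by (auto simp: covers_def)
    define f where "f = incidence A xs"
    have inj: "inj_on f A" using restricted_iff_inj_on_incidence[OF A cov] restr by (simp add: f_def)
    have card2: "card (f v) = 2" if "v \<in> A" for v
      using cov that unfolding cover_nonempty_part_iff f_def by blast
    have adj: "adjacent M u v \<longleftrightarrow> u \<noteq> v \<and> f u \<inter> f v \<noteq> {}" if "u \<in> A" "v \<in> A" for u v
      using adjacent_incidence[OF that, of xs] unfolding xs f_def .
    have disj: "f x \<inter> f y \<inter> f z = {}"
    proof (rule ccontr)
      assume "f x \<inter> f y \<inter> f z \<noteq> {}"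
      then obtain i where "i < length xs" "x \<in> xs ! i" "y \<in> xs ! i" "z \<in> xs ! i"
        using xyz by (auto simp: f_def incidence_def)
      then have "\<exists>S\<in>#nonempty_part xs. x \<in> S \<and> {y, z} \<subseteq> S" unfolding Bex_nonempty_part by auto
      then show False using no unfolding xs by blast
    qed
    obtain a where a: "a \<in> f x" "a \<in> f y" using R adj xyz by blast
    obtain b where b: "b \<in> f y" "b \<in> f z" using R adj xyz by blast
    obtain c where c: "c \<in> f x" "c \<in> f z" using R adj xyz by blast
    have ne: "a \<noteq> b" "b \<noteq> c" "a \<noteq> c" using a b c disj by auto
    have pair: "f v = {p, q}" if "v \<in> A" "p \<in> f v" "q \<in> f v" "p \<noteq> q" for v p q
      using card2[OF that(1)] that(2-) by (auto simp: card_2_iff)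
    have fx: "f x = {a, c}" and fy: "f y = {a, b}" and fz: "f z = {b, c}"
      using pair xyz a b c ne by auto
    obtain w where w: "w \<in> A" "w \<notin> {x, y, z}" and odd: "odd (card {v \<in> {x, y, z}. adjacent M v w})"
      using R by blast
    have ad: "adjacent M x w \<longleftrightarrow> a \<in> f w \<or> c \<in> f w" "adjacent M y w \<longleftrightarrow> a \<in> f w \<or> b \<in> f w"
      "adjacent M z w \<longleftrightarrow> b \<in> f w \<or> c \<in> f w"
      using adj[of _ w] xyz w by (auto simp: fx fy fz)
    \<comment> \<open>An edge through two corners would coincide with a side of the triangle,
      against injectivity.\<close>
    have not2: "\<not> (a \<in> f w \<and> c \<in> f w)" "\<not> (a \<in> f w \<and> b \<in> f w)" "\<not> (b \<in> f w \<and> c \<in> f w)"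
      using pair[OF w(1)] ne inj_onD[OF inj _ w(1)] xyz w fx fy fz by (metis insertCI)+
    have "{v \<in> {x, y, z}. adjacent M v w} =
        (if a \<in> f w then {x, y} else if b \<in> f w then {y, z} else if c \<in> f w then {x, z} else {})"
      using ad not2 by auto
    then have "even (card {v \<in> {x, y, z}. adjacent M v w})"
      using xyz by simp
    then show False using odd by blast
  qed
qed

text \<open>Recovers a set from two of its elements and the knowledge of which triples lie in a
  common set; \<open>claw_iff\<close> reads the latter off the graph.\<close>

lemma block_eq:
  assumes A: "finite A" and M: "M \<in> covers restricted_cover A"
    and S: "S \<in># M" "x \<in> S" "y \<in> S" "x \<noteq> y"
  shows "S = {x, y} \<union> {z \<in> A - {x, y}. \<exists>T\<in>#M. {x, y, z} \<subseteq> T}"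
proof -
  have "S \<subseteq> A" "finite S" using M S A by (auto simp: covers_def cover_def intro: finite_subset)
  moreover have "T = S" if "T \<in># M" "{x, y, z} \<subseteq> T" for T z
    using restricted_eqI[of M S T x y] that S M \<open>finite S\<close> by (auto simp: covers_def)
  ultimately show ?thesis using S by blast
qed

text \<open>Sets with at least two elements are recovered by \<open>block_eq\<close> and have
  multiplicity at most 1. Singletons leave no trace in the graph, but every element lies in exactly
  two sets, so {x} occurs 2 minus the number of larger sets through x times.\<close>

lemma intersection_graph_inj_on:
  assumes A: "finite A"
  shows "inj_on (intersection_graph A) {M \<in> covers restricted_cover A. no_even_claw A M}"
proof (rule inj_onI)
  fix M M' assume M: "M \<in> {M \<in> covers restricted_cover A. no_even_claw A M}"
    and M': "M' \<in> {M \<in> covers restricted_cover A. no_even_claw A M}"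
    and eq: "intersection_graph A M = intersection_graph A M'"
  have adj: "adjacent M x y \<longleftrightarrow> adjacent M' x y" if "x \<in> A" "y \<in> A" for x y
    using in_edges_intersection_graph[OF that, of M] in_edges_intersection_graph[OF that, of M'] eq by simp
  have claw: "(\<exists>S\<in>#M. {x, y, z} \<subseteq> S) \<longleftrightarrow> (\<exists>S\<in>#M'. {x, y, z} \<subseteq> S)"
    if "x \<in> A" "y \<in> A" "z \<in> A" "x \<noteq> y" "y \<noteq> z" "x \<noteq> z" for x y z
  proof -
    have "{v \<in> {x, y, z}. adjacent M v w} = {v \<in> {x, y, z}. adjacent M' v w}" if "w \<in> A" for w
      using adj \<open>x \<in> A\<close> \<open>y \<in> A\<close> \<open>z \<in> A\<close> that by auto
    then show ?thesis
      using claw_iff[OF A _ _ that, of M] claw_iff[OF A _ _ that, of M'] M M' adj that by auto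
  qed
  have sub: "S \<noteq> {} \<and> S \<subseteq> A" if "S \<in># M \<or> S \<in># M'" for S
    using that M M' unfolding covers_def cover_def by blast
  have fin: "finite S" "S \<noteq> {}" "S \<subseteq> A" if "S \<in># M \<or> S \<in># M'" for S
    using sub[OF that] A finite_subset by blast+
  have transfer: "S \<in># N'"
    if N: "N \<in> covers restricted_cover A" and N': "N' \<in> covers restricted_cover A"
      and adjN: "\<And>x y. x \<in> A \<Longrightarrow> y \<in> A \<Longrightarrow> adjacent N x y \<longleftrightarrow> adjacent N' x y"
      and clawN: "\<And>x y z. x \<in> A \<Longrightarrow> y \<in> A \<Longrightarrow> z \<in> A \<Longrightarrow> x \<noteq> y \<Longrightarrow> y \<noteq> z \<Longrightarrow> x \<noteq> z \<Longrightarrow>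
        (\<exists>S\<in>#N. {x, y, z} \<subseteq> S) \<longleftrightarrow> (\<exists>S\<in>#N'. {x, y, z} \<subseteq> S)"
      and S: "S \<in># N" "card S \<ge> 2" for N N' S
  proof -
    have SA: "S \<subseteq> A" using N S by (auto simp: covers_def cover_def)
    then have "finite S" using A finite_subset by blast
    then have "\<not> card S \<le> Suc 0" using S by simp
    then obtain x y where xy: "x \<in> S" "y \<in> S" "x \<noteq> y"
      using card_le_Suc0_iff_eq[OF \<open>finite S\<close>] by blast
    have xyA: "x \<in> A" "y \<in> A" using xy SA by auto
    have "adjacent N x y" using xy S by (auto simp: adjacent_def)
    then obtain S' where S': "S' \<in># N'" "x \<in> S'" "y \<in> S'"
      using adjN[OF xyA] by (auto simp: adjacent_def)
    have "{z \<in> A - {x, y}. \<exists>T\<in>#N. {x, y, z} \<subseteq> T} = {z \<in> A - {x, y}. \<exists>T\<in>#N'. {x, y, z} \<subseteq> T}"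
      using clawN[OF xyA] xy by (intro Collect_cong) auto
    then have "S = S'"
      using block_eq[OF A N S(1) xy] block_eq[OF A N' S' xy(3)] by simp
    then show ?thesis using S' by simp
  qed
  have big: "count M S = count M' S" if S: "card S \<ge> 2" for S
  proof -
    have "S \<in># M \<longleftrightarrow> S \<in># M'"
      using transfer[of M M' S] transfer[of M' M S] adj claw S M M' by auto
    moreover have "count M S \<le> 1" "count M' S \<le> 1"
      using restricted_count_le[OF _ S] M M' by (auto simp: covers_def)
    ultimately show ?thesis
      by (metis One_nat_def count_greater_zero_iff le_Suc_eq le_zero_eq not_gr_zero)
  qed
  show "M = M'"
  proof (rule multiset_eqI)
    fix S
    consider "card S \<ge> 2" | "S \<notin># M" "S \<notin># M'" | x where "S = {x}" "x \<in> A"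
    proof -
      assume *: "2 \<le> card S \<Longrightarrow> thesis" "S \<notin># M \<Longrightarrow> S \<notin># M' \<Longrightarrow> thesis" "\<And>x. S = {x} \<Longrightarrow> x \<in> A \<Longrightarrow> thesis"
      show thesis
      proof (cases "S \<in># M \<or> S \<in># M'")
        case True
        note f = fin[OF True]
        show thesis
        proof (cases "card S \<ge> 2")
          case False
          then have "card S = 1" using f by (metis One_nat_def Suc_1 Suc_leI card_gt_0_iff le_antisym not_less_eq_eq)
          then obtain x where "S = {x}" by (auto simp: card_1_singleton_iff)
          then show thesis using *(3) f by auto
        qed (use * in auto)
      qed (use * in auto)
    qed
    then show "count M S = count M' S"
    proof cases
      case 1
      then show ?thesis by (rule big)
    next
      case 2
      then show ?thesis by (simp add: not_in_iff)
    next
      case (3 x)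
      have split: "size {#T \<in># N. x \<in> T#} = size {#T \<in># N. card T \<ge> 2 \<and> x \<in> T#} + count N {x}"
        if N: "N = M \<or> N = M'" for N
      proof -
        have "{#T \<in># N. x \<in> T#} = {#T \<in># N. card T \<ge> 2 \<and> x \<in> T#} + replicate_mset (count N {x}) {x}"
        proof (rule multiset_eqI)
          fix T
          show "count {#T \<in># N. x \<in> T#} T =
            count ({#T \<in># N. card T \<ge> 2 \<and> x \<in> T#} + replicate_mset (count N {x}) {x}) T"
          proof (cases "T \<in># N \<and> x \<in> T \<and> \<not> card T \<ge> 2")
            case True
            then have "finite T" using fin N by blast
            then have "T = {x}" using True card_le_Suc0_iff_eq[of T] by auto
            then show ?thesis by simp
          next
            case False
            then show ?thesis by (auto simp: not_in_iff)
          qed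
        qed
        then show ?thesis by simp
      qed
      have "{#T \<in># M. card T \<ge> 2 \<and> x \<in> T#} = {#T \<in># M'. card T \<ge> 2 \<and> x \<in> T#}"
        using big by (auto simp: multiset_eq_iff)
      moreover have "size {#T \<in># M. x \<in> T#} = 2" "size {#T \<in># M'. x \<in> T#} = 2"
        using M M' 3 by (auto simp: covers_def cover_def)
      ultimately show ?thesis using split[of M] split[of M'] 3 by simp
    qed
  qed
qed

section \<open>Covers whose claws escape the parity test\<close>

text \<open>Let the claw have edges pa, pb, pc. By parity any other edge touching {p, a, b, c} meets
  exactly two of them, and as it misses p, it is ab, bc or ac. So these four vertices carry a union
  of components with at most 3 + 3 edges: \<open>U\<close> is the set of its edges,
  \<open>M1\<close> consists of its four vertices.\<close>

lemma even_claw_decompose: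
  assumes A: "finite A" and M: "M \<in> covers restricted_cover A" and bad: "\<not> no_even_claw A M"
  obtains U M1 N where "U \<subseteq> A" "U \<noteq> {}" "card U \<le> 6" "size M1 = 4" "set_mset M1 \<subseteq> Pow U"
    "M = M1 + N" "N \<in> covers restricted_cover (A - U)"
proof -
  obtain S where S: "S \<in># M" "card S = 3" and ev: "\<And>w. w \<in> A - S \<Longrightarrow> even (card {v \<in> S. adjacent M v w})"
    using bad unfolding no_even_claw_def by blast
  obtain xs where xs: "mset xs = M" "nonempty_part xs = M"
    using M cover_obtain_list[of 2 A M] by (auto simp: covers_def)
  have cov: "cover 2 A (nonempty_part xs)" and restr: "restricted_cover (nonempty_part xs)"
    using M xs by (auto simp: covers_def)
  define f where "f = incidence A xs"
  have inj: "inj_on f A" using restricted_iff_inj_on_incidence[OF A cov] restr by (simp add: f_def)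
  have card2: "card (f v) = 2" if "v \<in> A" for v
    using cov that unfolding cover_nonempty_part_iff f_def by blast
  have adj: "adjacent M u v \<longleftrightarrow> u \<noteq> v \<and> f u \<inter> f v \<noteq> {}" if "u \<in> A" "v \<in> A" for u v
    using adjacent_incidence[OF that, of xs] unfolding xs(2) f_def .
  have mem: "i \<in> f d \<longleftrightarrow> i < length xs \<and> d \<in> xs ! i" if "d \<in> A" for i d
    unfolding f_def by (rule incidence_common_iff[OF that])
  have SA: "S \<subseteq> A" using M S by (auto simp: covers_def cover_def)
  obtain p where p: "p < length xs" "xs ! p = S"
    using S(1) xs(1) by (metis in_set_conv_nth set_mset_mset)
  obtain x y z where xyz: "S = {x, y, z}" "x \<noteq> y" "y \<noteq> z" "x \<noteq> z"
    using S(2) by (auto simp: card_3_iff)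
  have xyzA: "x \<in> A" "y \<in> A" "z \<in> A" using SA xyz by auto
  have other: "\<exists>i. f v = {p, i} \<and> i \<noteq> p" if "v \<in> S" for v
  proof -
    have "v \<in> A" "p \<in> f v" using that SA p mem by auto
    then show ?thesis using card2[of v] by (auto simp: card_2_iff)
  qed
  obtain a where a: "f x = {p, a}" "a \<noteq> p" using other[of x] xyz by auto
  obtain b where b: "f y = {p, b}" "b \<noteq> p" using other[of y] xyz by auto
  obtain c where c: "f z = {p, c}" "c \<noteq> p" using other[of z] xyz by auto
  have abc: "a \<noteq> b" "b \<noteq> c" "a \<noteq> c"
    using inj_onD[OF inj _ xyzA(1,2)] inj_onD[OF inj _ xyzA(2,3)] inj_onD[OF inj _ xyzA(1,3)] a b c xyz by auto
  define I where "I = {p, a, b, c}"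
  have cardI: "card I = 4" using abc a b c by (simp add: I_def)
  have finI: "finite I" by (simp add: I_def)
  have "a < length xs" "b < length xs" "c < length xs"
    using mem[OF xyzA(1), of a] mem[OF xyzA(2), of b] mem[OF xyzA(3), of c] a b c by auto
  then have I_sub: "I \<subseteq> {..<length xs}" using p by (simp add: I_def)
  define M1 where "M1 = image_mset ((!) xs) (mset_set I)"
  define U where "U = (\<Union>i\<in>I. xs ! i)"
  have "M1 \<subseteq># image_mset ((!) xs) (mset_set {..<length xs})"
    unfolding M1_def using I_sub by (intro image_mset_subseteq_mono subset_imp_msubset_mset_set) auto
  also have "image_mset ((!) xs) (mset_set {..<length xs}) = mset xs"
    by (metis map_nth mset_map mset_upt atLeast0LessThan)
  finally have M1_sub: "M1 \<subseteq># M" using xs by simp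
  have size_at: "size {#T \<in># M1. d \<in> T#} = card {i \<in> I. d \<in> xs ! i}" for d
    using finI by (simp add: M1_def filter_mset_image_mset)
  have UA: "U \<subseteq> A"
    using cov I_sub unfolding cover_nonempty_part_iff U_def by (auto simp: subset_iff)
  have outside: "f d = {a, b} \<or> f d = {b, c} \<or> f d = {a, c}" if d: "d \<in> U - S" for d
  proof -
    have dA: "d \<in> A" using d UA by blast
    \<comment> \<open>\<open>S\<close> consists of all edges at p, so an edge outside
      \<open>S\<close> misses p.\<close>
    have pd: "p \<notin> f d" using d p mem[OF dA] by auto
    have ne: "x \<noteq> d" "y \<noteq> d" "z \<noteq> d" using d xyz by auto
    have ad: "adjacent M x d \<longleftrightarrow> a \<in> f d" "adjacent M y d \<longleftrightarrow> b \<in> f d" "adjacent M z d \<longleftrightarrow> c \<in> f d"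
      using adj[OF _ dA] xyzA ne pd by (auto simp: a b c)
    have eq: "{v \<in> S. adjacent M v d} = (if a \<in> f d then {x} else {}) \<union> (if b \<in> f d then {y} else {}) \<union>
        (if c \<in> f d then {z} else {})"
      using ad xyz by auto
    have "even (card {v \<in> S. adjacent M v d})" using ev[of d] d dA by blast
    moreover have "a \<in> f d \<or> b \<in> f d \<or> c \<in> f d"
      using d p I_sub mem[OF dA] by (auto simp: U_def I_def)
    ultimately have "a \<in> f d \<and> b \<in> f d \<or> b \<in> f d \<and> c \<in> f d \<or> a \<in> f d \<and> c \<in> f d"
      unfolding eq by (auto split: if_splits)
    moreover have "f d = {i, j}" if "i \<in> f d" "j \<in> f d" "i \<noteq> j" for i j
      using card_seteq[of "f d" "{i, j}"] card_ge_0_finite[of "f d"] card2[OF dA] that by auto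
    ultimately show ?thesis using abc by blast
  qed
  have inside: "f d \<subseteq> I" if d: "d \<in> U" for d
  proof (cases "d \<in> S")
    case True
    then show ?thesis using xyz a b c by (auto simp: I_def)
  next
    case False
    then show ?thesis using outside[of d] d by (auto simp: I_def)
  qed
  have cov1: "cover 2 U M1"
    unfolding cover_def
  proof (intro conjI ballI)
    fix T assume "T \<in># M1"
    then obtain i where i: "i \<in> I" "T = xs ! i" using finI by (auto simp: M1_def)
    then show "T \<subseteq> U" by (auto simp: U_def)
    have "x \<in> xs ! p" "x \<in> xs ! a" "y \<in> xs ! b" "z \<in> xs ! c"
      using mem[OF xyzA(1), of a] mem[OF xyzA(2), of b] mem[OF xyzA(3), of c] a b c p xyz by auto
    then show "T \<noteq> {}" using i by (auto simp: I_def)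
  next
    fix d assume d: "d \<in> U"
    then have dA: "d \<in> A" using UA by blast
    have "{i \<in> I. d \<in> xs ! i} = f d"
      using inside[OF d] I_sub mem[OF dA] by auto
    then show "size {#T \<in># M1. d \<in> T#} = 2" using size_at card2[OF dA] by simp
  qed
  have eq: "M = M1 + (M - M1)" using M1_sub by simp
  have "cover 2 (A - U) (M - M1)"
    by (rule cover_diff[OF _ cov1 UA]) (use M eq in \<open>simp add: covers_def\<close>)
  moreover have "restricted_cover (M - M1)"
    using hereditary_restricted M unfolding hereditary_def covers_def by (auto intro: diff_subset_eq_self)
  ultimately have N: "M - M1 \<in> covers restricted_cover (A - U)" by (simp add: covers_def)
  have SU: "S \<subseteq> U" using p by (auto simp: U_def I_def)
  have "card (U - S) \<le> card {{a, b}, {b, c}, {a, c}}"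
  proof (rule card_inj_on_le)
    show "inj_on f (U - S)" using inj UA by (auto intro: inj_on_subset)
    show "f ` (U - S) \<subseteq> {{a, b}, {b, c}, {a, c}}" using outside by auto
  qed simp
  also have "\<dots> \<le> 3" by (simp add: card_insert_if)
  finally have "card U \<le> 6"
    using S(2) SU finite_subset[OF UA A] card_Diff_subset[of S U] finite_subset[OF SU] by simp
  moreover have "size M1 = 4" using cardI by (simp add: M1_def)
  moreover have "set_mset M1 \<subseteq> Pow U" using finI by (auto simp: M1_def U_def)
  moreover have "U \<noteq> {}" using SU xyz by auto
  ultimately show ?thesis using that[OF UA _ _ _ _ eq N] by blast
qed

lemma card_multisets_le:
  assumes "finite B"
  shows "finite {N. size N = k \<and> set_mset N \<subseteq> B}" "card {N. size N = k \<and> set_mset N \<subseteq> B} \<le> card B ^ k"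
proof -
  have eq: "{N. size N = k \<and> set_mset N \<subseteq> B} = mset ` {xs. set xs \<subseteq> B \<and> length xs = k}"
  proof (intro equalityI subsetI)
    fix N assume N: "N \<in> {N. size N = k \<and> set_mset N \<subseteq> B}"
    obtain xs where "mset xs = N" using ex_mset by blast
    then show "N \<in> mset ` {xs. set xs \<subseteq> B \<and> length xs = k}" using N by (intro image_eqI[of _ _ xs]) auto
  qed auto
  show "finite {N. size N = k \<and> set_mset N \<subseteq> B}"
    unfolding eq using finite_lists_length_eq[OF assms] by simp
  show "card {N. size N = k \<and> set_mset N \<subseteq> B} \<le> card B ^ k"
    unfolding eq using card_image_le[OF finite_lists_length_eq[OF assms, of k], of mset]
    by (simp add: card_lists_length_eq[OF assms])
qed

text \<open>At most six elements are removed, so \<open>Y\<close> has to be a bound only for ground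
  sets almost as large as \<open>A\<close>, where an asymptotic estimate is available. The constant
  is (2^6)^4, for four subsets of a set with at most six elements.\<close>

lemma card_even_claw_le:
  assumes A: "finite A"
    and Y: "\<And>B. B \<subseteq> A \<Longrightarrow> card A \<le> card B + 6 \<Longrightarrow> real (card (covers restricted_cover B)) \<le> Y (card B)"
    and Y0: "\<And>j. Y j \<ge> 0"
  shows "real (card {M \<in> covers restricted_cover A. \<not> no_even_claw A M}) \<le>
    2 ^ 24 * (\<Sum>k\<in>{1..card A}. real (card A choose k) * Y (card A - k))"
proof -
  define D where "D = (\<lambda>U. (\<lambda>(M1, N). M1 + N) `
    ({M1. size M1 = 4 \<and> set_mset M1 \<subseteq> Pow U} \<times> covers restricted_cover (A - U)))"
  define \<U> where "\<U> = {U \<in> Pow A - {{}}. card U \<le> 6}"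
  have fin\<U>: "finite \<U>" using A by (simp add: \<U>_def)
  have finU: "finite U" if "U \<in> \<U>" for U using that A finite_subset by (auto simp: \<U>_def)
  have fin: "finite ({M1. size M1 = 4 \<and> set_mset M1 \<subseteq> Pow U} \<times> covers restricted_cover (A - U))"
    if "U \<in> \<U>" for U
    using finU[OF that] A by (intro finite_cartesian_product card_multisets_le finite_covers_pred) auto
  have sub: "{M \<in> covers restricted_cover A. \<not> no_even_claw A M} \<subseteq> (\<Union>U\<in>\<U>. D U)"
  proof
    fix M assume "M \<in> {M \<in> covers restricted_cover A. \<not> no_even_claw A M}"
    then have M: "M \<in> covers restricted_cover A" "\<not> no_even_claw A M" by auto
    obtain U M1 N where *: "U \<subseteq> A" "U \<noteq> {}" "card U \<le> 6" "size M1 = 4" "set_mset M1 \<subseteq> Pow U"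
      "M = M1 + N" "N \<in> covers restricted_cover (A - U)"
      by (rule even_claw_decompose[OF A M])
    then have "M \<in> D U" unfolding D_def by (intro image_eqI[of _ _ "(M1, N)"]) auto
    then show "M \<in> (\<Union>U\<in>\<U>. D U)" using * by (auto simp: \<U>_def)
  qed
  have cardD: "real (card (D U)) \<le> 2 ^ 24 * Y (card A - card U)" if U: "U \<in> \<U>" for U
  proof -
    have "card (D U) \<le> card ({M1. size M1 = 4 \<and> set_mset M1 \<subseteq> Pow U} \<times> covers restricted_cover (A - U))"
      unfolding D_def using fin[OF U] by (rule card_image_le)
    also have "\<dots> = card {M1. size M1 = 4 \<and> set_mset M1 \<subseteq> Pow U} * card (covers restricted_cover (A - U))"
      by (rule card_cartesian_product)
    finally have "real (card (D U)) \<le>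
        real (card {M1. size M1 = 4 \<and> set_mset M1 \<subseteq> Pow U}) * real (card (covers restricted_cover (A - U)))"
      unfolding of_nat_mult[symmetric] of_nat_le_iff .
    also have "\<dots> \<le> 2 ^ 24 * Y (card A - card U)"
    proof (rule mult_mono)
      have "card {M1. size M1 = 4 \<and> set_mset M1 \<subseteq> Pow U} \<le> card (Pow U) ^ 4"
        using finU[OF U] by (intro card_multisets_le) auto
      also have "\<dots> = (2 ^ card U) ^ 4" using finU[OF U] by (simp add: card_Pow)
      also have "\<dots> \<le> (2 ^ 6) ^ 4" using U by (intro power_mono power_increasing) (auto simp: \<U>_def)
      finally have "card {M1. size M1 = 4 \<and> set_mset M1 \<subseteq> Pow U} \<le> 2 ^ 24" by simp
      then have "real (card {M1. size M1 = 4 \<and> set_mset M1 \<subseteq> Pow U}) \<le> real (2 ^ 24)" by (rule of_nat_mono)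
      then show "real (card {M1. size M1 = 4 \<and> set_mset M1 \<subseteq> Pow U}) \<le> 2 ^ 24" by simp
      have "card (A - U) = card A - card U" using U finU[OF U] by (simp add: card_Diff_subset \<U>_def)
      moreover have "card U \<le> 6" using U by (simp add: \<U>_def)
      ultimately have "card A \<le> card (A - U) + 6" by linarith
      then show "real (card (covers restricted_cover (A - U))) \<le> Y (card A - card U)"
        using Y[of "A - U"] \<open>card (A - U) = card A - card U\<close> by auto
    qed auto
    finally show ?thesis .
  qed
  have "finite (\<Union>U\<in>\<U>. D U)" using fin\<U> fin by (auto simp: D_def)
  then have "card {M \<in> covers restricted_cover A. \<not> no_even_claw A M} \<le> card (\<Union>U\<in>\<U>. D U)"
    using sub by (rule card_mono)
  also have "\<dots> \<le> (\<Sum>U\<in>\<U>. card (D U))"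
    using fin\<U> by (rule card_UN_le)
  finally have "real (card {M \<in> covers restricted_cover A. \<not> no_even_claw A M}) \<le> (\<Sum>U\<in>\<U>. real (card (D U)))"
    by (metis of_nat_le_iff of_nat_sum)
  also have "\<dots> \<le> (\<Sum>U\<in>\<U>. 2 ^ 24 * Y (card A - card U))"
    using cardD by (rule sum_mono)
  also have "\<dots> \<le> (\<Sum>U\<in>Pow A - {{}}. 2 ^ 24 * Y (card A - card U))"
    using A Y0 by (intro sum_mono2) (auto simp: \<U>_def)
  also have "\<dots> = 2 ^ 24 * (\<Sum>k\<in>{1..card A}. real (card A choose k) * Y (card A - k))"
    unfolding sum_distrib_left[symmetric] using sum_Pow_card[OF A, of "\<lambda>k. Y (card A - k)"] by simp
  finally show ?thesis .
qed

section \<open>Counting line graphs\<close>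

text \<open>What remains after removing a claw component may be nonproper and lives on a general
  finite set, so all covers of such sets need a bound: the nonproper ones add at most another
  \<open>X (card B)\<close>.\<close>

lemma card_covers_eventually_le:
  assumes Q: "hereditary Q" and X: "slowly_decaying X"
    and weight: "\<And>B. finite B \<Longrightarrow> (\<Sum>M\<in>covers Q B. weight M) = X (card B)"
  shows "\<exists>j0. \<forall>B. finite B \<longrightarrow> j0 \<le> card B \<longrightarrow> real (card (covers Q B)) \<le> 2 * X (card B)"
proof -
  define E where "E = (\<lambda>n. \<Sum>k\<in>{1..n}. real (n choose k) * (real k ^ k * X (n - k)))"
  have "(\<lambda>n. E n / X n) \<longlonglongrightarrow> 0" unfolding E_def by (rule convolution_negligible[OF X])
  then have "\<forall>\<^sub>F n in sequentially. E n / X n < 1" by (rule order_tendstoD) simp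
  moreover have "\<forall>\<^sub>F n in sequentially. X n > 0"
    using X by (auto simp: slowly_decaying_def elim: eventually_mono)
  ultimately have "\<forall>\<^sub>F n in sequentially. E n \<le> X n"
    by eventually_elim (simp add: field_simps)
  then obtain j0 where j0: "\<And>n. n \<ge> j0 \<Longrightarrow> E n \<le> X n" by (auto simp: eventually_sequentially)
  have "real (card (covers Q B)) \<le> 2 * X (card B)" if B: "finite B" "j0 \<le> card B" for B
  proof -
    let ?P = "covers (\<lambda>M. Q M \<and> proper_cover M) B"
    have sub: "?P \<subseteq> covers Q B" by (auto simp: covers_def)
    have "covers Q B = ?P \<union> (covers Q B - ?P)" using sub by blast
    then have "card (covers Q B) \<le> card ?P + card (covers Q B - ?P)" by (metis card_Un_le)
    then have "real (card (covers Q B)) \<le> real (card ?P) + real (card (covers Q B - ?P))" by linarith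
    also have "real (card ?P) \<le> X (card B)" using card_proper_le_weight_sum[OF B(1), of Q] weight[OF B(1)] by simp
    also have "real (card (covers Q B - ?P)) \<le> E (card B)"
      unfolding E_def by (rule card_nonproper_le[OF B(1) Q weight])
    also have "E (card B) \<le> X (card B)" by (rule j0[OF B(2)])
    finally show ?thesis by simp
  qed
  then show ?thesis by blast
qed

lemma card_line_graphs_asymp_equiv:
  defines "X \<equiv> \<lambda>n. restricted_series n / exp 1"
  shows "(\<lambda>n. real (card {H. labelled_line_graph n H})) \<sim>[at_top] X"
proof -
  let ?C = "\<lambda>n. covers restricted_cover {1..n} :: nat set multiset set"
  let ?B = "\<lambda>n. {M \<in> ?C n. \<not> no_even_claw {1..n} M}"
  let ?P = "\<lambda>n. {M \<in> ?C n. no_even_claw {1..n} M}"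
  define E where "E = (\<lambda>n. \<Sum>k\<in>{1..n}. real (n choose k) * (real k ^ k * X (n - k)))"
  have X: "slowly_decaying X" unfolding X_def by (rule slowly_decaying_series)
  have X0: "X n \<ge> 0" for n using X by (simp add: slowly_decaying_def)
  have weight: "(\<Sum>M\<in>covers restricted_cover B. weight M) = X (card B)" if "finite B" for B :: "nat set"
    using weight_sum_covers(2)[OF that] by (simp add: X_def)
  obtain j0 where j0: "\<And>B :: nat set. finite B \<Longrightarrow> j0 \<le> card B \<Longrightarrow>
      real (card (covers restricted_cover B)) \<le> 2 * X (card B)"
    using card_covers_eventually_le[OF hereditary_restricted X weight] by blast
  \<comment> \<open>The margin 6 keeps the ground set above the threshold \<open>j0\<close> after
    the removal; the constant doubles to 2^25 because the remainder is bounded by twice the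
    series.\<close>
  have bad: "\<forall>\<^sub>F n in sequentially. real (card (?B n)) \<le> 2 ^ 25 * E n"
    using eventually_ge_at_top[of "j0 + 6"]
  proof eventually_elim
    case (elim n)
    have "real (card (?B n)) \<le> 2 ^ 24 * (\<Sum>k\<in>{1..card {1..n}}. real (card {1..n} choose k) * (2 * X (card {1..n} - k)))"
    proof (rule card_even_claw_le)
      fix B :: "nat set" assume "B \<subseteq> {1..n}" "card {1..n} \<le> card B + 6"
      then show "real (card (covers restricted_cover B)) \<le> 2 * X (card B)"
        using elim by (intro j0) (auto intro: finite_subset)
    qed (use X0 in auto)
    also have "\<dots> = 2 ^ 25 * (\<Sum>k\<in>{1..n}. real (n choose k) * X (n - k))"
      by (simp add: sum_distrib_left mult_ac)
    \<comment> \<open>Inserting k^k \<ge> 1 makes the convolution estimate for repeated sets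
      applicable here.\<close>
    also have "\<dots> \<le> 2 ^ 25 * E n"
      unfolding E_def
    proof (intro mult_left_mono sum_mono)
      fix k assume "k \<in> {1..n}"
      then have "1 * X (n - k) \<le> real k ^ k * X (n - k)"
        using X0 by (intro mult_right_mono one_le_power) auto
      then show "X (n - k) \<le> real k ^ k * X (n - k)" by simp
    qed auto
    finally show ?case .
  qed
  have "(\<lambda>n. 2 ^ 25 * (E n / X n)) \<longlonglongrightarrow> 2 ^ 25 * 0"
    unfolding E_def by (intro tendsto_mult tendsto_const convolution_negligible[OF X])
  then have E0: "(\<lambda>n. (2 ^ 25 * E n) / X n) \<longlonglongrightarrow> 0" by simp
  have finC: "finite (?C n)" for n by (rule finite_covers_pred) simp
  have lower: "card (?P n) \<le> card {H. labelled_line_graph n H}" for n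
    unfolding labelled_line_graphs_eq
    using finC by (intro card_inj_on_le[OF intersection_graph_inj_on]) auto
  have upper: "card {H. labelled_line_graph n H} \<le> card (?C n)" for n
    unfolding labelled_line_graphs_eq using finC by (rule card_image_le)
  have split: "real (card (?C n)) = real (card (?P n)) + real (card (?B n))" for n
  proof -
    have "?C n = ?P n \<union> ?B n" by blast
    moreover have "card (?P n \<union> ?B n) = card (?P n) + card (?B n)"
      using finC by (intro card_Un_disjoint) auto
    ultimately show ?thesis by simp
  qed
  have pos: "\<forall>\<^sub>F n in sequentially. real (card (?C n)) > 0"
  proof -
    have "\<forall>\<^sub>F n in sequentially. X n > 0"
      using X by (auto simp: slowly_decaying_def elim: eventually_mono)
    then show ?thesis
    proof eventually_elim
      case (elim n)
      then show ?case using weight_sum_le_card[of restricted_cover "{1..n}"] weight[of "{1..n}"] by simp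
    qed
  qed
  have u: "(\<lambda>n. real (card (?C n))) \<sim>[at_top] X"
    by (rule card_covers_asymp_equiv(1)[OF hereditary_restricted X weight])
  have "(\<lambda>n. real (card {H. labelled_line_graph n H})) \<sim>[at_top] (\<lambda>n. real (card (?C n)))"
  proof (rule sandwich_asymp_equiv[where P = "\<lambda>n. real (card (?P n))" and N = "\<lambda>n. real (card (?C n))"
        and E = "\<lambda>n. 2 ^ 25 * E n"])
    show "real (card (?P n)) \<le> real (card (?C n))" for n using split[of n] by simp
    show "\<forall>\<^sub>F n in sequentially. real (card (?C n)) - real (card (?P n)) \<le> 2 ^ 25 * E n"
      using bad
    proof eventually_elim
      case (elim n)
      then show ?case using split[of n] by linarith
    qed
    show "(\<lambda>n. 2 ^ 25 * E n / real (card (?C n))) \<longlonglongrightarrow> 0"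
      using asymp_equiv_tendsto_transfer[OF asymp_equiv_divide[OF asymp_equiv_refl asymp_equiv_symI[OF u]] E0] .
  qed (use lower upper pos in auto)
  then show ?thesis using u by (rule asymp_equiv_trans)
qed

theorem theorem1:
  fixes s t u v l :: "nat \<Rightarrow> real"
  assumes s: "\<And>n. s n = real (card {M. two_cover n M})"
    and t: "\<And>n. t n = real (card {M. two_cover n M \<and> proper_cover M})"
    and u: "\<And>n. u n = real (card {M. two_cover n M \<and> restricted_cover M})"
    and v: "\<And>n. v n = real (card {M. two_cover n M \<and> restricted_cover M \<and> proper_cover M})"
    and l: "\<And>n. l n = real (card {H. labelled_line_graph n H})"
  shows "s \<sim>[at_top] t \<and>
         t \<sim>[at_top] (\<lambda>n. real (bell (2 * n)) / 2 ^ n * exp (- (1 / 2) * ln (2 * real n / ln (real n)))) \<and>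
         u \<sim>[at_top] v \<and>
         v \<sim>[at_top] l \<and>
         l \<sim>[at_top] (\<lambda>n. real (bell (2 * n)) / 2 ^ n * real n powr (- 1 / 2) *
                            exp (- (1 / 2 * ln (2 * real n / ln (real n)))\<^sup>2))"
proof -
  define X where "X = (\<lambda>n. cover_series n / exp 1)"
  define R where "R = (\<lambda>n. restricted_series n / exp 1)"
  have X: "slowly_decaying X" and R: "slowly_decaying R"
    unfolding X_def R_def by (rule slowly_decaying_series)+
  have wX: "(\<Sum>M\<in>covers (\<lambda>_. True) B. weight M) = X (card B)"
    and wR: "(\<Sum>M\<in>covers restricted_cover B. weight M) = R (card B)" if "finite B" for B :: "nat set"
    using weight_sum_covers[OF that] by (simp_all add: X_def R_def)
  have her: "hereditary (\<lambda>_ :: nat set multiset. True)" by (simp add: hereditary_def)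
  have s': "s = (\<lambda>n. real (card (covers (\<lambda>_. True) {1..n})))"
    and t': "t = (\<lambda>n. real (card (covers (\<lambda>M. True \<and> proper_cover M) {1..n})))"
    and u': "u = (\<lambda>n. real (card (covers restricted_cover {1..n})))"
    and v': "v = (\<lambda>n. real (card (covers (\<lambda>M. restricted_cover M \<and> proper_cover M) {1..n})))"
    by (simp_all add: fun_eq_iff s t u v covers_def two_cover_eq_cover)
  have sX: "s \<sim>[at_top] X" and tX: "t \<sim>[at_top] X"
    unfolding s' t' using card_covers_asymp_equiv[OF her X wX] by simp_all
  have uR: "u \<sim>[at_top] R" and vR: "v \<sim>[at_top] R"
    unfolding u' v' using card_covers_asymp_equiv[OF hereditary_restricted R wR] by simp_all
  have lR: "l \<sim>[at_top] R"
    using card_line_graphs_asymp_equiv by (simp add: l[abs_def] R_def)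
  \<comment> \<open>The factor e of Dobinski's formula cancels the one in the weighted
    counts.\<close>
  have bell: "dobinski n / 2 ^ n * w / exp 1 = real (bell (2 * n)) / 2 ^ n * w" for n w
    by (simp add: dobinski_eq_bell)
  have "X \<sim>[at_top] (\<lambda>n. dobinski n / 2 ^ n * exp (- saddle n / 2) / exp 1)"
    unfolding X_def by (intro asymp_equiv_divide cover_series_asymp_equiv asymp_equiv_refl)
  also have "\<dots> \<sim>[at_top] (\<lambda>n. real (bell (2 * n)) / 2 ^ n * exp (- (1 / 2) * ln (2 * real n / ln (real n))))"
    unfolding bell by (intro asymp_equiv_mult saddle_asymp_equiv asymp_equiv_refl)
  finally have X_bell: "X \<sim>[at_top] \<dots>" .
  have "R \<sim>[at_top] (\<lambda>n. dobinski n / 2 ^ n * exp (- saddle n / 2 - (saddle n)\<^sup>2 / 4) / exp 1)"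
    unfolding R_def by (intro asymp_equiv_divide restricted_series_asymp_equiv asymp_equiv_refl)
  also have "\<dots> \<sim>[at_top] (\<lambda>n. real (bell (2 * n)) / 2 ^ n *
      (real n powr (- 1 / 2) * exp (- (1 / 2 * ln (2 * real n / ln (real n)))\<^sup>2)))"
    unfolding bell by (intro asymp_equiv_mult[OF asymp_equiv_refl] saddle_asymp_equiv)
  finally have R_bell: "R \<sim>[at_top] (\<lambda>n. real (bell (2 * n)) / 2 ^ n * real n powr (- 1 / 2) *
      exp (- (1 / 2 * ln (2 * real n / ln (real n)))\<^sup>2))"
    by (simp only: mult.assoc)
  show ?thesis
    using asymp_equiv_trans[OF sX asymp_equiv_symI[OF tX]] asymp_equiv_trans[OF tX X_bell]
      asymp_equiv_trans[OF uR asymp_equiv_symI[OF vR]] asymp_equiv_trans[OF vR asymp_equiv_symI[OF lR]]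
      asymp_equiv_trans[OF lR R_bell]
    by blast
qed

end
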